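(* Let $K$ be a field, let $\mathcal{F}:f(X,Y)=0$ be a (geometrically) irreducible plane curve of degree $d$ defined over $K$, and let $x,y\in K(\mathcal{F})$ be such that $K(\mathcal{F})=K(x,y)$ and $f(x,y)=0$. Let $l,m$ be non-negative integers. The following assertions are equivalent: (a) The functions $x$ and $y$ have no common poles, with $\deg(\mathrm{div}(x)_\infty)=l$ and $\deg(\mathrm{div}(y)_\infty)=m$. (b) Up to multiplying $f$ by a nonzero constant of $K$, $f(X,Y)=X^mY^l+g(X,Y)$, where $g(X,Y)\in K[X,Y]$ is a polynomial of degree $n<d=m+l$ such that the degree of $g$ in the variable $X$ is $\leq m$ and the degree of $g$ in the variable $Y$ is $\leq l$. (c) The points $O_1=(1:0:0)$ and $O_2=(0:1:0)$ have respective multiplicities $l$ and $m$ on $\mathcal{F}$, and $m+l=d$.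
   Context: $\mathcal{F}$ denotes the projective plane curve with affine equation $f(X,Y)=0$ in the coordinates $(X:Y:1)$ of the projective plane with homogeneous coordinates $(X:Y:Z)$, where $f\in K[X,Y]$ has degree $d$. $K(\mathcal{F})$ is the function field of $\mathcal{F}$, and $\mathrm{div}(h)_\infty$ denotes the pole divisor of a function $h$ on a non-singular model of $\mathcal{F}$ (whose points correspond to the branches of $\mathcal{F}$). *)

theory Defs
  imports "HOL-Algebra.Algebraic_Closure_Type" "HOL-Computational_Algebra.Polynomial"
begin

section \<open>Bivariate polynomials\<close>

text \<open>
  A polynomial of $K[X,Y]$ is an element of $K[X][Y]$: the coefficient of $X^i Y^j$ in \<open>f\<close> is
  \<open>coeff (coeff f j) i\<close>, and \<open>degree f\<close> is the degree in $Y$.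
\<close>

definition monomials :: "'a::zero poly poly \<Rightarrow> (nat \<times> nat) set" where
  "monomials f = {(i, j). coeff (coeff f j) i \<noteq> 0}"

text \<open>Both degrees below are 0 for the zero polynomial, like \<^const>\<open>degree\<close>.\<close>

definition total_degree :: "'a::zero poly poly \<Rightarrow> nat" where
  "total_degree f = (if f = 0 then 0 else Max ((\<lambda>(i, j). i + j) ` monomials f))"

definition degree_X :: "'a::zero poly poly \<Rightarrow> nat" where
  "degree_X f = (if f = 0 then 0 else Max (fst ` monomials f))"

abbreviation degree_Y :: "'a::zero poly poly \<Rightarrow> nat" where
  "degree_Y f \<equiv> degree f"

definition const2 :: "'a::zero \<Rightarrow> 'a poly poly" where
  "const2 c = [:[:c:]:]"

definition geometrically_irreducible :: "'a::field poly poly \<Rightarrow> bool" where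
  "geometrically_irreducible f \<longleftrightarrow> irreducible (map_poly (map_poly to_ac) f)"


section \<open>Multiplicity of a point on a projective plane curve\<close>

text \<open>
  With $d = \deg f$, the homogenization of \<open>f\<close> is
  $F(X,Y,Z) = \sum_{i,j} a_{ij} X^i Y^j Z^{d-i-j}$; here its variables are replaced by elements
  \<open>A\<close>, \<open>B\<close>, \<open>C\<close> of $K[U,V]$.
\<close>

definition homogenization_subst ::
    "'a::field poly poly \<Rightarrow> 'a poly poly \<Rightarrow> 'a poly poly \<Rightarrow> 'a poly poly \<Rightarrow> 'a poly poly" where
  "homogenization_subst f A B C =
     (\<Sum>(i, j)\<in>monomials f.
        const2 (coeff (coeff f j) i) * A ^ i * B ^ j * C ^ (total_degree f - i - j))"

text \<open>
  The equation of the curve in an affine chart containing the point $(a:b:c)$, in affine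
  coordinates $U,V$ of that chart translated so that the point becomes the origin.
\<close>

definition local_equation :: "'a::field poly poly \<Rightarrow> 'a \<times> 'a \<times> 'a \<Rightarrow> 'a poly poly" where
  "local_equation f = (\<lambda>(a, b, c).
     let U = [:[:0, 1:]:]; V = [:0, 1:] in
     if c \<noteq> 0 then homogenization_subst f (const2 (a / c) + U) (const2 (b / c) + V) 1
     else if b \<noteq> 0 then homogenization_subst f (const2 (a / b) + U) 1 (const2 (c / b) + V)
     else homogenization_subst f 1 (const2 (b / a) + U) (const2 (c / a) + V))"

text \<open>
  The multiplicity is the lowest degree of a monomial of the local equation; it is 0 for points
  not on the curve.
\<close>

definition point_multiplicity :: "'a::field poly poly \<Rightarrow> 'a \<times> 'a \<times> 'a \<Rightarrow> nat" where
  "point_multiplicity f P = Min ((\<lambda>(i, j). i + j) ` monomials (local_equation f P))"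


section \<open>The function field of a plane curve\<close>

text \<open>A field extension $L/K$ is given by an embedding \<open>\<iota>\<close> of the type \<open>K\<close> into the type \<open>L\<close>.\<close>

definition field_embedding :: "('a::field \<Rightarrow> 'f::field) \<Rightarrow> bool" where
  "field_embedding \<iota> \<longleftrightarrow>
     \<iota> 1 = 1 \<and> (\<forall>a b. \<iota> (a + b) = \<iota> a + \<iota> b) \<and> (\<forall>a b. \<iota> (a * b) = \<iota> a * \<iota> b)"

definition eval2 :: "('a::field \<Rightarrow> 'f::field) \<Rightarrow> 'a poly poly \<Rightarrow> 'f \<Rightarrow> 'f \<Rightarrow> 'f" where
  "eval2 \<iota> g x y = poly (map_poly (\<lambda>p. poly (map_poly \<iota> p) x) g) y"

text \<open>The subfield $K(x,y)$.\<close>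

definition adjoin2 :: "('a::field \<Rightarrow> 'f::field) \<Rightarrow> 'f \<Rightarrow> 'f \<Rightarrow> 'f set" where
  "adjoin2 \<iota> x y = {eval2 \<iota> g x y / eval2 \<iota> h x y | g h. eval2 \<iota> h x y \<noteq> 0}"

text \<open>
  \<open>L\<close> is the fraction field of $K[X,Y]/(f)$: the images \<open>\<xi>\<close>, \<open>\<eta>\<close> of $X$ and $Y$ (the coordinate
  functions) satisfy exactly the relations in the ideal $(f)$, and they generate \<open>L\<close> over \<open>K\<close>.
\<close>

definition is_function_field :: "'a::field poly poly \<Rightarrow> ('a \<Rightarrow> 'f::field) \<Rightarrow> bool" where
  "is_function_field f \<iota> \<longleftrightarrow> field_embedding \<iota> \<and>
     (\<exists>\<xi> \<eta>. (\<forall>g. eval2 \<iota> g \<xi> \<eta> = 0 \<longleftrightarrow> f dvd g) \<and> adjoin2 \<iota> \<xi> \<eta> = UNIV)"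


section \<open>Places and pole divisors\<close>

text \<open>
  The points of the non-singular model over \<open>K\<close> are the places of $L/K$, represented by their
  normalized discrete valuations, trivial on \<open>K\<close>.  The value at 0, mathematically $\infty$, is set
  to the dummy 0, so that each place is represented by exactly one function.
\<close>

definition is_place :: "('a::field \<Rightarrow> 'f::field) \<Rightarrow> ('f \<Rightarrow> int) \<Rightarrow> bool" where
  "is_place \<iota> v \<longleftrightarrow>
     v 0 = 0 \<and>
     (\<forall>a b. a \<noteq> 0 \<longrightarrow> b \<noteq> 0 \<longrightarrow> v (a * b) = v a + v b) \<and>
     (\<forall>a b. a \<noteq> 0 \<longrightarrow> b \<noteq> 0 \<longrightarrow> a + b \<noteq> 0 \<longrightarrow> min (v a) (v b) \<le> v (a + b)) \<and>
     (\<forall>c. v (\<iota> c) = 0) \<and>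
     surj v"

definition valuation_ring :: "('f::field \<Rightarrow> int) \<Rightarrow> 'f set" where
  "valuation_ring v = {z. z = 0 \<or> v z \<ge> 0}"

definition place_ideal :: "('f::field \<Rightarrow> int) \<Rightarrow> 'f set" where
  "place_ideal v = {z. z = 0 \<or> v z > 0}"

text \<open>
  The residue classes of the elements of \<open>B\<close> are distinct and form a finite \<open>K\<close>-basis of the residue
  field of \<open>v\<close>, the quotient of \<open>valuation_ring v\<close> by \<open>place_ideal v\<close>: every residue class is a
  \<open>K\<close>-linear combination of them with unique coefficients.
\<close>

definition residue_basis :: "('a::field \<Rightarrow> 'f::field) \<Rightarrow> ('f \<Rightarrow> int) \<Rightarrow> 'f set \<Rightarrow> bool" where
  "residue_basis \<iota> v B \<longleftrightarrow>
     finite B \<and> B \<subseteq> valuation_ring v \<and>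
     (\<forall>z\<in>valuation_ring v.
        \<exists>!c. (\<forall>b. b \<notin> B \<longrightarrow> c b = 0) \<and> z - (\<Sum>b\<in>B. \<iota> (c b) * b) \<in> place_ideal v)"

definition place_degree :: "('a::field \<Rightarrow> 'f::field) \<Rightarrow> ('f \<Rightarrow> int) \<Rightarrow> nat" where
  "place_degree \<iota> v = (THE n. \<exists>B. residue_basis \<iota> v B \<and> card B = n)"

text \<open>Divisors are integer-valued functions on the set of places (extended by 0 elsewhere).\<close>

definition pole_divisor ::
    "('a::field \<Rightarrow> 'f::field) \<Rightarrow> 'f \<Rightarrow> ('f \<Rightarrow> int) \<Rightarrow> int" where
  "pole_divisor \<iota> h v = (if is_place \<iota> v then max 0 (- v h) else 0)"

definition divisor_degree ::
    "('a::field \<Rightarrow> 'f::field) \<Rightarrow> (('f \<Rightarrow> int) \<Rightarrow> int) \<Rightarrow> int" where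
  "divisor_degree \<iota> D = (\<Sum>v | is_place \<iota> v \<and> D v \<noteq> 0. D v * int (place_degree \<iota> v))"

definition is_pole_at :: "('f::field \<Rightarrow> int) \<Rightarrow> 'f \<Rightarrow> bool" where
  "is_pole_at v h \<longleftrightarrow> v h < 0"

end

theory Submission
  imports Defs
begin

text \<open>
  All three assertions turn out to be statements about the bidegree $(m,l)$ of \<open>f\<close>, that is, its
  degrees $m$ in $X$ and $l$ in $Y$, and about the coefficient of \<open>f\<close> at the corner $X^m Y^l$ of the
  box of exponents that it fills.  Each of (a), (b) and (c) says that the bidegree is $(m,l)$ and
  that the corner coefficient is nonzero.

  For (b) and (c) this is elementary.  In the chart around $(1:0:0)$ the monomial $X^i Y^j$ of \<open>f\<close>
  becomes $U^j V^{d-i-j}$, of degree $d-i$, so that the multiplicity there is $d$ minus the degree of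
  \<open>f\<close> in $X$; symmetrically at $(0:1:0)$.  And $d$ is the sum of the two partial degrees exactly
  when the corner monomial occurs in \<open>f\<close>.

  For (a), the first point is that \<open>x\<close> and \<open>y\<close>, being generators of the function field that satisfy
  \<open>f\<close>, satisfy no relations but the multiples of \<open>f\<close> (\<open>other_generators\<close>).  Hence, if \<open>x\<close> is
  transcendental, $1, y, \dots, y^{l-1}$ is a basis of $L$ over $K(x)$, and the equality
  $\deg(\mathrm{div}(x)_\infty) = [L:K(x)]$ gives the value $l$ for the degree of the poles of \<open>x\<close>;
  exchanging the variables gives $m$ for \<open>y\<close>.  The second point is that \<open>x\<close> and \<open>y\<close> have a common pole
  if and only if the corner coefficient vanishes.  If it does not vanish, the corner monomial has
  strictly smaller value at a common pole than all the others, and $f(x,y)$ could not be 0.  If it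
  vanishes, $1/x$ and $1/y$ generate a proper ideal of $K[1/x,1/y]$, since in a multiple of \<open>f\<close> the
  corner coefficient also vanishes, and a place that is centred at this ideal is a common pole.

  Two parts of the theory of function fields in one variable carry this argument.  The existence of
  places with a given centre (\<open>place_exists\<close>) follows Chevalley: a subring that is maximal among those
  in which the given ideal stays proper is a valuation ring, and it is discrete because $L$ is finite
  over $K(t)$ for every transcendental $t$, which bounds the length of chains of divisors of $t$.
  The equality $\deg(\mathrm{div}(x)_\infty) = [L:K(x)]$ (\<open>degree_of_pole_divisor\<close>) consists of two
  inequalities.  For $\le$, weak approximation lifts the products of powers of uniformizers with bases
  of the residue fields to elements that are independent over $K(x)$.  For $\ge$, let $z_i$ be a basis
  of $L$ over $K(x)$ with poles only at the poles of \<open>x\<close>.  The linear combinations over $K$ of the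
  functions $x^k z_i$ with $k \le r$ are determined by their principal parts and constant terms at the
  poles of \<open>x\<close>, and the comparison of dimensions for growing $r$ gives the inequality.
\<close>

section \<open>Subrings, subfields and spans\<close>

text \<open>
  Subrings and subfields are plain subsets of a type, because the fields $K(x)$, $K(y)$ and $K(t)$,
  and the rings to which Zorn's lemma is applied, all live inside the one field $L$.
\<close>
definition is_subring :: "'r::comm_ring_1 set \<Rightarrow> bool" where
  "is_subring A \<longleftrightarrow> 1 \<in> A \<and> (\<forall>a\<in>A. \<forall>b\<in>A. a - b \<in> A \<and> a * b \<in> A)"

definition is_subfield :: "'f::field set \<Rightarrow> bool" where
  "is_subfield E \<longleftrightarrow> is_subring E \<and> (\<forall>a\<in>E. inverse a \<in> E)"

lemma subring_1: "is_subring A \<Longrightarrow> 1 \<in> A"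
  and subring_diff: "is_subring A \<Longrightarrow> a \<in> A \<Longrightarrow> b \<in> A \<Longrightarrow> a - b \<in> A"
  and subring_mult: "is_subring A \<Longrightarrow> a \<in> A \<Longrightarrow> b \<in> A \<Longrightarrow> a * b \<in> A"
  by (auto simp: is_subring_def)

lemma subring_0: "is_subring A \<Longrightarrow> 0 \<in> A"
  using subring_1 subring_diff by fastforce

lemma subring_uminus: "is_subring A \<Longrightarrow> a \<in> A \<Longrightarrow> - a \<in> A"
  using subring_0 subring_diff by fastforce

lemma subring_add: "is_subring A \<Longrightarrow> a \<in> A \<Longrightarrow> b \<in> A \<Longrightarrow> a + b \<in> A"
  using subring_uminus[of A b] subring_diff[of A a "-b"] by simp

lemma subring_power: "is_subring A \<Longrightarrow> a \<in> A \<Longrightarrow> a ^ k \<in> A"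
  by (induction k) (auto intro: subring_1 subring_mult)

lemma subring_sum: "is_subring A \<Longrightarrow> (\<And>i. i \<in> I \<Longrightarrow> g i \<in> A) \<Longrightarrow> sum g I \<in> A"
  by (induction I rule: infinite_finite_induct) (auto intro: subring_0 subring_add)

lemma subring_poly:
  "is_subring A \<Longrightarrow> (\<And>i. coeff p i \<in> A) \<Longrightarrow> z \<in> A \<Longrightarrow> poly p z \<in> A"
  unfolding poly_altdef by (intro subring_sum subring_mult subring_power) auto

lemma subring_UNIV: "is_subring UNIV"
  by (simp add: is_subring_def)

lemma subfield_subring: "is_subfield E \<Longrightarrow> is_subring E"
  by (simp add: is_subfield_def)

lemma subfield_divide: "is_subfield E \<Longrightarrow> a \<in> E \<Longrightarrow> b \<in> E \<Longrightarrow> a / b \<in> E"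
  by (simp add: is_subfield_def is_subring_def divide_inverse)

text \<open>
  Gaussian elimination without division: a pivot entry removes one coordinate and one vector.
  It is done over a subring so that it covers both $K$ itself and the subfields of $L$.
\<close>
lemma dependent_if_more_vectors_than_coordinates:
  fixes a :: "'i \<Rightarrow> 'j \<Rightarrow> 'r::idom"
  assumes "is_subring A" "finite J" "finite I" "card J < card I"
    and "\<And>i j. i \<in> I \<Longrightarrow> j \<in> J \<Longrightarrow> a i j \<in> A"
  shows "\<exists>c. (\<forall>i\<in>I. c i \<in> A) \<and> (\<exists>i\<in>I. c i \<noteq> 0) \<and> (\<forall>j\<in>J. (\<Sum>i\<in>I. c i * a i j) = 0)"
  using assms(2-5)
proof (induction J arbitrary: I a rule: finite_induct)
  case empty
  then show ?case
    by (intro exI[of _ "\<lambda>_. 1"]) (use subring_1[OF assms(1)] in \<open>auto simp: card_gt_0_iff\<close>)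
next
  case (insert q J)
  have fI: "finite I" and cI: "card J + 1 < card I" and aA: "\<And>i j. i \<in> I \<Longrightarrow> j \<in> insert q J \<Longrightarrow> a i j \<in> A"
    using insert by auto
  show ?case
  proof (cases "\<exists>p\<in>I. a p q \<noteq> 0")
    case False
    have "card J < card I" using cI by simp
    then obtain c where "\<forall>i\<in>I. c i \<in> A" "\<exists>i\<in>I. c i \<noteq> 0" "\<forall>j\<in>J. (\<Sum>i\<in>I. c i * a i j) = 0"
      using insert.IH[OF fI, of a] aA by auto
    then show ?thesis using False by (intro exI[of _ c]) auto
  next
    case True
    then obtain p where p: "p \<in> I" "a p q \<noteq> 0" by auto
    \<comment> \<open>row \<open>i\<close> after elimination of column \<open>q\<close> with the pivot row \<open>p\<close>\<close>
    define a' where "a' i j = a p q * a i j - a i q * a p j" for i j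
    have a'A: "a' i j \<in> A" if "i \<in> I - {p}" "j \<in> J" for i j
      unfolding a'_def using that p aA assms(1) by (intro subring_diff subring_mult) auto
    have "card J < card (I - {p})" using cI p fI by simp
    from insert.IH[of "I - {p}" a', OF _ this a'A] fI obtain c' where c': "\<forall>i\<in>I-{p}. c' i \<in> A"
       "\<exists>i\<in>I-{p}. c' i \<noteq> 0" "\<forall>j\<in>J. (\<Sum>i\<in>I-{p}. c' i * a' i j) = 0" by auto
    define s where "s = - (\<Sum>i\<in>I-{p}. c' i * a i q)"
    define c where "c i = (if i = p then s else c' i * a p q)" for i
    have sum_c: "(\<Sum>i\<in>I. c i * a i j) = s * a p j + (\<Sum>i\<in>I-{p}. c' i * a p q * a i j)" for j
    proof -
      have "(\<Sum>i\<in>I. c i * a i j) = c p * a p j + (\<Sum>i\<in>I-{p}. c i * a i j)"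
        using p fI by (simp add: sum.remove)
      then show ?thesis by (simp add: c_def cong: sum.cong_simp)
    qed
    have "(\<Sum>i\<in>I. c i * a i j) = 0" if "j \<in> insert q J" for j
    proof (cases "j = q")
      case True
      then show ?thesis unfolding sum_c s_def
        by (simp add: sum_distrib_left mult_ac)
    next
      case False
      then have "(\<Sum>i\<in>I-{p}. c' i * a' i j) = 0" using that c' by auto
      also have "(\<Sum>i\<in>I-{p}. c' i * a' i j) = s * a p j + (\<Sum>i\<in>I-{p}. c' i * a p q * a i j)"
        unfolding a'_def s_def by (simp add: algebra_simps sum_subtractf sum_distrib_left)
      finally show ?thesis unfolding sum_c .
    qed
    moreover have "s \<in> A" unfolding s_def
      using c'(1) aA by (intro subring_uminus subring_sum subring_mult assms(1)) auto
    ultimately show ?thesis using c'(1,2) p aA assms(1)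
      by (intro exI[of _ c]) (auto simp: c_def intro!: subring_mult)
  qed
qed

text \<open>
  The spanning vectors are an indexed family and not a set: powers of an element need not be
  pairwise distinct.
\<close>
definition Span :: "'f::field set \<Rightarrow> ('i \<Rightarrow> 'f) \<Rightarrow> 'i set \<Rightarrow> 'f set" where
  "Span E w J = {\<Sum>j\<in>J. a j * w j | a. \<forall>j\<in>J. a j \<in> E}"

lemma SpanI: "(\<And>j. j \<in> J \<Longrightarrow> a j \<in> E) \<Longrightarrow> (\<Sum>j\<in>J. a j * w j) \<in> Span E w J"
  by (auto simp: Span_def)

lemma Span_add:
  assumes "is_subring E" "u \<in> Span E w J" "v \<in> Span E w J" shows "u + v \<in> Span E w J"
proof -
  from assms obtain a b where "u = (\<Sum>j\<in>J. a j * w j)" "v = (\<Sum>j\<in>J. b j * w j)"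
    "\<forall>j\<in>J. a j \<in> E" "\<forall>j\<in>J. b j \<in> E" by (auto simp: Span_def)
  then show ?thesis using assms(1) SpanI[of J "\<lambda>j. a j + b j" E w]
    by (auto simp: sum.distrib distrib_right intro: subring_add)
qed

lemma Span_scale:
  assumes "is_subring E" "e \<in> E" "u \<in> Span E w J" shows "e * u \<in> Span E w J"
proof -
  from assms obtain a where "u = (\<Sum>j\<in>J. a j * w j)" "\<forall>j\<in>J. a j \<in> E" by (auto simp: Span_def)
  then show ?thesis using assms SpanI[of J "\<lambda>j. e * a j" E w]
    by (auto simp: sum_distrib_left mult.assoc intro: subring_mult)
qed

lemma Span_base:
  assumes "is_subring E" "finite J" "j \<in> J" shows "w j \<in> Span E w J"
proof -
  have "(\<Sum>k\<in>J. (if k = j then 1 else 0) * w k) \<in> Span E w J"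
    using assms by (intro SpanI) (auto intro: subring_0 subring_1)
  moreover have "(\<Sum>k\<in>J. (if k = j then 1 else 0) * w k) = w j"
    using assms by (simp add: if_distrib[of "\<lambda>c. c * _"] cong: if_cong)
  ultimately show ?thesis by simp
qed

lemma Span_0: "is_subring E \<Longrightarrow> 0 \<in> Span E w J"
  using SpanI[of J "\<lambda>_. 0" E w] by (simp add: subring_0)

lemma Span_sum:
  "is_subring E \<Longrightarrow> (\<And>i. i \<in> I \<Longrightarrow> g i \<in> Span E w J) \<Longrightarrow> sum g I \<in> Span E w J"
  by (induction I rule: infinite_finite_induct) (auto intro: Span_0 Span_add)

lemma dependent_if_more_than_spanning:
  fixes z :: "'i \<Rightarrow> 'f::field"
  assumes "is_subring E" "finite J" "finite I" "card J < card I"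
    and "\<And>i. i \<in> I \<Longrightarrow> z i \<in> Span E w J"
  shows "\<exists>c. (\<forall>i\<in>I. c i \<in> E) \<and> (\<exists>i\<in>I. c i \<noteq> 0) \<and> (\<Sum>i\<in>I. c i * z i) = 0"
proof -
  have "\<forall>i\<in>I. \<exists>a. (\<forall>j\<in>J. a j \<in> E) \<and> z i = (\<Sum>j\<in>J. a j * w j)"
    using assms(5) by (auto simp: Span_def)
  then obtain a where a: "\<And>i j. i \<in> I \<Longrightarrow> j \<in> J \<Longrightarrow> a i j \<in> E"
      "\<And>i. i \<in> I \<Longrightarrow> z i = (\<Sum>j\<in>J. a i j * w j)" by metis
  obtain c where c: "\<forall>i\<in>I. c i \<in> E" "\<exists>i\<in>I. c i \<noteq> 0" "\<forall>j\<in>J. (\<Sum>i\<in>I. c i * a i j) = 0"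
    using dependent_if_more_vectors_than_coordinates[OF assms(1-4), of a] a(1) by auto
  have "(\<Sum>i\<in>I. c i * z i) = (\<Sum>i\<in>I. \<Sum>j\<in>J. c i * a i j * w j)"
    by (simp add: a(2) sum_distrib_left mult.assoc cong: sum.cong_simp)
  also have "\<dots> = (\<Sum>j\<in>J. (\<Sum>i\<in>I. c i * a i j) * w j)"
    by (subst sum.swap) (simp add: sum_distrib_right)
  also have "\<dots> = 0" using c by simp
  finally show ?thesis using c by blast
qed

definition algebraic_over :: "'f::field set \<Rightarrow> 'f \<Rightarrow> bool" where
  "algebraic_over E z \<longleftrightarrow> (\<exists>p. p \<noteq> 0 \<and> (\<forall>i. coeff p i \<in> E) \<and> poly p z = 0)"

text \<open>
  A power of \<open>z\<close> beyond the degree of \<open>p\<close> is reduced by means of \<open>p\<close>, so the span is a ring.  It is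
  finite-dimensional over \<open>E\<close>, so the powers of each $h \ne 0$ in it satisfy a linear relation, which
  after division by a power of \<open>h\<close> has a nonzero constant term and gives the inverse of \<open>h\<close>.
\<close>
lemma simple_extension:
  fixes z :: "'f::field"
  assumes E: "is_subfield E" and p: "p \<noteq> 0" "\<And>i. coeff p i \<in> E" "poly p z = 0"
  defines "V \<equiv> Span E (\<lambda>k. z ^ k) {..<degree p}"
  shows "is_subfield V" "E \<subseteq> V" "z \<in> V"
proof -
  note R = subfield_subring[OF E]
  define n where "n = degree p"
  define l where "l = lead_coeff p"
  have l: "l \<noteq> 0" "l \<in> E" using p by (auto simp: l_def)
  have n0: "n > 0"
  proof (rule ccontr)
    assume "\<not> n > 0"
    then obtain c where "p = [:c:]" by (auto simp: n_def elim: degree_eq_zeroE)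
    then show False using p by simp
  qed
  have top: "z ^ n \<in> V"
  proof -
    have "0 = (\<Sum>k\<le>n. coeff p k * z ^ k)" using p(3) by (simp add: poly_altdef n_def)
    also have "{..n} = insert n {..<n}" by auto
    finally have "l * z ^ n = - (\<Sum>k<n. coeff p k * z ^ k)"
      by (simp add: l_def n_def eq_neg_iff_add_eq_0)
    then have "z ^ n = (\<Sum>k<n. (- coeff p k / l) * z ^ k)"
      using l by (simp add: field_simps sum_divide_distrib[symmetric] sum_negf)
    also have "\<dots> \<in> V" unfolding V_def n_def[symmetric]
      using l p R by (intro SpanI) (auto intro!: subfield_divide[OF E] subring_uminus)
    finally show ?thesis .
  qed
  have VzV: "u * z \<in> V" if "u \<in> V" for u
  proof -
    from that obtain a where a: "u = (\<Sum>k<n. a k * z ^ k)" "\<forall>k<n. a k \<in> E"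
      by (auto simp: V_def Span_def n_def)
    have "a k * z ^ Suc k \<in> V" if k: "k < n" for k
    proof (cases "Suc k = n")
      case True
      then show ?thesis using top a k unfolding V_def by (auto intro!: Span_scale[OF R])
    next
      case False
      then have "Suc k \<in> {..<degree p}" using k by (simp add: n_def)
      then have "z ^ Suc k \<in> V" unfolding V_def by (intro Span_base[OF R]) auto
      then show ?thesis using a k unfolding V_def by (intro Span_scale[OF R]) auto
    qed
    then have "(\<Sum>k<n. a k * z ^ Suc k) \<in> V"
      unfolding V_def by (intro Span_sum[OF R]) auto
    then show ?thesis using a by (simp add: sum_distrib_left mult_ac)
  qed
  have oneV: "1 \<in> V" using Span_base[OF R, of "{..<degree p}" 0 "\<lambda>k. z ^ k"] n0
    by (simp add: V_def n_def)
  show EV: "E \<subseteq> V"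
  proof
    fix e assume "e \<in> E"
    then have "e * 1 \<in> V" unfolding V_def using oneV by (intro Span_scale[OF R]) (auto simp: V_def)
    then show "e \<in> V" by simp
  qed
  show "z \<in> V" using VzV[OF oneV] by simp
  have powV: "u * z ^ k \<in> V" if "u \<in> V" for u k
    using that by (induction k) (use VzV in \<open>auto simp: mult.assoc[symmetric] mult.commute[of z]\<close>)
  have multV: "u * v \<in> V" if "u \<in> V" "v \<in> V" for u v
  proof -
    from that obtain a where a: "v = (\<Sum>k<n. a k * z ^ k)" "\<forall>k<n. a k \<in> E"
      by (auto simp: V_def Span_def n_def)
    have "u * v = (\<Sum>k<n. a k * (u * z ^ k))" by (simp add: a sum_distrib_left mult_ac)
    also have "\<dots> \<in> V" unfolding V_def
      by (rule Span_sum[OF R], rule Span_scale[OF R]) (use powV[OF that(1)] a in \<open>auto simp: V_def\<close>)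
    finally show ?thesis .
  qed
  have "-1 \<in> E" using R by (intro subring_uminus subring_1)
  then have "u - v \<in> V" if "u \<in> V" "v \<in> V" for u v
    using that Span_scale[OF R, of "-1" v] Span_add[OF R, of u _ _ "- v"] by (auto simp: V_def)
  then have RV: "is_subring V" using oneV multV by (auto simp: is_subring_def)
  have "inverse h \<in> V" if h: "h \<in> V" for h
  proof (cases "h = 0")
    case True then show ?thesis using RV by (simp add: subring_0)
  next
    case False
    have "\<exists>c. (\<forall>i\<in>{..n}. c i \<in> E) \<and> (\<exists>i\<in>{..n}. c i \<noteq> 0) \<and> (\<Sum>i\<in>{..n}. c i * h ^ i) = 0"
      using subring_power[OF RV h] unfolding V_def n_def
      by (intro dependent_if_more_than_spanning[OF R, of "{..<degree p}" _ _ "\<lambda>k. z ^ k"]) auto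
    then obtain c where c: "\<forall>i\<le>n. c i \<in> E" "\<exists>i\<le>n. c i \<noteq> 0" "(\<Sum>i\<le>n. c i * h ^ i) = 0" by auto
    \<comment> \<open>the relation can be divided by \<open>h ^ k\<close>\<close>
    define k where "k = (LEAST i. i \<le> n \<and> c i \<noteq> 0)"
    have k: "k \<le> n" "c k \<noteq> 0" using LeastI_ex[OF c(2)[unfolded Bex_def]] by (auto simp: k_def)
    have k0: "c i = 0" if "i < k" for i
      using not_less_Least[of i "\<lambda>i. i \<le> n \<and> c i \<noteq> 0"] that k by (auto simp: k_def)
    have "0 = (\<Sum>i\<in>{k..n}. c i * h ^ i)"
      using c(3) by (subst c(3)[symmetric], intro sum.mono_neutral_right) (auto simp: k0)
    also have "{k..n} = insert k {Suc k..n}" using k by auto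
    finally have "0 = c k * h ^ k + (\<Sum>i\<in>{Suc k..n}. c i * h ^ i)" by simp
    also have "(\<Sum>i\<in>{Suc k..n}. c i * h ^ i) = (\<Sum>i\<in>{Suc k..n}. c i * h ^ (i - Suc k)) * h ^ Suc k"
      unfolding sum_distrib_right by (intro sum.cong) (auto simp: mult.assoc power_add[symmetric] simp del: power_Suc)
    finally have "(c k + (\<Sum>i\<in>{Suc k..n}. c i * h ^ (i - Suc k)) * h) * h ^ k = 0"
      by (simp add: algebra_simps)
    then have "(\<Sum>i\<in>{Suc k..n}. c i * h ^ (i - Suc k)) * h = - c k"
      using False by (simp add: add_eq_0_iff2)
    then have "inverse h = (\<Sum>i\<in>{Suc k..n}. c i * h ^ (i - Suc k)) * (- inverse (c k))"
      using False k by (simp add: field_simps)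
    also have "\<dots> \<in> V"
    proof (intro subring_mult[OF RV] subring_sum[OF RV] subring_uminus[OF RV])
      show "inverse (c k) \<in> V" using k c EV E by (auto simp: is_subfield_def)
    qed (use c EV subring_power[OF RV h] in auto)
    finally show ?thesis .
  qed
  then show "is_subfield V" using RV by (simp add: is_subfield_def)
qed

lemma Span_tower:
  assumes "is_subring E" "finite I" "finite J"
  shows "Span (Span E w I) w' J \<subseteq> Span E (\<lambda>(i, j). w i * w' j) (I \<times> J)"
proof
  fix u assume "u \<in> Span (Span E w I) w' J"
  then obtain a where a: "u = (\<Sum>j\<in>J. a j * w' j)" "\<forall>j\<in>J. a j \<in> Span E w I" by (auto simp: Span_def)
  then have "\<forall>j\<in>J. \<exists>b. (\<forall>i\<in>I. b i \<in> E) \<and> a j = (\<Sum>i\<in>I. b i * w i)" by (auto simp: Span_def)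
  then obtain b where b: "\<And>i j. i \<in> I \<Longrightarrow> j \<in> J \<Longrightarrow> b j i \<in> E"
      "\<And>j. j \<in> J \<Longrightarrow> a j = (\<Sum>i\<in>I. b j i * w i)" by metis
  have "u = (\<Sum>j\<in>J. \<Sum>i\<in>I. b j i * (w i * w' j))"
    by (simp add: a(1) b(2) sum_distrib_left mult_ac cong: sum.cong_simp)
  also have "\<dots> = (\<Sum>(i,j)\<in>I\<times>J. b j i * (w i * w' j))"
    by (subst sum.swap) (simp add: sum.cartesian_product)
  also have "\<dots> = (\<Sum>q\<in>I\<times>J. (case q of (i,j) \<Rightarrow> b j i) * (case q of (i,j) \<Rightarrow> w i * w' j))"
    by (intro sum.cong) auto
  also have "\<dots> \<in> Span E (\<lambda>(i, j). w i * w' j) (I \<times> J)"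
    using b(1) by (intro SpanI) auto
  finally show "u \<in> Span E (\<lambda>(i, j). w i * w' j) (I \<times> J)" .
qed

section \<open>Evaluation of polynomials and exchange of the variables\<close>

text \<open>
  Evaluation of $K[X][Y]$ in $L$ applies a homomorphism to the coefficients twice: first the embedding of
  $K$, then the evaluation of $K[X]$ that it induces.  The locale serves both levels.
\<close>
locale ring_morphism =
  fixes \<phi> :: "'r::comm_ring_1 \<Rightarrow> 's::comm_ring_1"
  assumes hom_1: "\<phi> 1 = 1"
    and hom_add: "\<phi> (a + b) = \<phi> a + \<phi> b"
    and hom_mult: "\<phi> (a * b) = \<phi> a * \<phi> b"
begin

lemma hom_0: "\<phi> 0 = 0"
  using hom_add[of 0 0] by simp

lemma hom_uminus: "\<phi> (- a) = - \<phi> a"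
  using hom_add[of a "- a"] by (simp add: hom_0 eq_neg_iff_add_eq_0 add.commute)

lemma hom_diff: "\<phi> (a - b) = \<phi> a - \<phi> b"
  using hom_add[of a "- b"] by (simp add: hom_uminus)

lemma hom_sum: "\<phi> (sum g I) = (\<Sum>i\<in>I. \<phi> (g i))"
  by (induction I rule: infinite_finite_induct) (auto simp: hom_0 hom_add)

lemma hom_prod: "\<phi> (prod g I) = (\<Prod>i\<in>I. \<phi> (g i))"
  by (induction I rule: infinite_finite_induct) (auto simp: hom_1 hom_mult)

lemma hom_power: "\<phi> (a ^ k) = \<phi> a ^ k"
  by (induction k) (auto simp: hom_1 hom_mult)

lemma eval_pCons: "poly (map_poly \<phi> (pCons a p)) t = \<phi> a + t * poly (map_poly \<phi> p) t"
  by (cases "a = 0 \<and> p = 0") (auto simp: map_poly_pCons hom_0)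

lemma eval_ring_morphism: "ring_morphism (\<lambda>p. poly (map_poly \<phi> p) t)"
proof
  show add: "poly (map_poly \<phi> (p + q)) t = poly (map_poly \<phi> p) t + poly (map_poly \<phi> q) t" for p q
    by (induction p q rule: poly_induct2) (auto simp: eval_pCons hom_add algebra_simps)
  have smult: "poly (map_poly \<phi> (smult a q)) t = \<phi> a * poly (map_poly \<phi> q) t" for a q
    by (induction q) (auto simp: eval_pCons hom_mult algebra_simps)
  show "poly (map_poly \<phi> (p * q)) t = poly (map_poly \<phi> p) t * poly (map_poly \<phi> q) t" for p q
    by (induction p) (auto simp: eval_pCons hom_0 add smult algebra_simps)
  show "poly (map_poly \<phi> 1) t = 1"
    by (simp add: hom_1)
qed

lemma eval_monom: "poly (map_poly \<phi> (monom a k)) t = \<phi> a * t ^ k"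
  by (simp add: map_poly_monom hom_0 poly_monom)

lemma eval_altdef:
  assumes "degree p \<le> n"
  shows "poly (map_poly \<phi> p) t = (\<Sum>k\<le>n. \<phi> (coeff p k) * t ^ k)"
proof -
  interpret e: ring_morphism "\<lambda>p. poly (map_poly \<phi> p) t" by (rule eval_ring_morphism)
  have "p = (\<Sum>k\<le>n. monom (coeff p k) k)" using poly_as_sum_of_monoms'[OF assms] by simp
  then have "poly (map_poly \<phi> p) t = poly (map_poly \<phi> (\<Sum>k\<le>n. monom (coeff p k) k)) t" by simp
  then show ?thesis by (simp add: e.hom_sum eval_monom)
qed

end


lemma finite_monomials: "finite (monomials f)"
proof (rule finite_subset)
  show "monomials f \<subseteq> (SIGMA i:{..Max ((\<lambda>j. degree (coeff f j)) ` {..degree f})}. {..degree f})"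
  proof safe
    fix i j assume "(i, j) \<in> monomials f"
    then have nz: "coeff (coeff f j) i \<noteq> 0" by (simp add: monomials_def)
    then have "coeff f j \<noteq> 0" by auto
    then show j: "j \<le> degree f" by (rule le_degree)
    have "i \<le> degree (coeff f j)" using nz by (rule le_degree)
    also have "\<dots> \<le> Max ((\<lambda>j. degree (coeff f j)) ` {..degree f})" using j by (intro Max_ge) auto
    finally show "i \<le> Max ((\<lambda>j. degree (coeff f j)) ` {..degree f})" .
  qed
qed auto

lemma poly2_eqI: "(\<And>i j. coeff (coeff f j) i = coeff (coeff g j) i) \<Longrightarrow> f = g"
  by (simp add: poly_eq_iff)

lemma monomials_empty_iff: "monomials f = {} \<longleftrightarrow> f = 0"
  by (auto simp: monomials_def poly_eq_iff)

lemma coeff_sum_monom_monom: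
  assumes "finite S"
  shows "coeff (coeff (\<Sum>(i, j)\<in>S. monom (monom (a i j) i) j) q) p = (if (p, q) \<in> S then a p q else 0)"
proof -
  have "coeff (coeff (\<Sum>(i, j)\<in>S. monom (monom (a i j) i) j) q) p
      = (\<Sum>s\<in>S. if s = (p, q) then a p q else 0)"
    by (auto simp: coeff_sum case_prod_beta intro!: sum.cong)
  then show ?thesis using assms by simp
qed

lemma poly2_as_sum_of_monomials:
  "f = (\<Sum>(i, j)\<in>monomials f. monom (monom (coeff (coeff f j) i) i) j)"
  by (rule poly2_eqI, subst coeff_sum_monom_monom[OF finite_monomials])
     (auto simp: monomials_def)

text \<open>
  The polynomial $f(Y,X)$.  The exchange of the variables reduces every assertion about \<open>y\<close> to the
  same assertion about \<open>x\<close>, as \<open>degree_swap_vars\<close> and \<open>eval2_swap_vars\<close> show.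
\<close>
definition swap_vars :: "'a::comm_ring_1 poly poly \<Rightarrow> 'a poly poly" where
  "swap_vars f = (\<Sum>(i, j)\<in>prod.swap ` monomials f. monom (monom (coeff (coeff f i) j) i) j)"

lemma coeff_swap_vars [simp]: "coeff (coeff (swap_vars f) j) i = coeff (coeff f i) j"
  unfolding swap_vars_def
  by (subst coeff_sum_monom_monom) (auto simp: finite_monomials, auto simp: monomials_def image_iff)

lemma swap_vars_swap_vars [simp]: "swap_vars (swap_vars f) = f"
  by (rule poly2_eqI) simp

lemma swap_vars_mult: "swap_vars (f * g) = swap_vars f * swap_vars g"
proof (rule poly2_eqI)
  fix i j
  have "coeff (coeff (swap_vars (f * g)) j) i =
      (\<Sum>k\<le>i. \<Sum>l\<le>j. coeff (coeff f k) l * coeff (coeff g (i - k)) (j - l))"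
    by (simp add: coeff_mult coeff_sum)
  also have "\<dots> = coeff (coeff (swap_vars f * swap_vars g) j) i"
    by (subst sum.swap) (simp add: coeff_mult coeff_sum)
  finally show "coeff (coeff (swap_vars (f * g)) j) i = coeff (coeff (swap_vars f * swap_vars g) j) i" .
qed

lemma swap_vars_1 [simp]: "swap_vars 1 = 1"
  by (rule poly2_eqI) (auto simp: coeff_1)

lemma swap_vars_0 [simp]: "swap_vars 0 = 0"
  by (rule poly2_eqI) simp

lemma swap_vars_0_iff [simp]: "swap_vars f = 0 \<longleftrightarrow> f = 0"
  by (auto simp: poly_eq_iff)

lemma swap_vars_dvd: "f dvd g \<Longrightarrow> swap_vars f dvd swap_vars g"
  by (auto simp: dvd_def swap_vars_mult)

lemma swap_vars_dvd_iff: "swap_vars f dvd swap_vars g \<longleftrightarrow> f dvd g"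
  using swap_vars_dvd[of f g] swap_vars_dvd[of "swap_vars f" "swap_vars g"] by auto

lemma irreducible_swap_vars:
  fixes f :: "'a::field poly poly"
  assumes "irreducible f" shows "irreducible (swap_vars f)"
proof (rule irreducibleI)
  have unit: "is_unit (swap_vars g) \<longleftrightarrow> is_unit g" for g :: "'a poly poly"
    using swap_vars_dvd_iff[of g 1] by simp
  show "swap_vars f \<noteq> 0" "\<not> is_unit (swap_vars f)" using assms by (auto simp: irreducible_def unit)
  fix a b assume "swap_vars f = a * b"
  then have "f = swap_vars a * swap_vars b" by (metis swap_vars_mult swap_vars_swap_vars)
  then show "is_unit a \<or> is_unit b" using irreducibleD[OF assms] unit by blast
qed

lemma le_degree_X: "coeff (coeff f j) i \<noteq> 0 \<Longrightarrow> i \<le> degree_X f"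
  by (auto simp: degree_X_def monomials_def[symmetric] intro!: Max_ge finite_imageI finite_monomials)
     (auto simp: monomials_def image_iff intro!: exI[of _ "(i, j)"])

lemma degree_X_attained:
  assumes "f \<noteq> 0" obtains j where "coeff (coeff f j) (degree_X f) \<noteq> 0"
proof -
  have "degree_X f \<in> fst ` monomials f"
    unfolding degree_X_def using assms finite_monomials[of f] monomials_empty_iff[of f]
    by (simp only: if_False) (rule Max_in, auto)
  then show ?thesis using that by (auto simp: monomials_def)
qed

lemma degree_swap_vars: "degree (swap_vars f) = degree_X f"
proof (cases "f = 0")
  case True
  then show ?thesis by (simp add: degree_X_def)
next
  case False
  show ?thesis
  proof (rule antisym)
    show "degree (swap_vars f) \<le> degree_X f"
      by (rule degree_le) (auto simp: poly_eq_iff, meson le_degree_X not_less)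
    obtain j where "coeff (coeff f j) (degree_X f) \<noteq> 0" by (rule degree_X_attained[OF False])
    then have "coeff (coeff (swap_vars f) (degree_X f)) j \<noteq> 0" by simp
    then have "coeff (swap_vars f) (degree_X f) \<noteq> 0" by (metis coeff_0)
    then show "degree_X f \<le> degree (swap_vars f)" by (rule le_degree)
  qed
qed


locale field_extension =
  fixes \<iota> :: "'a::field \<Rightarrow> 'f::field"
  assumes embedding: "field_embedding \<iota>"
begin

sublocale ring_morphism \<iota>
  using embedding by unfold_locales (auto simp: field_embedding_def)

lemma iota_eq_0 [simp]: "\<iota> a = 0 \<longleftrightarrow> a = 0"
proof
  assume a: "\<iota> a = 0"
  show "a = 0"
  proof (rule ccontr)
    assume "a \<noteq> 0"
    then have "\<iota> a * \<iota> (inverse a) = 1" by (simp add: hom_1 flip: hom_mult)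
    then show False using a by simp
  qed
qed (simp add: hom_0)

lemma iota_inverse: "\<iota> (inverse a) = inverse (\<iota> a)"
proof (cases "a = 0")
  case False
  then have "\<iota> (inverse a) * \<iota> a = 1" by (simp add: hom_1 flip: hom_mult)
  then show ?thesis using inverse_unique[of "\<iota> a" "\<iota> (inverse a)"] by (simp add: mult.commute)
qed (simp add: hom_0)

lemma subfield_range: "is_subfield (range \<iota>)"
  unfolding is_subfield_def is_subring_def
  by (auto simp flip: hom_diff hom_mult iota_inverse) (metis hom_1 rangeI)

definition ev :: "'a poly \<Rightarrow> 'f \<Rightarrow> 'f" where
  "ev p t = poly (map_poly \<iota> p) t"

lemma ev_morphism: "ring_morphism (\<lambda>p. ev p t)"
  unfolding ev_def by (rule eval_ring_morphism)

lemma ev_pCons: "ev (pCons a p) t = \<iota> a + t * ev p t"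
  by (simp add: ev_def eval_pCons)

lemma ev_monom: "ev (monom a k) t = \<iota> a * t ^ k"
  by (simp add: ev_def eval_monom)

lemma ev_0 [simp]: "ev 0 t = 0" by (simp add: ev_def)

lemma ev_const: "ev [:a:] t = \<iota> a" by (simp add: ev_pCons)

lemma ev_in_subring: "is_subring A \<Longrightarrow> range \<iota> \<subseteq> A \<Longrightarrow> t \<in> A \<Longrightarrow> ev p t \<in> A"
  unfolding ev_def by (intro subring_poly) (auto simp: coeff_map_poly hom_0)

definition transcendental :: "'f \<Rightarrow> bool" where
  "transcendental t \<longleftrightarrow> (\<forall>p. ev p t = 0 \<longrightarrow> p = 0)"

lemma transcendental_neq_0: "transcendental t \<Longrightarrow> t \<noteq> 0"
  unfolding transcendental_def
proof
  assume "\<forall>p. ev p t = 0 \<longrightarrow> p = 0" "t = 0"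
  moreover have "ev [:0, 1:] 0 = 0" by (simp add: ev_pCons hom_0)
  ultimately show False by force
qed

text \<open>
  The subfield $K(t)$ of $L$.
\<close>
definition rat_field :: "'f \<Rightarrow> 'f set" where
  "rat_field t = {ev p t / ev q t | p q. ev q t \<noteq> 0}"

lemma rat_fieldI: "ev q t \<noteq> 0 \<Longrightarrow> ev p t / ev q t \<in> rat_field t"
  by (auto simp: rat_field_def)

lemma ev_in_rat_field: "ev p t \<in> rat_field t"
  using rat_fieldI[of 1 t p] ring_morphism.hom_1[OF ev_morphism] by simp

lemma gen_in_rat_field: "t \<in> rat_field t"
  using ev_in_rat_field[of "[:0, 1:]" t] by (simp add: ev_pCons hom_0 hom_1)

lemma range_subset_rat_field: "range \<iota> \<subseteq> rat_field t"
  using ev_in_rat_field[of "[:_:]" t] by (auto simp: ev_const)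

lemma rat_field_least: "is_subfield E \<Longrightarrow> range \<iota> \<subseteq> E \<Longrightarrow> t \<in> E \<Longrightarrow> rat_field t \<subseteq> E"
  by (auto simp: rat_field_def intro!: subfield_divide ev_in_subring subfield_subring)

lemma subfield_rat_field: "is_subfield (rat_field t)"
proof -
  interpret e: ring_morphism "\<lambda>p. ev p t" by (rule ev_morphism)
  have "1 \<in> rat_field t" using ev_in_rat_field[of 1 t] by (simp add: e.hom_1)
  moreover have "a - b \<in> rat_field t \<and> a * b \<in> rat_field t" if ab: "a \<in> rat_field t" "b \<in> rat_field t" for a b
  proof -
    from ab obtain p q r s where *: "a = ev p t / ev q t" "b = ev r t / ev s t" "ev q t \<noteq> 0" "ev s t \<noteq> 0"
      by (auto simp: rat_field_def)
    have "a - b = ev (p * s - r * q) t / ev (q * s) t" "a * b = ev (p * r) t / ev (q * s) t"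
      using *(3,4) unfolding *(1,2) by (simp_all add: e.hom_mult e.hom_diff diff_frac_eq)
    moreover have "ev (q * s) t \<noteq> 0" using * by (simp add: e.hom_mult)
    ultimately show ?thesis using rat_fieldI[of "q * s" t] by simp
  qed
  moreover have "inverse a \<in> rat_field t" if a: "a \<in> rat_field t" for a
  proof -
    from a obtain p q where *: "a = ev p t / ev q t" "ev q t \<noteq> 0" by (auto simp: rat_field_def)
    show ?thesis
      using * rat_fieldI[of p t q] ev_in_rat_field[of 0 t] by (cases "ev p t = 0") auto
  qed
  ultimately show ?thesis by (simp add: is_subfield_def is_subring_def)
qed

lemma rat_field_inverse: "rat_field (inverse t) = rat_field t"
proof -
  have *: "rat_field (inverse s) \<subseteq> rat_field s" for s
    using subfield_rat_field[of s] gen_in_rat_field[of s]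
    by (intro rat_field_least range_subset_rat_field) (auto simp: is_subfield_def)
  show ?thesis using *[of t] *[of "inverse t"] by auto
qed

lemma ev_split_const: "\<exists>q. ev p t = \<iota> (coeff p 0) + t * ev q t"
  by (cases p) (auto simp: ev_pCons)

text \<open>
  A linear relation over $K(t)$ is multiplied by a common denominator and then divided by the highest
  power of $t$ that divides all coefficients.  Reducing the result modulo $t$, at a place where $t$
  vanishes, leaves a nontrivial relation over $K$.
\<close>
lemma clear_denominators:
  fixes z :: "'i \<Rightarrow> 'f"
  assumes t: "transcendental t" and I: "finite I"
    and c: "\<And>i. i \<in> I \<Longrightarrow> c i \<in> rat_field t" "\<exists>i\<in>I. c i \<noteq> 0" "(\<Sum>i\<in>I. c i * z i) = 0"
  obtains p where "\<exists>i\<in>I. coeff (p i) 0 \<noteq> 0" "(\<Sum>i\<in>I. ev (p i) t * z i) = 0"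
proof -
  interpret e: ring_morphism "\<lambda>p. ev p t" by (rule ev_morphism)
  have "\<forall>i\<in>I. \<exists>a b. ev b t \<noteq> 0 \<and> c i = ev a t / ev b t" using c(1) by (force simp: rat_field_def)
  then obtain a b where ab: "\<And>i. i \<in> I \<Longrightarrow> ev (b i) t \<noteq> 0"
     "\<And>i. i \<in> I \<Longrightarrow> c i = ev (a i) t / ev (b i) t" by metis
  define P where "P i = a i * (\<Prod>j\<in>I-{i}. b j)" for i
  define B where "B = (\<Prod>j\<in>I. ev (b j) t)"
  have B: "B \<noteq> 0" using ab I by (simp add: B_def)
  have P: "ev (P i) t = c i * B" if "i \<in> I" for i
    using that I ab by (simp add: P_def B_def e.hom_mult e.hom_prod prod.remove)
  have sumP: "(\<Sum>i\<in>I. ev (P i) t * z i) = 0"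
  proof -
    have "(\<Sum>i\<in>I. ev (P i) t * z i) = (\<Sum>i\<in>I. c i * z i) * B"
      by (simp add: P sum_distrib_left mult_ac cong: sum.cong_simp)
    then show ?thesis using c by simp
  qed
  from c(2) obtain i0 where i0: "i0 \<in> I" "c i0 \<noteq> 0" by auto
  then have "P i0 \<noteq> 0" using P[of i0] B by auto
  then obtain k0 where "coeff (P i0) k0 \<noteq> 0" by (auto simp: poly_eq_iff)
  then have ex: "\<exists>k. \<exists>i\<in>I. coeff (P i) k \<noteq> 0" using i0 by auto
  \<comment> \<open>the highest power of \<open>t\<close> that divides all the coefficients\<close>
  define m where "m = (LEAST k. \<exists>i\<in>I. coeff (P i) k \<noteq> 0)"
  have m: "\<exists>i\<in>I. coeff (P i) m \<noteq> 0" unfolding m_def using ex by (rule LeastI_ex)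
  have below: "coeff (P i) k = 0" if "i \<in> I" "k < m" for i k
    using not_less_Least[of k "\<lambda>k. \<exists>i\<in>I. coeff (P i) k \<noteq> 0"] that by (auto simp: m_def)
  define p where "p i = poly_shift m (P i)" for i
  have Pp: "P i = monom 1 m * p i" if "i \<in> I" for i
    by (rule poly_eqI) (use below[OF that] in \<open>auto simp: coeff_monom_mult p_def coeff_poly_shift\<close>)
  have "0 = (\<Sum>i\<in>I. t ^ m * (ev (p i) t * z i))"
    using sumP by (simp add: Pp e.hom_mult ev_monom hom_1 mult_ac cong: sum.cong_simp)
  then have "t ^ m * (\<Sum>i\<in>I. ev (p i) t * z i) = 0" by (simp add: sum_distrib_left)
  then have "(\<Sum>i\<in>I. ev (p i) t * z i) = 0" using transcendental_neq_0[OF t] by simp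
  moreover have "\<exists>i\<in>I. coeff (p i) 0 \<noteq> 0" using m by (simp add: p_def coeff_poly_shift)
  ultimately show ?thesis using that by blast
qed

lemma eval2_eq: "eval2 \<iota> g x y = poly (map_poly (\<lambda>p. ev p x) g) y"
  by (simp add: eval2_def ev_def)

lemma eval2_morphism: "ring_morphism (\<lambda>g. eval2 \<iota> g x y)"
  unfolding eval2_eq by (rule ring_morphism.eval_ring_morphism[OF ev_morphism])

lemma eval2_monom: "eval2 \<iota> (monom p k) x y = ev p x * y ^ k"
  unfolding eval2_eq by (rule ring_morphism.eval_monom[OF ev_morphism])

lemma eval2_pCons: "eval2 \<iota> (pCons p g) x y = ev p x + y * eval2 \<iota> g x y"
  unfolding eval2_eq by (rule ring_morphism.eval_pCons[OF ev_morphism])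

lemma eval2_0 [simp]: "eval2 \<iota> 0 x y = 0"
  by (simp add: eval2_eq)

lemma eval2_const: "eval2 \<iota> [:p:] x y = ev p x"
  by (simp add: eval2_pCons)

lemma eval2_altdef: "degree g \<le> n \<Longrightarrow> eval2 \<iota> g x y = (\<Sum>k\<le>n. ev (coeff g k) x * y ^ k)"
  unfolding eval2_eq by (rule ring_morphism.eval_altdef[OF ev_morphism])

lemma eval2_as_sum_of_monomials:
  "eval2 \<iota> g x y = (\<Sum>(i, j)\<in>monomials g. \<iota> (coeff (coeff g j) i) * x ^ i * y ^ j)"
  by (subst poly2_as_sum_of_monomials[of g])
     (simp add: ring_morphism.hom_sum[OF eval2_morphism] case_prod_beta eval2_monom ev_monom)

lemma eval2_swap_vars: "eval2 \<iota> (swap_vars g) y x = eval2 \<iota> g x y"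
proof -
  have "eval2 \<iota> (swap_vars g) y x
      = (\<Sum>(i, j)\<in>monomials (swap_vars g). \<iota> (coeff (coeff g i) j) * y ^ i * x ^ j)"
    by (simp add: eval2_as_sum_of_monomials)
  also have "\<dots> = (\<Sum>(i, j)\<in>monomials g. \<iota> (coeff (coeff g j) i) * y ^ j * x ^ i)"
    by (rule sum.reindex_bij_witness[of _ prod.swap prod.swap]) (auto simp: monomials_def)
  finally show ?thesis by (simp add: eval2_as_sum_of_monomials mult_ac)
qed

lemma eval2_in_subring:
  assumes "is_subring A" "range \<iota> \<subseteq> A" "x \<in> A" "y \<in> A" shows "eval2 \<iota> g x y \<in> A"
  unfolding eval2_as_sum_of_monomials case_prod_beta
  using assms by (intro subring_sum subring_mult subring_power) auto

lemma adjoin2_least: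
  "is_subfield E \<Longrightarrow> range \<iota> \<subseteq> E \<Longrightarrow> x \<in> E \<Longrightarrow> y \<in> E \<Longrightarrow> adjoin2 \<iota> x y \<subseteq> E"
  by (auto simp: adjoin2_def intro!: subfield_divide eval2_in_subring subfield_subring)

lemma adjoin2_commute: "adjoin2 \<iota> y x = adjoin2 \<iota> x y"
proof -
  have "adjoin2 \<iota> y x \<subseteq> adjoin2 \<iota> x y" for x y
    unfolding adjoin2_def
    by (auto, metis eval2_swap_vars)
  then show ?thesis by (metis subset_antisym)
qed

end

section \<open>Valuations and weak approximation\<close>

text \<open>
  The predicate treats 0 as an element of infinite value, in spite of the dummy value that a place has
  there; its laws need no case distinctions.
\<close>
definition val_ge :: "('f::field \<Rightarrow> int) \<Rightarrow> int \<Rightarrow> 'f \<Rightarrow> bool" where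
  "val_ge v N z \<longleftrightarrow> z = 0 \<or> N \<le> v z"

lemma val_ge_0 [simp]: "val_ge v N 0"
  by (simp add: val_ge_def)

lemma val_ge_mono: "val_ge v N z \<Longrightarrow> M \<le> N \<Longrightarrow> val_ge v M z"
  by (auto simp: val_ge_def)

lemma valuation_ring_eq: "valuation_ring v = {z. val_ge v 0 z}"
  by (auto simp: valuation_ring_def val_ge_def)

lemma place_ideal_eq: "place_ideal v = {z. val_ge v 1 z}"
  by (auto simp: place_ideal_def val_ge_def)

context field_extension
begin

lemma place_mult: "is_place \<iota> v \<Longrightarrow> a \<noteq> 0 \<Longrightarrow> b \<noteq> 0 \<Longrightarrow> v (a * b) = v a + v b"
  by (simp add: is_place_def)

lemma place_iota: "is_place \<iota> v \<Longrightarrow> v (\<iota> c) = 0"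
  by (simp add: is_place_def)

lemma place_1: "is_place \<iota> v \<Longrightarrow> v 1 = 0"
  using place_iota[of v 1] by (simp add: hom_1)

lemma place_uminus: "is_place \<iota> v \<Longrightarrow> v (- a) = v a"
  using place_iota[of v "-1"] place_mult[of v "-1" a]
  by (cases "a = 0") (simp_all add: hom_uminus hom_1)

lemma place_0: "is_place \<iota> v \<Longrightarrow> v 0 = 0"
  by (simp add: is_place_def)

lemma place_inverse: "is_place \<iota> v \<Longrightarrow> v (inverse a) = - v a"
  using place_mult[of v a "inverse a"] by (cases "a = 0") (simp_all add: place_1 place_0)

lemma place_divide: "is_place \<iota> v \<Longrightarrow> a \<noteq> 0 \<Longrightarrow> b \<noteq> 0 \<Longrightarrow> v (a / b) = v a - v b"
  by (simp add: divide_inverse place_mult place_inverse)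

lemma place_power: "is_place \<iota> v \<Longrightarrow> a \<noteq> 0 \<Longrightarrow> v (a ^ k) = int k * v a"
  by (induction k) (auto simp: place_1 place_mult algebra_simps)

lemma place_power_int: "is_place \<iota> v \<Longrightarrow> a \<noteq> 0 \<Longrightarrow> v (a powi k) = k * v a"
  by (auto simp: power_int_def place_power place_inverse)

lemma obtain_place_value:
  assumes "is_place \<iota> v" obtains t where "t \<noteq> 0" "v t = 1"
proof -
  have "surj v" using assms unfolding is_place_def by blast
  then obtain t where t: "1 = v t" by (rule surjE)
  then have "t \<noteq> 0" using place_0[OF assms] by auto
  then show ?thesis using that t by simp
qed

lemma val_ge_add: "is_place \<iota> v \<Longrightarrow> val_ge v N a \<Longrightarrow> val_ge v N b \<Longrightarrow> val_ge v N (a + b)"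
  unfolding val_ge_def
proof -
  assume "is_place \<iota> v" "a = 0 \<or> N \<le> v a" "b = 0 \<or> N \<le> v b"
  moreover from this(1) have "a \<noteq> 0 \<Longrightarrow> b \<noteq> 0 \<Longrightarrow> a + b \<noteq> 0 \<Longrightarrow> min (v a) (v b) \<le> v (a + b)"
    by (simp add: is_place_def)
  ultimately show "a + b = 0 \<or> N \<le> v (a + b)"
    by (cases "a = 0 \<or> b = 0 \<or> a + b = 0") force+
qed

lemma val_ge_uminus: "is_place \<iota> v \<Longrightarrow> val_ge v N (- a) \<longleftrightarrow> val_ge v N a"
  by (auto simp: val_ge_def place_uminus)

lemma val_ge_diff: "is_place \<iota> v \<Longrightarrow> val_ge v N a \<Longrightarrow> val_ge v N b \<Longrightarrow> val_ge v N (a - b)"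
  using val_ge_add[of v N a "- b"] by (simp add: val_ge_uminus)

lemma val_ge_sum:
  "is_place \<iota> v \<Longrightarrow> (\<And>i. i \<in> I \<Longrightarrow> val_ge v N (g i)) \<Longrightarrow> val_ge v N (sum g I)"
  by (induction I rule: infinite_finite_induct) (auto intro: val_ge_add)

lemma val_ge_mult:
  "is_place \<iota> v \<Longrightarrow> val_ge v N a \<Longrightarrow> val_ge v M b \<Longrightarrow> K \<le> N + M \<Longrightarrow> val_ge v K (a * b)"
  by (cases "a = 0 \<or> b = 0") (auto simp: val_ge_def place_mult)

lemma val_ge_iota: "is_place \<iota> v \<Longrightarrow> val_ge v 0 (\<iota> c)"
  by (simp add: val_ge_def place_iota)

lemma val_ge_scale: "is_place \<iota> v \<Longrightarrow> val_ge v N a \<Longrightarrow> val_ge v N (\<iota> c * a)"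
  by (rule val_ge_mult[where N = 0 and M = N]) (auto simp: val_ge_iota)

lemma val_ge_iota_pos: "is_place \<iota> v \<Longrightarrow> val_ge v N (\<iota> c) \<Longrightarrow> N > 0 \<Longrightarrow> c = 0"
  by (auto simp: val_ge_def place_iota)

lemma val_ring_subring: "is_place \<iota> v \<Longrightarrow> is_subring {z. val_ge v 0 z}"
  unfolding is_subring_def using val_ge_diff[of v 0] val_ge_mult[of v 0 _ 0 _ 0]
  by (auto simp: val_ge_def place_1)

lemma val_ge_power: "is_place \<iota> v \<Longrightarrow> val_ge v 0 a \<Longrightarrow> val_ge v 0 (a ^ k)"
  using subring_power[OF val_ring_subring] by blast

lemma val_ge_ev: "is_place \<iota> v \<Longrightarrow> val_ge v 0 t \<Longrightarrow> val_ge v 0 (ev p t)"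
  using ev_in_subring[OF val_ring_subring, of v t p] by (auto simp: val_ge_iota image_subset_iff)

text \<open>
  The strict triangle inequality: the summand of strictly smaller value determines the value of a sum.
\<close>
lemma place_add_dominant:
  assumes v: "is_place \<iota> v" and a: "a \<noteq> 0" and b: "val_ge v (v a + 1) b"
  shows "a + b \<noteq> 0" "v (a + b) = v a"
proof -
  show nz: "a + b \<noteq> 0"
  proof
    assume "a + b = 0"
    then have "b = - a" by (simp add: add_eq_0_iff2 add.commute)
    then show False using a b v by (auto simp: val_ge_def place_uminus)
  qed
  have "val_ge v (v a) (a + b)"
    using b by (intro val_ge_add[OF v]) (auto simp: val_ge_def)
  then have 1: "v a \<le> v (a + b)" using nz by (simp add: val_ge_def)
  have "\<not> v a < v (a + b)"
  proof
    assume "v a < v (a + b)"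
    then have "val_ge v (v a + 1) (a + b - b)"
      using b by (intro val_ge_diff[OF v]) (auto simp: val_ge_def)
    then show False using a by (simp add: val_ge_def)
  qed
  then show "v (a + b) = v a" using 1 by simp
qed

text \<open>
  If \<open>w\<close> is nonnegative wherever \<open>v\<close> is, then \<open>w\<close> vanishes wherever \<open>v\<close> does, so it is an integral
  multiple of \<open>v\<close>; both valuations are normalized, so they are equal.
\<close>
lemma place_incomparable:
  assumes v: "is_place \<iota> v" and w: "is_place \<iota> w" and "v \<noteq> w"
  shows "\<exists>a. a \<noteq> 0 \<and> v a \<ge> 0 \<and> w a < 0"
proof (rule ccontr)
  assume "\<not> ?thesis"
  then have vw: "w a \<ge> 0" if "a \<noteq> 0" "v a \<ge> 0" for a using that by force
  have zero: "w a = 0" if "a \<noteq> 0" "v a = 0" for a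
    using vw[of a] vw[of "inverse a"] that by (simp add: place_inverse v w)
  obtain t where t: "t \<noteq> 0" "v t = 1" by (rule obtain_place_value[OF v])
  have wz: "w z = v z * w t" if "z \<noteq> 0" for z
  proof -
    have "v (z * t powi (- v z)) = 0"
      using that t by (subst place_mult[OF v]) (auto simp: place_power_int[OF v])
    then have "w (z * t powi (- v z)) = 0" using that t by (intro zero) auto
    then show ?thesis using that t by (subst (asm) place_mult[OF w]) (auto simp: place_power_int[OF w])
  qed
  obtain s where s: "s \<noteq> 0" "w s = 1" by (rule obtain_place_value[OF w])
  have "w t \<ge> 0" using vw[of t] t by simp
  then have "w t = 1" using wz[OF s(1)] s by (auto simp: zmult_eq_1_iff dest: sym)
  then have "v z = w z" for z
    using wz[of z] v w by (cases "z = 0") (simp_all add: place_0)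
  then show False using \<open>v \<noteq> w\<close> by auto
qed

text \<open>
  Induction on \<open>S\<close>.  For an additional place \<open>w\<close>, add to \<open>z\<close> a high power of an element \<open>y\<close> with
  $v(y) > 0$ and $w(y) < 0$.  The exponent is so large that at each of the places that are to be
  separated from \<open>v\<close> the two summands have different values; the smaller of these values is negative,
  and it is the value of the sum.
\<close>
lemma places_separated:
  assumes v: "is_place \<iota> v" and S: "finite S" "\<And>w. w \<in> S \<Longrightarrow> is_place \<iota> w" "v \<notin> S"
  shows "\<exists>z. z \<noteq> 0 \<and> v z > 0 \<and> (\<forall>w\<in>S. w z < 0)"
  using S
proof (induction S rule: finite_induct)
  case empty
  obtain t where "t \<noteq> 0" "v t = 1" by (rule obtain_place_value[OF v])
  then show ?case by auto
next
  case (insert w S)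
  then have w: "is_place \<iota> w" and vw: "v \<noteq> w" by auto
  obtain z where z: "z \<noteq> 0" "v z > 0" "\<And>w. w \<in> S \<Longrightarrow> w z < 0" using insert by auto
  obtain a b where ab: "a \<noteq> 0" "v a \<ge> 0" "w a < 0" "b \<noteq> 0" "w b \<ge> 0" "v b < 0"
    using place_incomparable[OF v w vw] place_incomparable[OF w v vw[symmetric]] by blast
  define y where "y = a / b"
  have y: "y \<noteq> 0" "v y > 0" "w y < 0"
    using ab by (auto simp: y_def place_divide v w)
  \<comment> \<open>exceeds the absolute value of \<open>z\<close> at each of the places that are to be separated from \<open>v\<close>\<close>
  define k where "k = nat (1 + \<bar>w z\<bar> + (\<Sum>u\<in>S. \<bar>u z\<bar>))"
  have "0 \<le> (\<Sum>u\<in>S. \<bar>u z\<bar>)" by (rule sum_nonneg) auto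
  then have k1: "int k > \<bar>w z\<bar>" unfolding k_def by linarith
  have k2: "int k > \<bar>u z\<bar>" if "u \<in> S" for u
  proof -
    have "\<bar>u z\<bar> \<le> (\<Sum>u\<in>S. \<bar>u z\<bar>)"
      using that insert.hyps by (intro member_le_sum) auto
    then show ?thesis by (simp add: k_def)
  qed
  have yk: "y ^ k \<noteq> 0" using y by simp
  have kmul: "int k * c \<ge> int k" if "c > 0" for c :: int
    using mult_left_mono[of 1 c "int k"] that by simp
  have kmul': "int k * c \<le> - int k" if "c < 0" for c :: int
    using kmul[of "- c"] that by simp
  have wv: "w (y ^ k) \<le> - int k" using kmul'[OF y(3)] y by (simp add: place_power[OF w])
  have "val_ge w (w (y ^ k) + 1) z" using wv k1 by (auto simp: val_ge_def)
  note dw = place_add_dominant[OF w yk this]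
  have nz: "z + y ^ k \<noteq> 0" using dw by (simp add: add.commute)
  have wneg: "w (z + y ^ k) < 0" using dw wv k1 by (simp add: add.commute)
  have "int k * v y \<ge> 1" using kmul[OF y(2)] k1 by linarith
  then have "val_ge v 1 (y ^ k)" using y by (simp add: val_ge_def place_power[OF v])
  then have "val_ge v 1 (z + y ^ k)" using z by (intro val_ge_add[OF v]) (auto simp: val_ge_def)
  then have vpos: "v (z + y ^ k) > 0" using nz by (simp add: val_ge_def)
  have "u (z + y ^ k) < 0" if u: "u \<in> S" for u
  proof -
    have pu: "is_place \<iota> u" using u insert by auto
    show ?thesis
    proof (cases "u y < 0")
      case True
      then have uv: "u (y ^ k) \<le> - int k" using kmul' y by (simp add: place_power[OF pu])
      then have "val_ge u (u (y ^ k) + 1) z" using k2[OF u] by (auto simp: val_ge_def)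
      from place_add_dominant[OF pu yk this] show ?thesis using uv k2[OF u] by (simp add: add.commute)
    next
      case False
      then have "u (y ^ k) \<ge> 0" using y by (simp add: place_power[OF pu])
      then have "val_ge u (u z + 1) (y ^ k)" using z(3)[OF u] by (auto simp: val_ge_def)
      from place_add_dominant[OF pu z(1) this] show ?thesis using z(3)[OF u] by simp
    qed
  qed
  then show ?case using nz wneg vpos by (intro exI[of _ "z + y ^ k"]) auto
qed

text \<open>
  For \<open>z\<close> as in \<open>places_separated\<close>, the element $1/(1+z^k)$ is close to 1 at \<open>v\<close> and close to 0 at
  the places in \<open>S\<close>.
\<close>
lemma approximate_idempotent:
  assumes v: "is_place \<iota> v" and S: "finite S" "\<And>w. w \<in> S \<Longrightarrow> is_place \<iota> w" "v \<notin> S"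
  shows "\<exists>h. val_ge v (int N) (h - 1) \<and> (\<forall>w\<in>S. val_ge w (int N) h)"
proof -
  obtain z where z: "z \<noteq> 0" "v z > 0" "\<And>w. w \<in> S \<Longrightarrow> w z < 0" using places_separated[OF assms] by auto
  define k where "k = Suc N"
  have kmul: "int k * c \<ge> int k" if "c > 0" for c :: int
    using mult_left_mono[of 1 c "int k"] that by simp
  have kmul': "int k * c \<le> - int k" if "c < 0" for c :: int
    using kmul[of "- c"] that by simp
  have vk: "v (z ^ k) \<ge> int k" using kmul z by (simp add: place_power[OF v])
  then have "val_ge v (v 1 + 1) (z ^ k)" by (auto simp: val_ge_def place_1[OF v] k_def)
  note d = place_add_dominant[OF v one_neq_zero this]
  define h where "h = 1 / (1 + z ^ k)"
  have "h - 1 = - (z ^ k / (1 + z ^ k))" using d by (simp add: h_def field_simps)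
  moreover have "v (z ^ k / (1 + z ^ k)) = v (z ^ k)"
    using d z by (subst place_divide[OF v]) (auto simp: place_1[OF v])
  ultimately have "val_ge v (int N) (h - 1)" using vk by (simp add: val_ge_def place_uminus[OF v] k_def)
  moreover have "val_ge w (int N) h" if "w \<in> S" for w
  proof -
    have w: "is_place \<iota> w" using S that by auto
    have wk: "w (z ^ k) \<le> - int k" using kmul' z(3)[OF that] z by (simp add: place_power[OF w])
    then have "val_ge w (w (z ^ k) + 1) 1" by (auto simp: val_ge_def place_1[OF w] k_def)
    from place_add_dominant[OF w _ this] have "w (z ^ k + 1) = w (z ^ k)" "z ^ k + 1 \<noteq> 0" using z by auto
    then have "w h = - w (z ^ k)" by (simp add: h_def place_divide[OF w] place_1[OF w] add.commute)
    then show ?thesis using wk by (simp add: val_ge_def k_def)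
  qed
  ultimately show ?thesis by blast
qed

lemma weak_approximation:
  fixes S :: "('f \<Rightarrow> int) set"
  assumes S: "finite S" "\<And>w. w \<in> S \<Longrightarrow> is_place \<iota> w"
  shows "\<exists>h. \<forall>v\<in>S. val_ge v (int N) (h - a v)"
proof -
  \<comment> \<open>absorbs the poles of the elements \<open>a w\<close>, by which the approximate idempotents are multiplied\<close>
  define M where "M = N + nat (\<Sum>(v, w)\<in>S\<times>S. \<bar>v (a w)\<bar>)"
  have M: "int M + v (a w) \<ge> int N" if "v \<in> S" "w \<in> S" for v w
  proof -
    have "\<bar>v (a w)\<bar> \<le> (\<Sum>(v, w)\<in>S\<times>S. \<bar>v (a w)\<bar>)"
      using that S(1) member_le_sum[of "(v, w)" "S \<times> S" "\<lambda>(v, w). \<bar>v (a w)\<bar>"] by auto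
    then have "- v (a w) \<le> (\<Sum>(v, w)\<in>S\<times>S. \<bar>v (a w)\<bar>)" by linarith
    then show ?thesis unfolding M_def by linarith
  qed
  have "\<exists>h. val_ge v (int M) (h - 1) \<and> (\<forall>w\<in>S - {v}. val_ge w (int M) h)" if "v \<in> S" for v
    using S that by (intro approximate_idempotent) auto
  then obtain e where e: "\<And>v. v \<in> S \<Longrightarrow> val_ge v (int M) (e v - 1)"
     "\<And>v w. v \<in> S \<Longrightarrow> w \<in> S \<Longrightarrow> w \<noteq> v \<Longrightarrow> val_ge w (int M) (e v)"
    by (metis Diff_iff singletonD)
  have "val_ge v (int N) ((\<Sum>w\<in>S. e w * a w) - a v)" if v: "v \<in> S" for v
  proof -
    have pv: "is_place \<iota> v" using S v by auto
    have av: "val_ge v (v (a w)) (a w)" for w by (simp add: val_ge_def)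
    have "(\<Sum>w\<in>S. e w * a w) - a v = (e v - 1) * a v + (\<Sum>w\<in>S - {v}. e w * a w)"
      using S(1) v by (simp add: sum.remove algebra_simps)
    moreover have "val_ge v (int N) ((e v - 1) * a v)"
      by (rule val_ge_mult[OF pv e(1)[OF v] av]) (use M v in auto)
    moreover have "val_ge v (int N) (\<Sum>w\<in>S - {v}. e w * a w)"
      by (rule val_ge_sum[OF pv], rule val_ge_mult[OF pv e(2) av]) (use M v in auto)
    ultimately show ?thesis using val_ge_add[OF pv] by simp
  qed
  then show ?thesis by blast
qed

end

section \<open>Existence of places\<close>

text \<open>
  The ideal $uA + wA$ of \<open>A\<close>.  Two generators suffice: a common pole of \<open>x\<close> and \<open>y\<close> is a place with
  centre $(1/x, 1/y)$, and for a pole of a single element both generators are its inverse.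
\<close>
definition ideal2 :: "'f::field set \<Rightarrow> 'f \<Rightarrow> 'f \<Rightarrow> 'f set" where
  "ideal2 A u w = {u * a + w * b | a b. a \<in> A \<and> b \<in> A}"

lemma ideal2_add:
  assumes "is_subring A" "a \<in> ideal2 A u w" "b \<in> ideal2 A u w" shows "a + b \<in> ideal2 A u w"
proof -
  from assms obtain p q r s where "a = u * p + w * q" "b = u * r + w * s"
    and in_A: "p \<in> A" "q \<in> A" "r \<in> A" "s \<in> A" by (auto simp: ideal2_def)
  then have "a + b = u * (p + r) + w * (q + s)" by (simp add: algebra_simps)
  moreover have "p + r \<in> A" "q + s \<in> A" using in_A assms(1) by (auto intro: subring_add)
  ultimately show ?thesis unfolding ideal2_def by blast
qed

lemma ideal2_mult:
  assumes "is_subring A" "a \<in> ideal2 A u w" "c \<in> A" shows "c * a \<in> ideal2 A u w"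
proof -
  from assms obtain p q where "a = u * p + w * q" and in_A: "p \<in> A" "q \<in> A" by (auto simp: ideal2_def)
  then have "c * a = u * (c * p) + w * (c * q)" by (simp add: algebra_simps)
  moreover have "c * p \<in> A" "c * q \<in> A" using in_A assms(1,3) by (auto intro: subring_mult)
  ultimately show ?thesis unfolding ideal2_def by blast
qed

lemma ideal2_0: "is_subring A \<Longrightarrow> 0 \<in> ideal2 A u w"
  unfolding ideal2_def by (auto intro!: exI[of _ 0] subring_0)

text \<open>
  Such a relation of some degree says that the ideal generated by \<open>J\<close> in $A[z]$ is the whole ring.
\<close>
definition unit_relation :: "'f::field set \<Rightarrow> 'f \<Rightarrow> nat \<Rightarrow> bool" where
  "unit_relation J z n \<longleftrightarrow> (\<exists>a. (\<forall>i\<le>n. a i \<in> J) \<and> 1 = (\<Sum>i\<le>n. a i * z ^ i))"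

text \<open>
  Chevalley's reduction step.  The relation for \<open>z\<close> is multiplied by $1 - b_0$, where $b_0$ is the
  constant term of the relation for $1/z$.  The latter, multiplied by $z^n$, expresses
  $(1 - b_0) z^n$ by lower powers of \<open>z\<close>, as $m \le n$.
\<close>
lemma unit_relation_shorten:
  fixes z :: "'f::field"
  assumes A: "is_subring A" and J: "J = ideal2 A u w" "J \<subseteq> A"
    and z: "z \<noteq> 0" and n: "unit_relation J z n" "unit_relation J (inverse z) m" "m \<le> n" "n > 0"
  shows "unit_relation J z (n - 1)"
proof -
  obtain a where a: "\<And>i. i \<le> n \<Longrightarrow> a i \<in> J" "1 = (\<Sum>i\<le>n. a i * z ^ i)"
    using n(1) by (auto simp: unit_relation_def)
  obtain b where b: "\<And>i. i \<le> m \<Longrightarrow> b i \<in> J" "1 = (\<Sum>i\<le>m. b i * inverse z ^ i)"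
    using n(2) by (auto simp: unit_relation_def)
  obtain k where k: "n = Suc k" using n(4) by (cases n) auto
  have Jadd: "p + q \<in> J" if "p \<in> J" "q \<in> J" for p q using that ideal2_add[OF A] J by blast
  have Jmul: "p * q \<in> J" if "p \<in> A" "q \<in> J" for p q using that ideal2_mult[OF A] J by blast
  have J0: "0 \<in> J" using ideal2_0[OF A] J by simp
  define c where "c i = (if i = 0 then b 0 else 0) + (1 - b 0) * a i
     + (if n - i \<le> m then a n * b (n - i) else 0)" for i
  have c: "c i \<in> J" if "i \<le> k" for i
    unfolding c_def using that k a(1)[of i] a(1)[of n] b(1) J(2) subring_1[OF A]
    by (auto intro!: Jadd Jmul J0 subring_diff[OF A])
  have top: "a n * z ^ n * (1 - b 0) = (\<Sum>i\<le>k. (if n - i \<le> m then a n * b (n - i) else 0) * z ^ i)"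
  proof -
    have "1 - b 0 = (\<Sum>i=1..m. b i * inverse z ^ i)"
    proof -
      have "{..m} = insert 0 {1..m}" by auto
      then show ?thesis by (subst b(2)) simp
    qed
    then have "a n * z ^ n * (1 - b 0) = (\<Sum>i=1..m. a n * b i * (z ^ n * inverse z ^ i))"
      by (simp add: sum_distrib_left mult_ac)
    also have "\<dots> = (\<Sum>i=1..m. a n * b i * z ^ (n - i))"
      using z n(3) by (intro sum.cong refl) (simp add: power_diff power_inverse divide_inverse)
    also have "\<dots> = (\<Sum>i\<in>{i. i \<le> k \<and> n - i \<le> m}. a n * b (n - i) * z ^ i)"
      using n(3) k by (intro sum.reindex_bij_witness[of _ "\<lambda>i. n - i" "\<lambda>i. n - i"]) auto
    also have "\<dots> = (\<Sum>i\<le>k. (if n - i \<le> m then a n * b (n - i) else 0) * z ^ i)"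
      by (rule sum.mono_neutral_cong_left) auto
    finally show ?thesis .
  qed
  have "(\<Sum>i\<le>k. c i * z ^ i) = b 0 + (1 - b 0) * (\<Sum>i\<le>k. a i * z ^ i)
      + (\<Sum>i\<le>k. (if n - i \<le> m then a n * b (n - i) else 0) * z ^ i)"
  proof -
    have "(\<Sum>i\<le>k. (if i = 0 then b 0 else 0) * z ^ i) = (\<Sum>i\<in>{0::nat}. b 0)"
      by (rule sum.mono_neutral_cong_right) auto
    then show ?thesis
      by (simp add: c_def distrib_right sum.distrib sum_distrib_left mult.assoc)
  qed
  also have "\<dots> = b 0 + (1 - b 0) * (\<Sum>i\<le>n. a i * z ^ i)"
    unfolding top[symmetric] by (simp add: k algebra_simps)
  also have "\<dots> = 1" using a(2) by simp
  finally show ?thesis using c k unfolding unit_relation_def by (intro exI[of _ c]) auto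
qed

lemma adjoin_subring:
  fixes z :: "'f::field"
  assumes A: "is_subring A"
  shows "is_subring {poly p z | p. \<forall>i. coeff p i \<in> A}"
proof -
  have "\<exists>p. 1 = poly p z \<and> (\<forall>i. coeff p i \<in> A)"
    using A by (intro exI[of _ 1]) (auto simp: coeff_1 intro: subring_0 subring_1)
  moreover have "\<exists>r. poly p z - poly q z = poly r z \<and> (\<forall>i. coeff r i \<in> A)"
    if "\<forall>i. coeff p i \<in> A" "\<forall>i. coeff q i \<in> A" for p q
    using A that by (intro exI[of _ "p - q"]) (auto intro: subring_diff)
  moreover have "\<exists>r. poly p z * poly q z = poly r z \<and> (\<forall>i. coeff r i \<in> A)"
    if "\<forall>i. coeff p i \<in> A" "\<forall>i. coeff q i \<in> A" for p q
    using A that by (intro exI[of _ "p * q"]) (auto simp: coeff_mult intro!: subring_sum subring_mult)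
  ultimately show ?thesis unfolding is_subring_def by blast
qed

text \<open>
  If neither \<open>z\<close> nor $1/z$ were in \<open>A\<close>, the ideal would become the unit ideal in $A[z]$ and in
  $A[1/z]$ by maximality.  Of the two relations of least degree, the one of larger degree can be
  shortened.
\<close>
lemma maximal_subring_is_valuation_ring:
  fixes z :: "'f::field"
  assumes A: "is_subring A" and uw: "u \<in> A" "w \<in> A" and one: "1 \<notin> ideal2 A u w"
    and max: "\<And>B. is_subring B \<Longrightarrow> A \<subseteq> B \<Longrightarrow> 1 \<notin> ideal2 B u w \<Longrightarrow> B = A"
    and z: "z \<noteq> 0"
  shows "z \<in> A \<or> inverse z \<in> A"
proof (rule ccontr)
  define J where "J = ideal2 A u w"
  have JA: "J \<subseteq> A" using A uw by (auto simp: J_def ideal2_def intro!: subring_add subring_mult)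
  have rel: "\<exists>n. unit_relation J s n" if s: "s \<notin> A" for s
  proof -
    define B where "B = {poly p s | p. \<forall>i. coeff p i \<in> A}"
    have "A \<subseteq> B"
    proof
      fix a assume "a \<in> A"
      then show "a \<in> B" unfolding B_def
        using subring_0[OF A] by (auto intro!: exI[of _ "[:a:]"] simp: coeff_pCons split: nat.split)
    qed
    moreover have "s \<in> B" unfolding B_def
      using subring_0[OF A] subring_1[OF A]
      by (auto intro!: exI[of _ "[:0, 1:]"] simp: coeff_pCons split: nat.split)
    moreover have "is_subring B" unfolding B_def by (rule adjoin_subring[OF A])
    ultimately have "1 \<in> ideal2 B u w" using max[of B] s by blast
    then obtain p q where pq: "1 = u * poly p s + w * poly q s" "\<forall>i. coeff p i \<in> A" "\<forall>i. coeff q i \<in> A"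
      by (auto simp: ideal2_def B_def)
    define r where "r = smult u p + smult w q"
    have "1 = poly r s" using pq by (simp add: r_def)
    moreover have "coeff r i \<in> J" for i using pq by (auto simp: r_def J_def ideal2_def)
    ultimately show ?thesis
      by (auto simp: unit_relation_def poly_altdef intro!: exI[of _ "degree r"] exI[of _ "coeff r"])
  qed
  assume "\<not> ?thesis"
  then have ex: "\<exists>n. unit_relation J z n" "\<exists>n. unit_relation J (inverse z) n" using rel by auto
  define n where "n = (LEAST n. unit_relation J z n)"
  define m where "m = (LEAST n. unit_relation J (inverse z) n)"
  have nm: "unit_relation J z n" "unit_relation J (inverse z) m"
    unfolding n_def m_def using ex by (auto intro: LeastI_ex)
  have zero: "\<not> unit_relation J s 0" for s using one by (auto simp: unit_relation_def J_def)
  have pos: "n > 0" "m > 0" using nm zero by (cases n; cases m; auto)+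
  show False
  proof (cases "m \<le> n")
    case True
    then have "unit_relation J z (n - 1)"
      using unit_relation_shorten[OF A J_def JA z nm] pos by simp
    then show False using pos not_less_Least[of "n - 1" "unit_relation J z"] by (simp add: n_def)
  next
    case False
    then have "unit_relation J (inverse z) (m - 1)"
      using unit_relation_shorten[OF A J_def JA _ nm(2), of n] nm pos z by simp
    then show False using pos not_less_Least[of "m - 1" "unit_relation J (inverse z)"] by (simp add: m_def)
  qed
qed

text \<open>
  Zorn's lemma: a relation $1 = ua + wb$ in the union of a chain holds in a member of the chain.
\<close>
lemma maximal_subring_exists:
  fixes A0 :: "'f::field set"
  assumes A0: "is_subring A0" "1 \<notin> ideal2 A0 u w"
  obtains A where "is_subring A" "A0 \<subseteq> A" "1 \<notin> ideal2 A u w"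
    "\<And>B. is_subring B \<Longrightarrow> A \<subseteq> B \<Longrightarrow> 1 \<notin> ideal2 B u w \<Longrightarrow> B = A"
proof -
  define \<A> where "\<A> = {A. is_subring A \<and> A0 \<subseteq> A \<and> 1 \<notin> ideal2 A u w}"
  have "\<exists>M\<in>\<A>. \<forall>B\<in>\<A>. M \<subseteq> B \<longrightarrow> B = M"
  proof (rule subset_Zorn_nonempty)
    show "\<A> \<noteq> {}" using A0 by (auto simp: \<A>_def)
    fix C assume C: "C \<noteq> {}" "subset.chain \<A> C"
    then have CA: "\<And>B. B \<in> C \<Longrightarrow> B \<in> \<A>" by (auto simp: subset.chain_def)
    have two: "\<exists>B\<in>C. a \<in> B \<and> b \<in> B" if "a \<in> \<Union>C" "b \<in> \<Union>C" for a b
    proof -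
      from that obtain B B' where BB: "B \<in> C" "a \<in> B" "B' \<in> C" "b \<in> B'" by auto
      then have "B \<subseteq> B' \<or> B' \<subseteq> B" using C by (auto simp: subset.chain_def)
      then show ?thesis using BB by auto
    qed
    have "is_subring (\<Union>C)"
      unfolding is_subring_def
    proof (intro conjI ballI)
      show "1 \<in> \<Union>C" using C(1) CA by (auto simp: \<A>_def intro: subring_1)
      fix a b assume "a \<in> \<Union>C" "b \<in> \<Union>C"
      then obtain B where "B \<in> C" "a \<in> B" "b \<in> B" using two by blast
      then show "a - b \<in> \<Union>C" "a * b \<in> \<Union>C"
        using CA[of B] by (auto simp: \<A>_def intro: subring_diff subring_mult)
    qed
    moreover have "A0 \<subseteq> \<Union>C" using C(1) CA by (auto simp: \<A>_def)
    moreover have "1 \<notin> ideal2 (\<Union>C) u w"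
    proof
      assume "1 \<in> ideal2 (\<Union>C) u w"
      then obtain a b where ab: "1 = u * a + w * b" "a \<in> \<Union>C" "b \<in> \<Union>C" unfolding ideal2_def by blast
      obtain B where "B \<in> C" "a \<in> B" "b \<in> B" using two ab by blast
      then show False using ab(1) CA[of B] by (auto simp: \<A>_def ideal2_def)
    qed
    ultimately show "\<Union>C \<in> \<A>" by (simp add: \<A>_def)
  qed
  then obtain A where A: "A \<in> \<A>" "\<And>B. B \<in> \<A> \<Longrightarrow> A \<subseteq> B \<Longrightarrow> B = A" by auto
  show ?thesis
    by (rule that[of A]) (use A in \<open>auto simp: \<A>_def\<close>)
qed

context field_extension
begin

text \<open>
  The constant term of an equation for \<open>t\<close>, which may be assumed nonzero, is a multiple of \<open>t\<close>.
\<close>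
lemma algebraic_inverse_in_subring:
  assumes A: "is_subring A" "range \<iota> \<subseteq> A" "t \<in> A" and t: "t \<noteq> 0" "\<not> transcendental t"
  shows "inverse t \<in> A"
proof -
  obtain p where "p \<noteq> 0" "ev p t = 0" using t by (auto simp: transcendental_def)
  then show ?thesis
  proof (induction p)
    case (pCons a p)
    show ?case
    proof (cases "a = 0")
      case True
      then have "p \<noteq> 0" "ev p t = 0" using pCons t by (auto simp: ev_pCons hom_0)
      then show ?thesis using pCons by simp
    next
      case False
      have "t * ev p t = - \<iota> a" using pCons.prems by (simp add: ev_pCons eq_neg_iff_add_eq_0 add.commute)
      then have "inverse t = \<iota> (- inverse a) * ev p t"
        unfolding hom_uminus iota_inverse using False t by (simp add: field_simps)
      also have "\<dots> \<in> A" using A by (intro subring_mult ev_in_subring) auto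
      finally show ?thesis .
    qed
  qed simp
qed

lemma transcendental_inverse:
  assumes t: "transcendental t" shows "transcendental (inverse t)"
  unfolding transcendental_def
proof (intro allI impI)
  fix p assume p: "ev p (inverse t) = 0"
  have t0: "t \<noteq> 0" by (rule transcendental_neq_0[OF t])
  interpret e: ring_morphism "\<lambda>p. ev p t" by (rule ev_morphism)
  define n where "n = degree p"
  define q where "q = (\<Sum>k\<le>n. monom (coeff p k) (n - k))"
  have "ev q t = (\<Sum>k\<le>n. \<iota> (coeff p k) * t ^ (n - k))"
    by (simp add: q_def e.hom_sum ev_monom)
  also have "\<dots> = (\<Sum>k\<le>n. t ^ n * (\<iota> (coeff p k) * inverse t ^ k))"
    using t0 by (intro sum.cong refl) (simp add: power_diff power_inverse divide_inverse)
  also have "\<dots> = t ^ n * ev p (inverse t)"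
    by (simp add: ev_def eval_altdef[of p n] n_def sum_distrib_left)
  finally have "q = 0" using p t by (simp add: transcendental_def)
  have "coeff p n = (\<Sum>k\<le>n. if k = n then coeff p k else 0)" by simp
  also have "\<dots> = coeff q 0" unfolding q_def coeff_sum by (intro sum.cong) auto
  finally show "p = 0" using \<open>q = 0\<close> by (simp add: n_def)
qed

end

text \<open>
  The defining property of a function field in one variable, in the form in which it is applied:
  for every transcendental $t$ there is a bound on the number of elements that are linearly
  independent over $K(t)$.
\<close>
locale one_dim_extension = field_extension \<iota> for \<iota> :: "'a::field \<Rightarrow> 'f::field" +
  assumes finite_rank:
    "transcendental t \<Longrightarrow> \<exists>N::nat. \<forall>z::nat \<Rightarrow> 'f.
       \<exists>c. (\<forall>i\<le>N. c i \<in> rat_field t) \<and> (\<exists>i\<le>N. c i \<noteq> 0) \<and> (\<Sum>i\<le>N. c i * z i) = 0"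
begin

context
  fixes R :: "'f set"
  assumes R: "is_subring R" and KR: "range \<iota> \<subseteq> R"
    and val: "\<And>z. z \<noteq> 0 \<Longrightarrow> z \<in> R \<or> inverse z \<in> R"
    and proper: "\<exists>z\<in>R. z \<noteq> 0 \<and> inverse z \<notin> R"
begin

definition nonunits :: "'f set" where
  "nonunits = {z \<in> R. z = 0 \<or> inverse z \<notin> R}"

lemma nonunits_mult: "a \<in> nonunits \<Longrightarrow> b \<in> R \<Longrightarrow> a * b \<in> nonunits"
proof (cases "a * b = 0")
  case False
  assume a: "a \<in> nonunits" and b: "b \<in> R"
  have "inverse (a * b) \<notin> R"
  proof
    assume "inverse (a * b) \<in> R"
    then have "b * inverse (a * b) \<in> R" using b R by (intro subring_mult)
    then show False using a False by (auto simp: nonunits_def field_simps)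
  qed
  then show ?thesis using a b R by (auto simp: nonunits_def intro: subring_mult)
qed (auto simp: nonunits_def subring_0 R)

lemma nonunits_add: "a \<in> nonunits \<Longrightarrow> b \<in> nonunits \<Longrightarrow> a + b \<in> nonunits"
proof -
  have *: "a + b \<in> nonunits" if ab: "a \<in> nonunits" "b \<in> nonunits" "b \<noteq> 0" "a / b \<in> R" for a b
  proof -
    have "b * (1 + a / b) \<in> nonunits" using ab R by (intro nonunits_mult subring_add subring_1) auto
    moreover have "b * (1 + a / b) = a + b" using ab by (simp add: field_simps)
    ultimately show ?thesis by simp
  qed
  assume ab: "a \<in> nonunits" "b \<in> nonunits"
  show ?thesis
  proof (cases "a = 0 \<or> b = 0")
    case False
    then have "a / b \<in> R \<or> b / a \<in> R" using val[of "a / b"] by simp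
    then show ?thesis using *[of a b] *[of b a] ab False by (auto simp: add.commute)
  qed (use ab in auto)
qed

lemma nonunits_0: "0 \<in> nonunits"
  by (simp add: nonunits_def subring_0 R)

lemma nonunits_sum: "(\<And>i. i \<in> I \<Longrightarrow> g i \<in> nonunits) \<Longrightarrow> sum g I \<in> nonunits"
  by (induction I rule: infinite_finite_induct) (auto intro: nonunits_0 nonunits_add)

lemma nonunits_subset: "nonunits \<subseteq> R"
  by (auto simp: nonunits_def)

lemma iota_nonunit: "\<iota> c \<in> nonunits \<Longrightarrow> c = 0"
  using KR by (auto simp: nonunits_def simp flip: iota_inverse)

lemma nonunit_transcendental: "t \<in> nonunits \<Longrightarrow> t \<noteq> 0 \<Longrightarrow> transcendental t"
  using algebraic_inverse_in_subring[OF R KR, of t] by (auto simp: nonunits_def)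

text \<open>
  The elements of such a chain are linearly independent over $K(t)$, where $t$ is the first of them.
  For in a relation with coefficients in $K[t]$, not all divisible by $t$, the last term whose
  coefficient is not divisible by $t$ strictly divides all other terms: the earlier ones by the chain
  condition, and the later ones because their coefficients are multiples of $t$, which itself is the
  first element of the chain.
\<close>
lemma no_infinite_divisor_chain:
  assumes s: "\<And>i::nat. s i \<noteq> 0" "\<And>i. s i \<in> nonunits" "\<And>i. s i / s (Suc i) \<in> nonunits"
  shows False
proof -
  have chain: "s i / s j \<in> nonunits" if "i < j" for i j
    using that
  proof (induction j)
    case (Suc j)
    show ?case
    proof (cases "i = j")
      case False
      then have "s i / s j * (s j / s (Suc j)) \<in> nonunits"
        using Suc s(3)[of j] nonunits_subset by (intro nonunits_mult) auto
      then show ?thesis using s(1)[of j] by simp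
    qed (use s in auto)
  qed simp
  define t where "t = s 0"
  have t: "transcendental t" "t \<in> R" using s nonunit_transcendental nonunits_subset by (auto simp: t_def)
  obtain N c where c: "\<forall>i\<le>N. c i \<in> rat_field t" "\<exists>i\<le>N. c i \<noteq> 0" "(\<Sum>i\<le>N. c i * s i) = 0"
    using finite_rank[OF t(1)] by metis
  obtain p where p: "\<exists>i\<in>{..N}. coeff (p i) 0 \<noteq> 0" "(\<Sum>i\<in>{..N}. ev (p i) t * s i) = 0"
    by (rule clear_denominators[OF t(1), of "{..N}" c s]) (use c in auto)
  define I where "I = {i. i \<le> N \<and> coeff (p i) 0 \<noteq> 0}"
  define k where "k = Max I"
  have "finite I" "I \<noteq> {}" using p(1) by (auto simp: I_def)
  then have k: "k \<in> I" "\<And>i. i \<in> I \<Longrightarrow> i \<le> k" by (auto simp: k_def)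
  have evR: "ev q t \<in> R" for q using t R KR by (intro ev_in_subring)
  have summand: "ev (p i) t * s i / s k \<in> nonunits" if i: "i \<in> {..N} - {k}" for i
  proof (cases "i < k")
    case True
    then show ?thesis using nonunits_mult[OF chain evR] by (simp add: mult.commute)
  next
    case False
    then have "coeff (p i) 0 = 0" using k(2)[of i] i by (auto simp: I_def)
    then obtain q where q: "ev (p i) t = t * ev q t" using ev_split_const[of "p i" t] by (auto simp: hom_0)
    have "s 0 / s k \<in> R" using chain[of 0 k] nonunits_subset s(1) subring_1[OF R] by (cases "k = 0") auto
    then have "s i * (s 0 / s k * ev q t) \<in> nonunits" using s(2) evR R by (intro nonunits_mult subring_mult)
    then show ?thesis unfolding q by (simp add: t_def mult_ac)
  qed
  have "k \<le> N" using k by (simp add: I_def)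
  then have "0 = (ev (p k) t * s k + (\<Sum>i\<in>{..N} - {k}. ev (p i) t * s i)) / s k"
    using p(2) by (simp add: sum.remove)
  also have "\<dots> = ev (p k) t + (\<Sum>i\<in>{..N} - {k}. ev (p i) t * s i / s k)"
    using s(1) by (simp add: add_divide_distrib sum_divide_distrib)
  finally have ev_eq: "ev (p k) t = - 1 * (\<Sum>i\<in>{..N} - {k}. ev (p i) t * s i / s k)"
    by (simp add: eq_neg_iff_add_eq_0)
  have neg: "- 1 * a \<in> nonunits" if "a \<in> nonunits" for a
    using nonunits_mult[OF that subring_uminus[OF R subring_1[OF R]]] by simp
  have "ev (p k) t \<in> nonunits" unfolding ev_eq by (intro neg nonunits_sum summand)
  moreover obtain q where q: "ev (p k) t = \<iota> (coeff (p k) 0) + t * ev q t" using ev_split_const by blast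
  moreover have "t * ev q t \<in> nonunits" using s evR by (auto simp: t_def intro: nonunits_mult)
  ultimately have "ev (p k) t + - 1 * (t * ev q t) \<in> nonunits"
    using neg by (intro nonunits_add) auto
  moreover have "ev (p k) t + - 1 * (t * ev q t) = \<iota> (coeff (p k) 0)" unfolding q by simp
  ultimately have "\<iota> (coeff (p k) 0) \<in> nonunits" by (simp only:)
  then show False using iota_nonunit k by (simp add: I_def)
qed

text \<open>
  Otherwise every nonunit would have a proper divisor among the nonunits, and iteration would produce
  an infinite chain.
\<close>
lemma uniformizer_exists:
  obtains \<pi> where "\<pi> \<in> nonunits" "\<pi> \<noteq> 0" "\<And>z. z \<in> nonunits \<Longrightarrow> z / \<pi> \<in> R"
proof (rule ccontr)
  note witness = that
  assume no: "\<not> thesis"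
  define P where "P = nonunits - {0}"
  have "\<exists>z\<in>P. s / z \<in> nonunits" if s: "s \<in> P" for s
  proof -
    have "\<exists>z. z \<in> nonunits \<and> z / s \<notin> R" using no witness[of s] s by (auto simp: P_def)
    then obtain z where z: "z \<in> nonunits" "z / s \<notin> R" by blast
    then have "z \<noteq> 0" using subring_0[OF R] by auto
    then have "s / z \<in> R" using val[of "z / s"] s z by (auto simp: P_def)
    then show ?thesis using z \<open>z \<noteq> 0\<close> by (auto simp: P_def nonunits_def)
  qed
  then obtain g where g: "\<And>s. s \<in> P \<Longrightarrow> g s \<in> P" "\<And>s. s \<in> P \<Longrightarrow> s / g s \<in> nonunits" by metis
  obtain s0 where s0: "s0 \<in> P" using proper by (auto simp: P_def nonunits_def)
  have P: "(g ^^ i) s0 \<in> P" for i by (induction i) (auto simp: s0 g)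
  show False
    by (rule no_infinite_divisor_chain[of "\<lambda>i. (g ^^ i) s0"]) (use P g(2)[OF P] in \<open>auto simp: P_def\<close>)
qed

text \<open>
  Every nonzero element of the ring is a unit times a power of the uniformizer, because division by
  the uniformizer can be repeated only finitely often; the value is the exponent.
\<close>
lemma valuation_ring_gives_place:
  obtains v where "is_place \<iota> v" "\<And>z. z \<in> nonunits \<Longrightarrow> z \<noteq> 0 \<Longrightarrow> v z > 0"
proof -
  obtain \<pi> where \<pi>: "\<pi> \<in> nonunits" "\<pi> \<noteq> 0" "\<And>z. z \<in> nonunits \<Longrightarrow> z / \<pi> \<in> R"
    by (rule uniformizer_exists) blast
  define U where "U = {z \<in> R. z \<noteq> 0 \<and> inverse z \<in> R}"
  have U1: "1 \<in> U" using subring_1[OF R] by (simp add: U_def)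
  have Umult: "a * b \<in> U" if "a \<in> U" "b \<in> U" for a b using that R by (auto simp: U_def intro: subring_mult)
  have Uinv: "inverse a \<in> U" if "a \<in> U" for a using that by (auto simp: U_def)
  have \<pi>R: "\<pi> \<in> R" using \<pi> nonunits_subset by auto
  have pow: "\<exists>k::nat. z / \<pi> ^ k \<in> U" if z: "z \<in> R" "z \<noteq> 0" for z
  proof -
    have "\<exists>k. z / \<pi> ^ k \<notin> nonunits"
    proof (rule ccontr)
      assume "\<nexists>k. z / \<pi> ^ k \<notin> nonunits"
      then show False using z \<pi> by (intro no_infinite_divisor_chain[of "\<lambda>i. z / \<pi> ^ i"]) auto
    qed
    then have ex: "\<exists>k. z / \<pi> ^ k \<notin> nonunits" .
    define k where "k = (LEAST k. z / \<pi> ^ k \<notin> nonunits)"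
    have k: "z / \<pi> ^ k \<notin> nonunits" unfolding k_def by (rule LeastI_ex[OF ex])
    have "z / \<pi> ^ k \<in> R"
    proof (cases k)
      case (Suc m)
      then have "z / \<pi> ^ m \<in> nonunits" using not_less_Least[of m "\<lambda>k. z / \<pi> ^ k \<notin> nonunits"] by (auto simp: k_def)
      then have "z / \<pi> ^ m / \<pi> \<in> R" using \<pi> by blast
      then show ?thesis using Suc by (simp add: mult.commute)
    qed (use z in auto)
    then show ?thesis using k z \<pi> by (intro exI[of _ k]) (auto simp: U_def nonunits_def)
  qed
  have ex: "\<exists>k::int. z * \<pi> powi (- k) \<in> U" if z: "z \<noteq> 0" for z
  proof (cases "z \<in> R")
    case True
    then obtain k :: nat where "z / \<pi> ^ k \<in> U" using pow z by blast
    then show ?thesis by (intro exI[of _ "int k"]) (simp add: power_int_minus divide_inverse)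
  next
    case False
    then have "inverse z \<in> R" using val z by blast
    then obtain k :: nat where "inverse z / \<pi> ^ k \<in> U" using pow z by (metis nonzero_imp_inverse_nonzero)
    then have "inverse (inverse z / \<pi> ^ k) \<in> U" by (rule Uinv)
    then show ?thesis by (intro exI[of _ "- int k"]) (simp add: field_simps)
  qed
  have nat_pow_unit: "k = 0" if "\<pi> ^ k \<in> U" for k :: nat
  proof (rule ccontr)
    assume "k \<noteq> 0"
    then obtain m where "k = Suc m" by (cases k) auto
    then have "\<pi> ^ k \<in> nonunits" using nonunits_mult[OF \<pi>(1) subring_power[OF R \<pi>R]] by simp
    then show False using that by (auto simp: U_def nonunits_def)
  qed
  have pow_unit: "k = 0" if "\<pi> powi k \<in> U" for k :: int
  proof (cases "k \<ge> 0")
    case True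
    then show ?thesis using that nat_pow_unit[of "nat k"] by (simp add: power_int_def)
  next
    case False
    then have "inverse (\<pi> powi k) = \<pi> ^ nat (- k)" by (simp add: power_int_def power_inverse)
    then show ?thesis using Uinv[OF that] nat_pow_unit[of "nat (- k)"] False by simp
  qed
  have uniq: "k = l" if "z * \<pi> powi (- k) \<in> U" "z * \<pi> powi (- l) \<in> U" "z \<noteq> 0" for z k l
  proof -
    have "z * \<pi> powi (- k) * inverse (z * \<pi> powi (- l)) \<in> U" using that Umult Uinv by blast
    also have "z * \<pi> powi (- k) * inverse (z * \<pi> powi (- l)) = \<pi> powi (l - k)"
      using that(3) \<pi>(2) by (simp add: power_int_diff power_int_minus field_simps)
    finally show ?thesis using pow_unit by force
  qed
  define v where "v z = (if z = 0 then 0 else THE k::int. z * \<pi> powi (- k) \<in> U)" for z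
  have v: "z * \<pi> powi (- v z) \<in> U" if z: "z \<noteq> 0" for z
  proof -
    obtain k where k: "z * \<pi> powi (- k) \<in> U" using ex[OF z] by blast
    then have "v z = k" unfolding v_def using z uniq by (auto intro!: the_equality)
    then show ?thesis using k by simp
  qed
  have veq: "v z = k" if "z * \<pi> powi (- k) \<in> U" "z \<noteq> 0" for z k
    using uniq[OF v that(1)] that(2) by simp
  have vmult: "v (a * b) = v a + v b" if "a \<noteq> 0" "b \<noteq> 0" for a b
  proof (rule veq)
    have "(a * \<pi> powi (- v a)) * (b * \<pi> powi (- v b)) \<in> U" using that v Umult by blast
    also have "(a * \<pi> powi (- v a)) * (b * \<pi> powi (- v b)) = a * b * \<pi> powi (- (v a + v b))"
      using \<pi>(2) by (simp add: power_int_diff power_int_minus field_simps power_int_add)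
    finally show "a * b * \<pi> powi (- (v a + v b)) \<in> U" .
  qed (use that in auto)
  have vpow: "v (\<pi> powi k) = k" for k
    using \<pi>(2) U1 by (intro veq) (auto simp: power_int_minus)
  have vR: "z \<in> R \<longleftrightarrow> v z \<ge> 0" if z: "z \<noteq> 0" for z
  proof
    assume "z \<in> R"
    then obtain k :: nat where "z / \<pi> ^ k \<in> U" using pow z by blast
    then have "v z = int k" using z by (intro veq) (auto simp: power_int_minus divide_inverse)
    then show "v z \<ge> 0" by simp
  next
    assume "v z \<ge> 0"
    then have "\<pi> powi (v z) \<in> R" using \<pi>R R by (auto simp: power_int_def intro: subring_power)
    then have "z * \<pi> powi (- v z) * \<pi> powi (v z) \<in> R"
      using v[OF z] R by (auto simp: U_def intro: subring_mult)
    then show "z \<in> R" using \<pi>(2) by (simp add: power_int_minus field_simps)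
  qed
  have vinv: "v (inverse z) = - v z" if "z \<noteq> 0" for z
    using vmult[of z "inverse z"] vpow[of 0] that by simp
  have "is_place \<iota> v"
    unfolding is_place_def
  proof (intro conjI allI impI)
    show "v 0 = 0" by (simp add: v_def)
    show "v (a * b) = v a + v b" if "a \<noteq> 0" "b \<noteq> 0" for a b using vmult that by blast
    show "min (v a) (v b) \<le> v (a + b)" if "a \<noteq> 0" "b \<noteq> 0" "a + b \<noteq> 0" for a b
    proof -
      define m where "m = min (v a) (v b)"
      define s where "s = \<pi> powi (- m)"
      have s: "s \<noteq> 0" "v s = - m" using \<pi>(2) vpow by (auto simp: s_def)
      have "a * s \<in> R" "b * s \<in> R" using that s vR[of "a * s"] vR[of "b * s"] by (auto simp: vmult m_def)
      then have "(a + b) * s \<in> R" using R by (simp add: distrib_right subring_add)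
      then have "v ((a + b) * s) \<ge> 0" using that s by (subst (asm) vR) auto
      then show ?thesis using that s by (simp add: vmult m_def)
    qed
    show "v (\<iota> c) = 0" for c
    proof (cases "c = 0")
      case False
      then have "\<iota> c \<in> U" using KR by (auto simp: U_def simp flip: iota_inverse)
      then show ?thesis using False by (intro veq) auto
    qed (simp add: hom_0 v_def)
    show "surj v" by (rule surjI[of v "\<lambda>k. \<pi> powi k"]) (rule vpow)
  qed
  moreover have "v z > 0" if "z \<in> nonunits" "z \<noteq> 0" for z
    using that vR[of z] vR[of "inverse z"] vinv[of z] by (auto simp: nonunits_def)
  ultimately show ?thesis using that by blast
qed

end

theorem place_exists:
  assumes A: "is_subring A" "range \<iota> \<subseteq> A" "u \<in> A" "w \<in> A" and uw: "u \<noteq> 0" "1 \<notin> ideal2 A u w"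
  obtains v where "is_place \<iota> v" "v u > 0" "w = 0 \<or> v w > 0"
proof -
  obtain R where R: "is_subring R" "A \<subseteq> R" "1 \<notin> ideal2 R u w"
    "\<And>B. is_subring B \<Longrightarrow> R \<subseteq> B \<Longrightarrow> 1 \<notin> ideal2 B u w \<Longrightarrow> B = R"
    by (rule maximal_subring_exists[OF A(1) uw(2)]) blast
  have uwR: "u \<in> R" "w \<in> R" and KR: "range \<iota> \<subseteq> R" using R A by auto
  have val: "z \<in> R \<or> inverse z \<in> R" if "z \<noteq> 0" for z
    using maximal_subring_is_valuation_ring[OF R(1) uwR R(3,4) that] .
  have u: "inverse u \<notin> R"
  proof
    assume "inverse u \<in> R"
    moreover have "1 = u * inverse u + w * 0" using uw by simp
    ultimately show False using R(3) subring_0[OF R(1)] unfolding ideal2_def by blast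
  qed
  have w: "w \<noteq> 0 \<Longrightarrow> inverse w \<notin> R"
  proof
    assume "inverse w \<in> R" "w \<noteq> 0"
    moreover from this have "1 = u * 0 + w * inverse w" by simp
    ultimately show False using R(3) subring_0[OF R(1)] unfolding ideal2_def by blast
  qed
  have proper: "\<exists>z\<in>R. z \<noteq> 0 \<and> inverse z \<notin> R" using u uw uwR by auto
  obtain v where "is_place \<iota> v" "\<And>z. z \<in> nonunits R \<Longrightarrow> z \<noteq> 0 \<Longrightarrow> v z > 0"
    using valuation_ring_gives_place[OF R(1) KR val proper] by blast
  then show ?thesis using that u w uw uwR nonunits_def[OF R(1) KR val proper] by auto
qed

text \<open>
  The ideal generated by $1/h$ in the polynomial ring $K[1/h]$ is proper.
\<close>
lemma transcendental_has_pole: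
  assumes h: "transcendental h"
  obtains v where "is_place \<iota> v" "v h < 0"
proof -
  define u where "u = inverse h"
  have u0: "u \<noteq> 0" using transcendental_neq_0[OF h] by (simp add: u_def)
  have u: "transcendental u" unfolding u_def by (rule transcendental_inverse[OF h])
  interpret e: ring_morphism "\<lambda>p. ev p u" by (rule ev_morphism)
  define A where "A = range (\<lambda>p. ev p u)"
  have A: "is_subring A"
    unfolding is_subring_def A_def using e.hom_1 by (auto simp flip: e.hom_diff e.hom_mult)
  have KA: "range \<iota> \<subseteq> A" unfolding A_def using ev_const[of _ u] by (auto simp flip: ev_const[of _ u])
  have s: "ev [:0, 1:] u = u" by (simp add: ev_pCons hom_0 hom_1)
  then have uA: "u \<in> A" unfolding A_def by (metis rangeI)
  have "1 \<notin> ideal2 A u u"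
  proof
    assume "1 \<in> ideal2 A u u"
    then obtain p q where "1 = u * ev p u + u * ev q u" by (auto simp: ideal2_def A_def)
    then have "ev (1 - [:0, 1:] * (p + q)) u = 0"
      by (simp only: e.hom_diff e.hom_1 e.hom_mult e.hom_add s) (simp add: distrib_left)
    then have "1 - [:0, 1:] * (p + q) = 0" using u unfolding transcendental_def by blast
    then have "coeff (1 - [:0, 1:] * (p + q)) 0 = 0" by simp
    then show False by (simp add: coeff_mult)
  qed
  then obtain v where "is_place \<iota> v" "v u > 0" using place_exists[OF A KA uA uA u0] by blast
  then show ?thesis using that[of v] by (simp add: u_def place_inverse)
qed

end

section \<open>The degree of a pole divisor\<close>

context field_extension
begin

text \<open>
  The residue classes of \<open>B\<close> are linearly independent over $K$.  In contrast to a residue basis, such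
  a set exists without any finiteness property of the residue field.
\<close>
definition residue_independent :: "('f \<Rightarrow> int) \<Rightarrow> 'f set \<Rightarrow> bool" where
  "residue_independent v B \<longleftrightarrow> finite B \<and> (\<forall>b\<in>B. val_ge v 0 b) \<and>
     (\<forall>c. val_ge v 1 (\<Sum>b\<in>B. \<iota> (c b) * b) \<longrightarrow> (\<forall>b\<in>B. c b = 0))"

lemma residue_independentD:
  "residue_independent v B \<Longrightarrow> val_ge v 1 (\<Sum>b\<in>B. \<iota> (c b) * b) \<Longrightarrow> b \<in> B \<Longrightarrow> c b = 0"
  by (simp add: residue_independent_def)

lemma residue_independent_one: "is_place \<iota> v \<Longrightarrow> residue_independent v {1}"
  using val_ge_iota_pos[of v 1] by (auto simp: residue_independent_def val_ge_def[of v 0] place_1)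

text \<open>
  The coefficients of a $t$-adic expansion are determined one after the other: if those before \<open>j\<close>
  vanish, division by $t^j$ leaves the \<open>j\<close>-th one as the residue class.
\<close>
lemma power_series_coefficients_zero:
  assumes v: "is_place \<iota> v" and t: "t \<noteq> 0" "v t = 1" and B: "residue_independent v B"
    and sum: "val_ge v (int e) (\<Sum>j<e. \<Sum>b\<in>B. \<iota> (c j b) * (t ^ j * b))"
    and j: "j < e"
  shows "\<forall>b\<in>B. c j b = 0"
  using j
proof (induction j rule: less_induct)
  case (less j)
  define s where "s i = (\<Sum>b\<in>B. \<iota> (c i b) * b)" for i
  have s0: "val_ge v 0 (s i)" for i
    unfolding s_def using B by (intro val_ge_sum[OF v] val_ge_scale[OF v]) (auto simp: residue_independent_def)
  have ts: "(\<Sum>b\<in>B. \<iota> (c i b) * (t ^ i * b)) = t ^ i * s i" for i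
    by (simp add: s_def sum_distrib_left mult_ac)
  have tpow: "val_ge v (int i) (t ^ i)" for i
    using t by (simp add: val_ge_def place_power[OF v])
  have "(\<Sum>i<e. t ^ i * s i) = (\<Sum>i\<in>{j..<e}. t ^ i * s i)"
    by (rule sum.mono_neutral_right) (use less in \<open>auto simp: s_def hom_0\<close>)
  also have "\<dots> = t ^ j * s j + (\<Sum>i\<in>{Suc j..<e}. t ^ i * s i)"
    using less.prems by (simp add: sum.atLeast_Suc_lessThan)
  finally have "t ^ j * s j = (\<Sum>i<e. t ^ i * s i) - (\<Sum>i\<in>{Suc j..<e}. t ^ i * s i)" by simp
  moreover have "val_ge v (int j + 1) (\<Sum>i<e. t ^ i * s i)"
    using sum less.prems unfolding ts by (elim val_ge_mono) auto
  moreover have "val_ge v (int j + 1) (\<Sum>i\<in>{Suc j..<e}. t ^ i * s i)"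
    by (rule val_ge_sum[OF v], rule val_ge_mult[OF v tpow s0]) auto
  ultimately have "val_ge v (int j + 1) (t ^ j * s j)" using val_ge_diff[OF v] by simp
  then have "val_ge v 1 (s j)"
    using t by (cases "s j = 0") (auto simp: val_ge_def place_mult[OF v] place_power[OF v])
  then show ?case using B by (simp add: s_def residue_independent_def)
qed

text \<open>
  The inequality $\sum e_v f_v \le [L:K(x)]$.  By weak approximation there are elements that are
  close to $\pi_v^j b$ at \<open>v\<close> and close to 0 at the other places of \<open>S\<close>, for $j < e_v$ and \<open>b\<close> in $B_v$.
  A linear relation between them over $K(t)$, where $t = 1/x$, may be assumed to be nontrivial
  modulo $t$.  As $t$ has the value $e_v$ at \<open>v\<close>, reduction modulo $t$ gives a relation over $K$
  between the elements $\pi_v^j b$ modulo $\pi_v^{e_v}$, which must be trivial.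
\<close>
lemma sum_ramification_times_degree_le:
  fixes z :: "nat \<Rightarrow> 'f"
  assumes x: "transcendental x" and span: "Span (rat_field x) z {..<n} = UNIV"
    and S: "finite S" "\<And>v. v \<in> S \<Longrightarrow> is_place \<iota> v" "\<And>v. v \<in> S \<Longrightarrow> v x < 0"
    and B: "\<And>v. v \<in> S \<Longrightarrow> residue_independent v (B v)"
  shows "(\<Sum>v\<in>S. nat (- v x) * card (B v)) \<le> n"
proof (rule ccontr)
  assume gt: "\<not> ?thesis"
  define t where "t = inverse x"
  have t: "transcendental t" unfolding t_def by (rule transcendental_inverse[OF x])
  have t0: "t \<noteq> 0" by (rule transcendental_neq_0[OF t])
  define e where "e v = nat (- v x)" for v
  have vt: "v t = int (e v)" "e v > 0" if "v \<in> S" for v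
    using S(3)[OF that] by (simp_all add: t_def place_inverse[OF S(2)[OF that]] e_def)
  define I where "I = Sigma S (\<lambda>v. {..<e v} \<times> B v)"
  have finB: "finite (B v)" if "v \<in> S" for v using B[OF that] by (simp add: residue_independent_def)
  have finI: "finite I" unfolding I_def using S finB by auto
  have "card I = (\<Sum>v\<in>S. e v * card (B v))"
    unfolding I_def using S finB by (subst card_SigmaI) (auto simp: card_cartesian_product)
  then have cardI: "card {..<n} < card I" using gt by (simp add: e_def)
  have "\<forall>v\<in>S. \<exists>p. p \<noteq> 0 \<and> v p = 1" using obtain_place_value S(2) by metis
  then obtain \<pi> where \<pi>: "\<And>v. v \<in> S \<Longrightarrow> \<pi> v \<noteq> 0" "\<And>v. v \<in> S \<Longrightarrow> v (\<pi> v) = 1" by metis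
  \<comment> \<open>a precision that is sufficient at all places of \<open>S\<close>\<close>
  define N where "N = (\<Sum>v\<in>S. e v)"
  have N: "e v \<le> N" if "v \<in> S" for v unfolding N_def using that S(1) by (intro member_le_sum) auto
  define a where "a w i = (case i of (v, j, b) \<Rightarrow> if w = v then \<pi> v ^ j * b else 0)" for w i
  have "\<exists>h. \<forall>w\<in>S. val_ge w (int N) (h - a w i)" for i
    using weak_approximation[OF S(1), of N "\<lambda>w. a w i"] S(2) by blast
  then obtain h where h: "\<And>i w. w \<in> S \<Longrightarrow> val_ge w (int N) (h i - a w i)" by metis
  have a0: "val_ge w 0 (a w i)" if "w \<in> S" "i \<in> I" for w i
  proof -
    obtain v j b where i: "i = (v, j, b)" by (metis prod_cases3)
    have "val_ge w 0 (\<pi> w ^ j * b)" if "w = v"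
    proof (rule val_ge_mult[OF S(2)[OF \<open>w \<in> S\<close>], where N = 0 and M = 0])
      show "val_ge w 0 (\<pi> w ^ j)"
        using \<pi>[OF \<open>w \<in> S\<close>] by (intro val_ge_power[OF S(2)[OF \<open>w \<in> S\<close>]]) (simp add: val_ge_def)
      show "val_ge w 0 b"
        using B[OF \<open>w \<in> S\<close>] \<open>i \<in> I\<close> that by (simp add: i I_def residue_independent_def)
    qed simp
    then show ?thesis by (auto simp: a_def i)
  qed
  have h0: "val_ge w 0 (h i)" if "w \<in> S" "i \<in> I" for w i
  proof -
    have "val_ge w 0 (h i - a w i + a w i)"
      by (rule val_ge_add[OF S(2)[OF that(1)] val_ge_mono[OF h[OF that(1)]] a0[OF that]]) simp
    then show ?thesis by simp
  qed
  have "\<exists>c. (\<forall>i\<in>I. c i \<in> rat_field x) \<and> (\<exists>i\<in>I. c i \<noteq> 0) \<and> (\<Sum>i\<in>I. c i * h i) = 0"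
    by (rule dependent_if_more_than_spanning[OF subfield_subring[OF subfield_rat_field] _ finI cardI, where w = z])
       (auto simp: span)
  then obtain c where c: "\<forall>i\<in>I. c i \<in> rat_field x" "\<exists>i\<in>I. c i \<noteq> 0" "(\<Sum>i\<in>I. c i * h i) = 0" by blast
  have "c i \<in> rat_field t" if "i \<in> I" for i using c(1) that by (simp add: t_def rat_field_inverse)
  then obtain p where p: "\<exists>i\<in>I. coeff (p i) 0 \<noteq> 0" "(\<Sum>i\<in>I. ev (p i) t * h i) = 0"
    by (rule clear_denominators[OF t finI _ c(2,3)])
  define c where "c i = coeff (p i) 0" for i
  have "\<forall>i. \<exists>q. ev (p i) t = \<iota> (c i) + t * ev q t" using ev_split_const by (simp add: c_def)
  then have "\<exists>q. \<forall>i. ev (p i) t = \<iota> (c i) + t * ev (q i) t" by (rule choice)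
  then obtain q where q: "\<And>i. ev (p i) t = \<iota> (c i) + t * ev (q i) t" by blast
  have "c (v, j, b) = 0" if v: "v \<in> S" and j: "j < e v" and b: "b \<in> B v" for v j b
  proof -
    note pv = S(2)[OF v]
    have tv: "val_ge v (int (e v)) t" using vt[OF v] by (simp add: val_ge_def)
    have "0 = (\<Sum>i\<in>I. \<iota> (c i) * h i) + (\<Sum>i\<in>I. t * ev (q i) t * h i)"
      using p(2) by (simp add: q distrib_right sum.distrib)
    then have "(\<Sum>i\<in>I. \<iota> (c i) * h i) = - (\<Sum>i\<in>I. t * ev (q i) t * h i)" by (simp add: eq_neg_iff_add_eq_0)
    moreover have "val_ge v (int (e v)) (\<Sum>i\<in>I. t * ev (q i) t * h i)"
    proof (rule val_ge_sum[OF pv])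
      fix i assume i: "i \<in> I"
      have "val_ge v 0 t" using tv by (elim val_ge_mono) auto
      then have "val_ge v 0 (ev (q i) t)" by (rule val_ge_ev[OF pv])
      then have "val_ge v (int (e v)) (t * ev (q i) t)" by (rule val_ge_mult[OF pv tv]) auto
      then show "val_ge v (int (e v)) (t * ev (q i) t * h i)"
        by (rule val_ge_mult[OF pv _ h0[OF v i]]) auto
    qed
    ultimately have 1: "val_ge v (int (e v)) (\<Sum>i\<in>I. \<iota> (c i) * h i)"
      by (simp add: val_ge_uminus[OF pv])
    have 2: "val_ge v (int (e v)) (\<Sum>i\<in>I. \<iota> (c i) * (h i - a v i))"
      by (rule val_ge_sum[OF pv], rule val_ge_scale[OF pv], rule val_ge_mono[OF h[OF v]]) (use N[OF v] in simp)
    have "val_ge v (int (e v)) (\<Sum>i\<in>I. \<iota> (c i) * a v i)"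
      using val_ge_diff[OF pv 1 2] by (simp add: right_diff_distrib sum_subtractf)
    also have "(\<Sum>i\<in>I. \<iota> (c i) * a v i) = (\<Sum>w\<in>S. \<Sum>s\<in>{..<e w} \<times> B w. \<iota> (c (w, s)) * a v (w, s))"
      unfolding I_def using S(1) finB by (subst sum.Sigma) auto
    also have "\<dots> = (\<Sum>w\<in>{v}. \<Sum>s\<in>{..<e w} \<times> B w. \<iota> (c (w, s)) * a v (w, s))"
      using S(1) v by (intro sum.mono_neutral_right) (auto simp: a_def intro!: sum.neutral)
    also have "\<dots> = (\<Sum>j<e v. \<Sum>b\<in>B v. \<iota> (c (v, j, b)) * (\<pi> v ^ j * b))"
      by (simp add: sum.cartesian_product a_def case_prod_beta)
    finally show ?thesis
      using power_series_coefficients_zero[OF pv \<pi>[OF v] B[OF v], of "e v" "\<lambda>j b. c (v, j, b)" j] j b by blast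
  qed
  then have "\<forall>i\<in>I. c i = 0" by (auto simp: I_def)
  then show False using p(1) by (simp add: c_def)
qed

text \<open>
  Each pole contributes at least 1 to the sum that \<open>sum_ramification_times_degree_le\<close> bounds.
\<close>
lemma finite_poles:
  fixes z :: "nat \<Rightarrow> 'f"
  assumes x: "transcendental x" and span: "Span (rat_field x) z {..<n} = UNIV"
  shows "finite {v. is_place \<iota> v \<and> v x < 0}"
proof (rule finite_if_finite_subsets_card_bdd[where C = n, THEN conjunct1])
  fix S assume S: "S \<subseteq> {v. is_place \<iota> v \<and> v x < 0}" "finite S"
  have "card S = (\<Sum>v\<in>S. 1)" by simp
  also have "\<dots> \<le> (\<Sum>v\<in>S. nat (- v x) * card {1::'f})" using S by (intro sum_mono) auto
  also have "\<dots> \<le> n"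
    using S by (intro sum_ramification_times_degree_le[OF x span]) (auto intro: residue_independent_one)
  finally show "card S \<le> n" .
qed

lemma residue_independent_of_basis:
  assumes v: "is_place \<iota> v" and B: "residue_basis \<iota> v B" shows "residue_independent v B"
  unfolding residue_independent_def
proof (intro conjI allI impI)
  show "finite B" "\<forall>b\<in>B. val_ge v 0 b" using B by (auto simp: residue_basis_def valuation_ring_eq)
  fix c assume c: "val_ge v 1 (\<Sum>b\<in>B. \<iota> (c b) * b)"
  define c' where "c' b = (if b \<in> B then c b else 0)" for b
  have "(\<Sum>b\<in>B. \<iota> (c' b) * b) = (\<Sum>b\<in>B. \<iota> (c b) * b)" by (simp add: c'_def)
  then have 1: "(\<forall>b. b \<notin> B \<longrightarrow> c' b = 0) \<and> 0 - (\<Sum>b\<in>B. \<iota> (c' b) * b) \<in> place_ideal v"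
    using c val_ge_uminus[OF v, of 1 "\<Sum>b\<in>B. \<iota> (c b) * b"] by (simp add: c'_def place_ideal_eq)
  have 2: "(\<forall>b. b \<notin> B \<longrightarrow> (\<lambda>b. 0::'a) b = 0) \<and> 0 - (\<Sum>b\<in>B. \<iota> ((\<lambda>b. 0::'a) b) * b) \<in> place_ideal v"
    by (simp add: hom_0 place_ideal_eq)
  define Q where "Q c \<longleftrightarrow> (\<forall>b. b \<notin> B \<longrightarrow> c b = 0) \<and> 0 - (\<Sum>b\<in>B. \<iota> (c b) * b) \<in> place_ideal v" for c
  have "0 \<in> valuation_ring v" by (simp add: valuation_ring_eq)
  then have "\<exists>!c. Q c" using B unfolding residue_basis_def Q_def by blast
  moreover have "Q c'" "Q (\<lambda>b. 0)" unfolding Q_def using 1 2 by blast+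
  ultimately have "c' = (\<lambda>b. 0)" by blast
  then show "\<forall>b\<in>B. c b = 0" by (metis c'_def)
qed

lemma residue_basisI:
  assumes v: "is_place \<iota> v" and B: "residue_independent v B"
    and span: "\<And>z. val_ge v 0 z \<Longrightarrow> \<exists>c. val_ge v 1 (z - (\<Sum>b\<in>B. \<iota> (c b) * b))"
  shows "residue_basis \<iota> v B"
  unfolding residue_basis_def
proof (intro conjI ballI)
  show "finite B" "B \<subseteq> valuation_ring v" using B by (auto simp: residue_independent_def valuation_ring_eq)
  fix z assume "z \<in> valuation_ring v"
  then obtain c where c: "val_ge v 1 (z - (\<Sum>b\<in>B. \<iota> (c b) * b))" using span by (auto simp: valuation_ring_eq)
  show "\<exists>!c. (\<forall>b. b \<notin> B \<longrightarrow> c b = 0) \<and> z - (\<Sum>b\<in>B. \<iota> (c b) * b) \<in> place_ideal v"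
  proof (rule ex1I[of _ "\<lambda>b. if b \<in> B then c b else 0"])
    show "(\<forall>b. b \<notin> B \<longrightarrow> (if b \<in> B then c b else 0) = 0)
        \<and> z - (\<Sum>b\<in>B. \<iota> (if b \<in> B then c b else 0) * b) \<in> place_ideal v"
      using c by (simp add: place_ideal_eq)
    fix d assume d: "(\<forall>b. b \<notin> B \<longrightarrow> d b = 0) \<and> z - (\<Sum>b\<in>B. \<iota> (d b) * b) \<in> place_ideal v"
    have "val_ge v 1 ((z - (\<Sum>b\<in>B. \<iota> (d b) * b)) - (z - (\<Sum>b\<in>B. \<iota> (c b) * b)))"
      by (rule val_ge_diff[OF v]) (use d c in \<open>auto simp: place_ideal_eq\<close>)
    also have "(z - (\<Sum>b\<in>B. \<iota> (d b) * b)) - (z - (\<Sum>b\<in>B. \<iota> (c b) * b)) = (\<Sum>b\<in>B. \<iota> (c b - d b) * b)"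
      by (simp add: hom_diff left_diff_distrib sum_subtractf)
    finally have "\<forall>b\<in>B. c b - d b = 0"
      using residue_independentD[OF B, of "\<lambda>b. c b - d b"] by blast
    then show "d = (\<lambda>b. if b \<in> B then c b else 0)" using d by auto
  qed
qed

text \<open>
  An independent set of the largest possible size spans, for otherwise it could be enlarged.
\<close>
lemma residue_basis_exists:
  assumes v: "is_place \<iota> v" and bound: "\<And>B. residue_independent v B \<Longrightarrow> card B \<le> n"
  obtains B where "residue_basis \<iota> v B"
proof -
  have "\<exists>B. residue_independent v B \<and> (\<forall>B'. residue_independent v B' \<longrightarrow> card B' \<le> card B)"
    using residue_independent_one[OF v] bound by (intro ex_has_greatest_nat[where b = "Suc n"]) (auto simp: le_imp_less_Suc)
  then obtain B where B: "residue_independent v B" "\<And>B'. residue_independent v B' \<Longrightarrow> card B' \<le> card B" by blast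
  then have fin: "finite B" by (simp add: residue_independent_def)
  have "\<exists>c. val_ge v 1 (z - (\<Sum>b\<in>B. \<iota> (c b) * b))" if z: "val_ge v 0 z" for z
  proof (rule ccontr)
    assume no: "\<nexists>c. val_ge v 1 (z - (\<Sum>b\<in>B. \<iota> (c b) * b))"
    have zB: "z \<notin> B"
    proof
      assume zB: "z \<in> B"
      have "(\<Sum>b\<in>B. \<iota> (if b = z then 1 else 0) * b) = (\<Sum>b\<in>B. if b = z then z else 0)"
        by (intro sum.cong) (auto simp: hom_0 hom_1)
      then have "z - (\<Sum>b\<in>B. \<iota> (if b = z then 1 else 0) * b) = 0" using fin zB by simp
      then show False using no by (metis val_ge_0)
    qed
    have "residue_independent v (insert z B)"
      unfolding residue_independent_def
    proof (intro conjI allI impI)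
      show "finite (insert z B)" "\<forall>b\<in>insert z B. val_ge v 0 b"
        using B z by (auto simp: residue_independent_def)
      fix c assume c: "val_ge v 1 (\<Sum>b\<in>insert z B. \<iota> (c b) * b)"
      have c': "val_ge v 1 (\<iota> (c z) * z + (\<Sum>b\<in>B. \<iota> (c b) * b))" using c fin zB by simp
      have cz: "c z = 0"
      proof (rule ccontr)
        assume nz: "c z \<noteq> 0"
        have "val_ge v 1 (\<iota> (inverse (c z)) * (\<iota> (c z) * z + (\<Sum>b\<in>B. \<iota> (c b) * b)))"
          by (rule val_ge_scale[OF v c'])
        also have "\<iota> (inverse (c z)) * (\<iota> (c z) * z + (\<Sum>b\<in>B. \<iota> (c b) * b))
            = z - (\<Sum>b\<in>B. \<iota> (- (inverse (c z) * c b)) * b)"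
          using nz by (simp add: distrib_left sum_distrib_left hom_uminus hom_mult iota_inverse sum_negf mult.assoc)
        moreover have "\<not> val_ge v 1 (z - (\<Sum>b\<in>B. \<iota> (- (inverse (c z) * c b)) * b))"
          using no by (auto dest: spec[of _ "\<lambda>b. - (inverse (c z) * c b)"])
        ultimately show False by (simp only:)
      qed
      then have "val_ge v 1 (\<Sum>b\<in>B. \<iota> (c b) * b)" using c' by (simp add: hom_0)
      then show "\<forall>b\<in>insert z B. c b = 0" using B(1) cz by (auto simp: residue_independent_def)
    qed
    then have "card (insert z B) \<le> card B" by (rule B(2))
    then show False using zB fin by simp
  qed
  then show ?thesis using that residue_basisI[OF v B(1)] by blast
qed

lemma residue_basis_span:
  assumes "residue_basis \<iota> v B" "val_ge v 0 z"
  obtains c where "val_ge v 1 (z - (\<Sum>b\<in>B. \<iota> (c b) * b))"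
  using assms unfolding residue_basis_def valuation_ring_eq place_ideal_eq by blast

lemma place_degree_eq:
  assumes v: "is_place \<iota> v" and B: "residue_basis \<iota> v B" shows "place_degree \<iota> v = card B"
proof -
  have le: "card B \<le> card B'" if B: "residue_basis \<iota> v B" and B': "residue_basis \<iota> v B'" for B B'
  proof (rule ccontr)
    assume less: "\<not> card B \<le> card B'"
    note indep = residue_independent_of_basis[OF v B] and indep' = residue_independent_of_basis[OF v B']
    have fin: "finite B" "finite B'" using indep indep' by (auto simp: residue_independent_def)
    have "\<forall>b\<in>B. \<exists>c. val_ge v 1 (b - (\<Sum>b'\<in>B'. \<iota> (c b') * b'))"
      using residue_basis_span[OF B'] indep by (metis residue_independent_def)
    then obtain a where a: "\<And>b. b \<in> B \<Longrightarrow> val_ge v 1 (b - (\<Sum>b'\<in>B'. \<iota> (a b b') * b'))" by metis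
    obtain c where c: "\<exists>b\<in>B. c b \<noteq> 0" "\<forall>b'\<in>B'. (\<Sum>b\<in>B. c b * a b b') = 0"
      using dependent_if_more_vectors_than_coordinates[OF subring_UNIV fin(2,1), of a] less by auto
    have "val_ge v 1 (\<Sum>b\<in>B. \<iota> (c b) * (b - (\<Sum>b'\<in>B'. \<iota> (a b b') * b')))"
      by (intro val_ge_sum[OF v] val_ge_scale[OF v] a)
    also have "(\<Sum>b\<in>B. \<iota> (c b) * (b - (\<Sum>b'\<in>B'. \<iota> (a b b') * b')))
        = (\<Sum>b\<in>B. \<iota> (c b) * b) - (\<Sum>b\<in>B. \<Sum>b'\<in>B'. \<iota> (c b * a b b') * b')"
      by (simp add: right_diff_distrib sum_subtractf sum_distrib_left hom_mult mult.assoc)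
    also have "(\<Sum>b\<in>B. \<Sum>b'\<in>B'. \<iota> (c b * a b b') * b') = (\<Sum>b'\<in>B'. \<iota> (\<Sum>b\<in>B. c b * a b b') * b')"
      by (subst sum.swap) (simp add: hom_sum sum_distrib_right)
    also have "\<dots> = 0" using c(2) by (simp add: hom_0)
    finally have "val_ge v 1 (\<Sum>b\<in>B. \<iota> (c b) * b)" by simp
    then show False using indep c(1) by (auto simp: residue_independent_def)
  qed
  show ?thesis unfolding place_degree_def
    by (rule the_equality) (use B le in \<open>auto intro: antisym\<close>)
qed

text \<open>
  The expansion of \<open>h\<close> in powers of a uniformizer, up to the constant term, with coefficients in the
  span of the residue basis.
\<close>
lemma laurent_expansion:
  assumes v: "is_place \<iota> v" and t: "t \<noteq> 0" "v t = 1" and B: "residue_basis \<iota> v B"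
    and "val_ge v (- int M) h"
  shows "\<exists>a. val_ge v 1 (h - (\<Sum>k\<le>M. \<Sum>b\<in>B. \<iota> (a k b) * (inverse t ^ k * b)))"
  using assms(5)
proof (induction M arbitrary: h)
  case 0
  then obtain c where "val_ge v 1 (h - (\<Sum>b\<in>B. \<iota> (c b) * b))" using residue_basis_span[OF B] by auto
  then show ?case by (intro exI[of _ "\<lambda>_. c"]) simp
next
  case (Suc M)
  have tk: "v (t ^ k) = int k" "v (inverse t ^ k) = - int k" for k
    using t by (auto simp: place_power[OF v] place_inverse[OF v])
  have "val_ge v 0 (h * t ^ Suc M)"
    by (rule val_ge_mult[OF v Suc.prems, of "int (Suc M)"]) (auto simp: val_ge_def tk simp del: power_Suc)
  then obtain c where c: "val_ge v 1 (h * t ^ Suc M - (\<Sum>b\<in>B. \<iota> (c b) * b))"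
    using residue_basis_span[OF B] by blast
  have "val_ge v (- int M) (inverse t ^ Suc M * (h * t ^ Suc M - (\<Sum>b\<in>B. \<iota> (c b) * b)))"
    by (rule val_ge_mult[OF v _ c, where N = "- int (Suc M)"]) (auto simp: val_ge_def tk simp del: power_Suc)
  also have "inverse t ^ Suc M * (h * t ^ Suc M - (\<Sum>b\<in>B. \<iota> (c b) * b))
      = h - (\<Sum>b\<in>B. \<iota> (c b) * (inverse t ^ Suc M * b))" (is "_ = ?h")
  proof -
    have "inverse t ^ Suc M * (h * t ^ Suc M) = h"
      using t by (simp add: power_inverse field_simps del: power_Suc)
    then show ?thesis by (simp add: right_diff_distrib sum_distrib_left mult_ac del: power_Suc)
  qed
  finally obtain a where a: "val_ge v 1 (?h - (\<Sum>k\<le>M. \<Sum>b\<in>B. \<iota> (a k b) * (inverse t ^ k * b)))"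
    using Suc.IH by blast
  define a' where "a' k = (if k = Suc M then c else a k)" for k
  have "(\<Sum>k\<le>Suc M. \<Sum>b\<in>B. \<iota> (a' k b) * (inverse t ^ k * b))
      = (\<Sum>k\<le>M. \<Sum>b\<in>B. \<iota> (a k b) * (inverse t ^ k * b)) + (\<Sum>b\<in>B. \<iota> (c b) * (inverse t ^ Suc M * b))"
    by (simp add: a'_def del: power_Suc)
  then have "h - (\<Sum>k\<le>Suc M. \<Sum>b\<in>B. \<iota> (a' k b) * (inverse t ^ k * b))
      = ?h - (\<Sum>k\<le>M. \<Sum>b\<in>B. \<iota> (a k b) * (inverse t ^ k * b))" by simp
  then show ?case using a by metis
qed

end

context one_dim_extension
begin

text \<open>
  Such a function has no poles, so it is algebraic over $K$; but a nonzero algebraic element has no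
  zeros either, and \<open>x\<close> has at least one pole.
\<close>
lemma zero_if_vanishing_at_poles:
  assumes x: "transcendental x"
    and pole: "\<And>v. is_place \<iota> v \<Longrightarrow> v x < 0 \<Longrightarrow> val_ge v 1 h"
    and regular: "\<And>v. is_place \<iota> v \<Longrightarrow> v x \<ge> 0 \<Longrightarrow> val_ge v 0 h"
  shows "h = 0"
proof (rule ccontr)
  assume h: "h \<noteq> 0"
  show False
  proof (cases "transcendental h")
    case True
    then obtain v where v: "is_place \<iota> v" "v h < 0" by (rule transcendental_has_pole)
    then show False using pole[of v] regular[of v] h by (cases "v x < 0") (auto simp: val_ge_def)
  next
    case False
    obtain v where v: "is_place \<iota> v" "v x < 0" by (rule transcendental_has_pole[OF x])
    then have vh: "v h \<ge> 1" using pole[of v] h by (simp add: val_ge_def)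
    have "inverse h \<in> {z. val_ge v 0 z}"
      using vh h False v by (intro algebraic_inverse_in_subring[OF val_ring_subring[OF v(1)]])
        (auto simp: val_ge_iota, auto simp: val_ge_def)
    then show False using vh h v by (simp add: val_ge_def place_inverse)
  qed
qed

text \<open>
  Here \<open>z\<close> is a basis of $L$ over $K(x)$ without poles outside the poles of \<open>x\<close>, which is what makes the
  functions $x^k z_i$ determined by their expansions at the poles of \<open>x\<close>.
\<close>
theorem degree_of_pole_divisor:
  fixes z :: "nat \<Rightarrow> 'f"
  assumes x: "transcendental x" and span: "Span (rat_field x) z {..<n} = UNIV"
    and indep: "\<And>p. (\<Sum>i<n. ev (p i) x * z i) = 0 \<Longrightarrow> \<forall>i<n. p i = 0"
    and integral: "\<And>v i. is_place \<iota> v \<Longrightarrow> v x \<ge> 0 \<Longrightarrow> i < n \<Longrightarrow> val_ge v 0 (z i)"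
  shows "divisor_degree \<iota> (pole_divisor \<iota> x) = int n"
proof -
  define S where "S = {v. is_place \<iota> v \<and> v x < 0}"
  have finS: "finite S" unfolding S_def by (rule finite_poles[OF x span])
  have S: "is_place \<iota> v" "v x < 0" if "v \<in> S" for v using that by (auto simp: S_def)
  have x0: "x \<noteq> 0" by (rule transcendental_neq_0[OF x])
  define e where "e v = nat (- v x)" for v
  have e: "v x = - int (e v)" "e v > 0" if "v \<in> S" for v using S[OF that] by (auto simp: e_def)
  have "\<exists>B. residue_basis \<iota> v B" if v: "v \<in> S" for v
  proof -
    have "card B \<le> n" if B: "residue_independent v B" for B
    proof -
      have "card B \<le> (\<Sum>v\<in>{v}. nat (- v x) * card B)" using e[OF v] by simp
      also have "\<dots> \<le> n"
        by (rule sum_ramification_times_degree_le[OF x span]) (use S[OF v] B in auto)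
      finally show ?thesis .
    qed
    then show ?thesis using residue_basis_exists[OF S(1)[OF v]] by blast
  qed
  then obtain B where B: "\<And>v. v \<in> S \<Longrightarrow> residue_basis \<iota> v (B v)" by metis
  note indepB = residue_independent_of_basis[OF S(1) B]
  have finB: "finite (B v)" if "v \<in> S" for v using indepB[OF that that] by (simp add: residue_independent_def)
  define E where "E = (\<Sum>v\<in>S. e v * card (B v))"
  have upper: "E \<le> n" unfolding E_def e_def
    by (rule sum_ramification_times_degree_le[OF x span finS]) (use S indepB in auto)
  have "\<forall>v\<in>S. \<exists>p. p \<noteq> 0 \<and> v p = 1" using obtain_place_value S(1) by metis
  then obtain \<pi> where \<pi>: "\<And>v. v \<in> S \<Longrightarrow> \<pi> v \<noteq> 0" "\<And>v. v \<in> S \<Longrightarrow> v (\<pi> v) = 1" by metis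
  define C where "C = nat (\<Sum>(v, i)\<in>S\<times>{..<n}. \<bar>v (z i)\<bar>)"
  have C: "v (z i) \<ge> - int C" if "v \<in> S" "i < n" for v i
  proof -
    have "\<bar>v (z i)\<bar> \<le> (\<Sum>(v, i)\<in>S\<times>{..<n}. \<bar>v (z i)\<bar>)"
      using that finS member_le_sum[of "(v, i)" "S \<times> {..<n}" "\<lambda>(v, i). \<bar>v (z i)\<bar>"] by auto
    then show ?thesis unfolding C_def by linarith
  qed
  \<comment> \<open>if there were more functions $x^k z_i$ with $k \le r$ than coefficients in their expansions at
    the poles of \<open>x\<close>, a nontrivial linear combination over $K$ would vanish at all these poles\<close>
  have growth: "(r + 1) * n \<le> (\<Sum>v\<in>S. (r * e v + C + 1) * card (B v))" for r
  proof (rule ccontr)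
    assume gt: "\<not> ?thesis"
    define M where "M v = r * e v + C" for v
    define I where "I = {..r} \<times> {..<n}"
    define J where "J = Sigma S (\<lambda>v. {..M v} \<times> B v)"
    define g where "g i = (case i of (k, i) \<Rightarrow> x ^ k * z i)" for i
    have fin: "finite I" "finite J" unfolding I_def J_def using finS finB by auto
    have "card J = (\<Sum>v\<in>S. (M v + 1) * card (B v))"
      unfolding J_def using finS finB by (subst card_SigmaI) (auto simp: card_cartesian_product)
    then have card: "card J < card I" using gt by (simp add: I_def M_def card_cartesian_product)
    have gM: "val_ge v (- int (M v)) (g i)" if v: "v \<in> S" and i: "i \<in> I" for v i
    proof -
      obtain k j where kj: "i = (k, j)" "k \<le> r" "j < n" using i by (auto simp: I_def)
      have "val_ge v (- int (k * e v)) (x ^ k)"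
        using x0 e[OF v] by (simp add: val_ge_def place_power[OF S(1)[OF v]])
      moreover have "val_ge v (- int C) (z j)" using C[OF v kj(3)] by (simp add: val_ge_def)
      moreover have "- int (M v) \<le> - int (k * e v) + - int C"
      proof -
        have "int (k * e v) \<le> int (r * e v)" using mult_le_mono1[OF kj(2)] by (simp only: of_nat_le_iff)
        then show ?thesis unfolding M_def of_nat_add by linarith
      qed
      ultimately show ?thesis unfolding g_def kj prod.case by (rule val_ge_mult[OF S(1)[OF v]])
    qed
    define expands where "expands v i a \<longleftrightarrow>
        val_ge v 1 (g i - (\<Sum>k\<le>M v. \<Sum>b\<in>B v. \<iota> (a k b) * (inverse (\<pi> v) ^ k * b)))" for v i a
    have ex: "\<exists>a. expands v i a" if v: "v \<in> S" and i: "i \<in> I" for v i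
      unfolding expands_def
      by (rule laurent_expansion[OF S(1)[OF v] \<pi>(1)[OF v] \<pi>(2)[OF v] B[OF v] gM[OF v i]])
    define a where "a v i = (SOME a. expands v i a)" for v i
    have a: "val_ge v 1 (g i - (\<Sum>k\<le>M v. \<Sum>b\<in>B v. \<iota> (a v i k b) * (inverse (\<pi> v) ^ k * b)))"
      if "v \<in> S" "i \<in> I" for v i
      using someI_ex[OF ex[OF that]] unfolding a_def expands_def .
    have "\<exists>c. (\<forall>i\<in>I. c i \<in> UNIV) \<and> (\<exists>i\<in>I. c i \<noteq> 0)
        \<and> (\<forall>j\<in>J. (\<Sum>i\<in>I. c i * (case j of (v, k, b) \<Rightarrow> a v i k b)) = 0)"
      by (rule dependent_if_more_vectors_than_coordinates[OF subring_UNIV fin(2,1) card]) auto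
    then obtain c where c: "\<exists>i\<in>I. c i \<noteq> 0"
        "\<forall>j\<in>J. (\<Sum>i\<in>I. c i * (case j of (v, k, b) \<Rightarrow> a v i k b)) = 0" by blast
    define h where "h = (\<Sum>i\<in>I. \<iota> (c i) * g i)"
    have "h = 0"
    proof (rule zero_if_vanishing_at_poles[OF x])
      fix v assume "is_place \<iota> v" "v x < 0"
      then have v: "v \<in> S" and pv: "is_place \<iota> v" by (auto simp: S_def)
      have "val_ge v 1 (\<Sum>i\<in>I. \<iota> (c i) * (g i - (\<Sum>k\<le>M v. \<Sum>b\<in>B v. \<iota> (a v i k b) * (inverse (\<pi> v) ^ k * b))))"
        by (intro val_ge_sum[OF pv] val_ge_scale[OF pv] a v)
      also have "(\<Sum>i\<in>I. \<iota> (c i) * (g i - (\<Sum>k\<le>M v. \<Sum>b\<in>B v. \<iota> (a v i k b) * (inverse (\<pi> v) ^ k * b))))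
          = h - (\<Sum>i\<in>I. \<Sum>k\<le>M v. \<Sum>b\<in>B v. \<iota> (c i * a v i k b) * (inverse (\<pi> v) ^ k * b))"
        by (simp add: h_def right_diff_distrib sum_subtractf sum_distrib_left hom_mult mult.assoc)
      also have "(\<Sum>i\<in>I. \<Sum>k\<le>M v. \<Sum>b\<in>B v. \<iota> (c i * a v i k b) * (inverse (\<pi> v) ^ k * b))
          = (\<Sum>k\<le>M v. \<Sum>b\<in>B v. \<Sum>i\<in>I. \<iota> (c i * a v i k b) * (inverse (\<pi> v) ^ k * b))"
        by (subst sum.swap, rule sum.cong[OF refl], rule sum.swap)
      also have "\<dots> = (\<Sum>k\<le>M v. \<Sum>b\<in>B v. \<iota> (\<Sum>i\<in>I. c i * a v i k b) * (inverse (\<pi> v) ^ k * b))"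
        by (simp add: hom_sum sum_distrib_right)
      also have "\<dots> = 0"
      proof (intro sum.neutral ballI)
        fix k b assume "k \<in> {..M v}" "b \<in> B v"
        then have "(\<Sum>i\<in>I. c i * a v i k b) = 0"
          using bspec[OF c(2), of "(v, k, b)"] v by (simp add: J_def)
        then show "\<iota> (\<Sum>i\<in>I. c i * a v i k b) * (inverse (\<pi> v) ^ k * b) = 0" by (simp add: hom_0)
      qed
      finally show "val_ge v 1 h" by simp
    next
      fix v assume pv: "is_place \<iota> v" and "v x \<ge> 0"
      then have "val_ge v 0 x" by (simp add: val_ge_def)
      then have "val_ge v 0 (g i)" if "i \<in> I" for i
        using that integral[OF pv \<open>v x \<ge> 0\<close>] val_ge_power[OF pv]
        by (auto simp: g_def I_def intro!: val_ge_mult[OF pv, where N = 0 and M = 0])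
      then show "val_ge v 0 h" unfolding h_def by (intro val_ge_sum[OF pv] val_ge_scale[OF pv])
    qed
    define P where "P i = (\<Sum>k\<le>r. monom (c (k, i)) k)" for i
    have evP: "ev (P i) x = (\<Sum>k\<le>r. \<iota> (c (k, i)) * x ^ k)" for i
      unfolding P_def by (simp add: ring_morphism.hom_sum[OF ev_morphism] ev_monom)
    have "h = (\<Sum>k\<le>r. \<Sum>i<n. \<iota> (c (k, i)) * (x ^ k * z i))"
      unfolding h_def I_def by (simp add: sum.cartesian_product g_def case_prod_beta)
    also have "\<dots> = (\<Sum>i<n. ev (P i) x * z i)"
      by (subst sum.swap) (simp add: evP sum_distrib_right mult.assoc)
    finally have "\<forall>i<n. P i = 0" using indep \<open>h = 0\<close> by simp
    have "c (k, i) = 0" if "k \<le> r" "i < n" for k i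
    proof -
      have "c (k, i) = (\<Sum>l\<le>r. if l = k then c (l, i) else 0)" using that by simp
      also have "\<dots> = coeff (P i) k" unfolding P_def coeff_sum by (intro sum.cong) auto
      finally show ?thesis using \<open>\<forall>i<n. P i = 0\<close> that by simp
    qed
    then show False using c(1) by (auto simp: I_def)
  qed
  \<comment> \<open>compare the two sides of \<open>growth\<close> for large \<open>r\<close>: their slopes are \<open>n\<close> and \<open>E\<close>\<close>
  have lower: "n \<le> E"
  proof (rule ccontr)
    assume "\<not> n \<le> E"
    then have less: "E + 1 \<le> n" by simp
    define D where "D = (C + 1) * (\<Sum>v\<in>S. card (B v))"
    have "(\<Sum>v\<in>S. (D * e v + C + 1) * card (B v)) = D * E + (C + 1) * (\<Sum>v\<in>S. card (B v))"
      unfolding E_def sum_distrib_left sum.distrib[symmetric] by (intro sum.cong) (auto simp: algebra_simps)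
    then have "(\<Sum>v\<in>S. (D * e v + C + 1) * card (B v)) = D * E + D" by (simp only: D_def)
    then have "(D + 1) * n \<le> D * (E + 1)" using growth[of D] by simp
    also have "\<dots> \<le> D * n" using less by (rule mult_le_mono2)
    finally show False using less by simp
  qed
  have deg: "place_degree \<iota> v = card (B v)" if "v \<in> S" for v
    by (rule place_degree_eq[OF S(1)[OF that] B[OF that]])
  have "{v. is_place \<iota> v \<and> pole_divisor \<iota> x v \<noteq> 0} = S"
    by (auto simp: S_def pole_divisor_def)
  then have "divisor_degree \<iota> (pole_divisor \<iota> x) = (\<Sum>v\<in>S. pole_divisor \<iota> x v * int (place_degree \<iota> v))"
    unfolding divisor_degree_def by simp
  also have "\<dots> = (\<Sum>v\<in>S. int (e v * card (B v)))"
  proof (rule sum.cong)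
    fix v assume v: "v \<in> S"
    have "pole_divisor \<iota> x v = int (e v)" using S(1)[OF v] e(1)[OF v] by (simp add: pole_divisor_def)
    then show "pole_divisor \<iota> x v * int (place_degree \<iota> v) = int (e v * card (B v))"
      using deg[OF v] by simp
  qed simp
  also have "\<dots> = int E" by (simp add: E_def)
  finally show ?thesis using upper lower by simp
qed

end

section \<open>Function fields of irreducible plane curves\<close>

lemma is_unit_const2:
  fixes c :: "'a::field" assumes "c \<noteq> 0" shows "is_unit (const2 c)"
proof (rule dvdI)
  show "1 = const2 c * const2 (inverse c)" using assms by (simp add: const2_def one_pCons)
qed

context field_extension
begin

lemma algebraic_over_mono: "algebraic_over E z \<Longrightarrow> E \<subseteq> F \<Longrightarrow> algebraic_over F z"
  unfolding algebraic_over_def by blast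

lemma algebraic_over_if_not_transcendental:
  assumes "\<not> transcendental z" "range \<iota> \<subseteq> E" shows "algebraic_over E z"
proof -
  obtain p where p: "ev p z = 0" "p \<noteq> 0" using assms(1) by (auto simp: transcendental_def)
  then have "map_poly \<iota> p \<noteq> 0" by (simp add: map_poly_eq_0_iff hom_0)
  then show ?thesis unfolding algebraic_over_def
    using p assms(2) by (intro exI[of _ "map_poly \<iota> p"]) (auto simp: coeff_map_poly hom_0 ev_def)
qed

lemma algebraic_over_rat_field:
  assumes t: "transcendental t" and g: "g \<noteq> 0" "eval2 \<iota> g t s = 0"
  shows "algebraic_over (rat_field t) s"
proof -
  define q where "q = map_poly (\<lambda>p. ev p t) g"
  have c: "coeff q k = ev (coeff g k) t" for k by (simp add: q_def coeff_map_poly)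
  have "coeff q (degree g) \<noteq> 0" using t g(1) unfolding c transcendental_def by auto
  then have "q \<noteq> 0" by auto
  moreover have "poly q s = 0" using g by (simp add: q_def eval2_eq)
  ultimately show ?thesis unfolding algebraic_over_def
    by (intro exI[of _ q]) (simp add: c ev_in_rat_field)
qed

text \<open>
  The powers of $t$ are linearly dependent over $K(s)$, and the relation between $s$ and $t$ that
  expresses this involves $s$, because $t$ is transcendental.
\<close>
lemma exchange:
  fixes z :: "nat \<Rightarrow> 'f"
  assumes s: "transcendental s" and t: "transcendental t" and span: "Span (rat_field s) z {..<n} = UNIV"
  shows "algebraic_over (rat_field t) s"
proof -
  have "\<exists>c. (\<forall>i\<in>{..n}. c i \<in> rat_field s) \<and> (\<exists>i\<in>{..n}. c i \<noteq> 0) \<and> (\<Sum>i\<in>{..n}. c i * t ^ i) = 0"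
    by (rule dependent_if_more_than_spanning[OF subfield_subring[OF subfield_rat_field], where w = z and J = "{..<n}"])
       (auto simp: span)
  then obtain c where c: "\<forall>i\<in>{..n}. c i \<in> rat_field s" "\<exists>i\<in>{..n}. c i \<noteq> 0" "(\<Sum>i\<in>{..n}. c i * t ^ i) = 0"
    by blast
  obtain p where p: "\<exists>i\<in>{..n}. coeff (p i) 0 \<noteq> 0" "(\<Sum>i\<in>{..n}. ev (p i) s * t ^ i) = 0"
    by (rule clear_denominators[OF s, of "{..n}" c "\<lambda>i. t ^ i"]) (use c in auto)
  define g where "g = (\<Sum>i\<le>n. monom (p i) i)"
  have "coeff g i = p i" if "i \<le> n" for i
    using that by (simp add: g_def coeff_sum)
  then have "g \<noteq> 0" using p(1) by (metis atMost_iff coeff_0)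
  moreover have "eval2 \<iota> g s t = 0"
    using p(2) by (simp add: g_def ring_morphism.hom_sum[OF eval2_morphism] eval2_monom)
  ultimately show ?thesis
    using algebraic_over_rat_field[OF t, of "swap_vars g" s] by (simp add: eval2_swap_vars)
qed

text \<open>
  Two simple extensions, and the product of their degrees as the bound.
\<close>
lemma finite_rank_if_generated_by_algebraic:
  assumes E: "is_subfield E" "range \<iota> \<subseteq> E" and gen: "adjoin2 \<iota> x y = UNIV"
    and alg: "algebraic_over E x" "algebraic_over E y"
  shows "\<exists>N::nat. \<forall>z::nat \<Rightarrow> 'f.
       \<exists>c. (\<forall>i\<le>N. c i \<in> E) \<and> (\<exists>i\<le>N. c i \<noteq> 0) \<and> (\<Sum>i\<le>N. c i * z i) = 0"
proof -
  obtain p where p: "p \<noteq> 0" "\<And>i. coeff p i \<in> E" "poly p x = 0" using alg(1) by (auto simp: algebraic_over_def)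
  define F where "F = Span E (\<lambda>k. x ^ k) {..<degree p}"
  note F = simple_extension[OF E(1) p, folded F_def]
  have "algebraic_over F y" using alg(2) F(2) by (rule algebraic_over_mono)
  then obtain q where q: "q \<noteq> 0" "\<And>i. coeff q i \<in> F" "poly q y = 0" by (auto simp: algebraic_over_def)
  define L where "L = Span F (\<lambda>k. y ^ k) {..<degree q}"
  note L = simple_extension[OF F(1) q, folded L_def]
  have "adjoin2 \<iota> x y \<subseteq> L" using E F L by (intro adjoin2_least) auto
  then have "L = UNIV" using gen by auto
  define J where "J = {..<degree p} \<times> {..<degree q}"
  define w where "w = (\<lambda>(i, j). x ^ i * y ^ j)"
  have span: "Span E w J = UNIV"
    using Span_tower[OF subfield_subring[OF E(1)], of "{..<degree p}" "{..<degree q}" "\<lambda>k. x ^ k" "\<lambda>k. y ^ k"]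
      \<open>L = UNIV\<close> by (auto simp: F_def L_def J_def w_def)
  show ?thesis
  proof (intro exI[of _ "card J"] allI)
    fix z :: "nat \<Rightarrow> 'f"
    have "\<exists>c. (\<forall>i\<in>{..card J}. c i \<in> E) \<and> (\<exists>i\<in>{..card J}. c i \<noteq> 0) \<and> (\<Sum>i\<in>{..card J}. c i * z i) = 0"
      by (rule dependent_if_more_than_spanning[OF subfield_subring[OF E(1)], of J _ z w])
         (simp_all add: span, simp add: J_def)
    then show "\<exists>c. (\<forall>i\<le>card J. c i \<in> E) \<and> (\<exists>i\<le>card J. c i \<noteq> 0) \<and> (\<Sum>i\<le>card J. c i * z i) = 0"
      by auto
  qed
qed

lemma not_transcendental_if_finite_rank:
  assumes "\<And>z::nat \<Rightarrow> 'f. \<exists>c. (\<forall>i\<le>N. c i \<in> range \<iota>) \<and> (\<exists>i\<le>N. c i \<noteq> 0) \<and> (\<Sum>i\<le>N. c i * z i) = 0"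
  shows "\<not> transcendental t"
proof -
  obtain c where c: "\<forall>i\<le>N. c i \<in> range \<iota>" "\<exists>i\<le>N. c i \<noteq> 0" "(\<Sum>i\<le>N. c i * t ^ i) = 0"
    using assms[of "\<lambda>i. t ^ i"] by auto
  then have "\<forall>i\<le>N. \<exists>a. c i = \<iota> a" by auto
  then obtain a where a: "\<And>i. i \<le> N \<Longrightarrow> c i = \<iota> (a i)" by metis
  define p where "p = (\<Sum>i\<le>N. monom (a i) i)"
  have "ev p t = 0"
    using c(3) a by (simp add: p_def ring_morphism.hom_sum[OF ev_morphism] ev_monom)
  moreover have "coeff p i = a i" if "i \<le> N" for i using that by (simp add: p_def coeff_sum)
  then have "p \<noteq> 0" using c(2) a by (metis coeff_0 hom_0)
  ultimately show ?thesis by (auto simp: transcendental_def)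
qed

lemma no_pole_if_not_transcendental:
  assumes v: "is_place \<iota> v" and z: "\<not> transcendental z" shows "\<not> v z < 0"
proof
  assume neg: "v z < 0"
  then have "z \<noteq> 0" using place_0[OF v] by auto
  have "\<not> transcendental (inverse z)" using z transcendental_inverse[of "inverse z"] by auto
  moreover have "val_ge v 0 (inverse z)" using neg by (simp add: val_ge_def place_inverse[OF v])
  ultimately have "inverse (inverse z) \<in> {z. val_ge v 0 z}"
    using \<open>z \<noteq> 0\<close> v
    by (subst algebraic_inverse_in_subring[OF val_ring_subring[OF v], of "inverse z"]) (auto simp: val_ge_iota)
  then show False using neg \<open>z \<noteq> 0\<close> by (simp add: val_ge_def)
qed

end

text \<open>
  Here \<open>x\<close> and \<open>y\<close> are the images of the coordinates in the fraction field of $K[X,Y]/(f)$.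
\<close>
locale function_field = field_extension \<iota> for \<iota> :: "'a::field \<Rightarrow> 'f::field" +
  fixes f :: "'a poly poly" and x y :: 'f
  assumes irreducible: "irreducible f"
    and relations: "eval2 \<iota> g x y = 0 \<longleftrightarrow> f dvd g"
    and generated: "adjoin2 \<iota> x y = UNIV"
begin

lemma f_nonzero: "f \<noteq> 0"
  using irreducible by (simp add: irreducible_def)

lemma swapped: "function_field \<iota> (swap_vars f) y x"
proof unfold_locales
  show "irreducible (swap_vars f)" by (rule irreducible_swap_vars[OF irreducible])
  show "eval2 \<iota> g y x = 0 \<longleftrightarrow> swap_vars f dvd g" for g
    using relations[of "swap_vars g"] swap_vars_dvd_iff[of f "swap_vars g"] by (simp add: eval2_swap_vars)
  show "adjoin2 \<iota> y x = UNIV" using generated by (simp add: adjoin2_commute)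
qed

lemma curve_equation: "eval2 \<iota> f x y = 0"
  by (simp add: relations)

lemma x_transcendental_iff: "transcendental x \<longleftrightarrow> degree f > 0"
proof
  assume x: "transcendental x"
  show "degree f > 0"
  proof (rule ccontr)
    assume "\<not> degree f > 0"
    then obtain p where "f = [:p:]" by (auto elim: degree_eq_zeroE)
    then show False using curve_equation x f_nonzero by (auto simp: eval2_const transcendental_def)
  qed
next
  assume deg: "degree f > 0"
  show "transcendental x" unfolding transcendental_def
  proof (intro allI impI)
    fix p assume "ev p x = 0"
    then have "f dvd [:p:]" using relations[of "[:p:]"] by (simp add: eval2_const)
    then have "[:p:] \<noteq> 0 \<Longrightarrow> degree f \<le> degree [:p:]" by (rule dvd_imp_degree_le)
    then show "p = 0" using deg by auto
  qed
qed

lemma powers_span: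
  assumes deg: "degree f > 0" shows "Span (rat_field x) (\<lambda>k. y ^ k) {..<degree f} = UNIV"
proof -
  have x: "transcendental x" using deg by (simp add: x_transcendental_iff)
  define q where "q = map_poly (\<lambda>p. ev p x) f"
  have c: "coeff q k = ev (coeff f k) x" for k by (simp add: q_def coeff_map_poly)
  have "coeff q (degree f) \<noteq> 0" using x f_nonzero unfolding c transcendental_def by auto
  then have "q \<noteq> 0" "degree f \<le> degree q" by (auto intro: le_degree)
  moreover have "degree q \<le> degree f" by (rule degree_le) (simp add: c coeff_eq_0)
  ultimately have q: "q \<noteq> 0" "degree q = degree f" by auto
  have "poly q y = 0" using curve_equation by (simp add: q_def eval2_eq)
  note V = simple_extension[OF subfield_rat_field q(1) _ this, unfolded c q(2), OF ev_in_rat_field]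
  have "adjoin2 \<iota> x y \<subseteq> Span (rat_field x) (\<lambda>k. y ^ k) {..<degree f}"
    using V range_subset_rat_field gen_in_rat_field by (intro adjoin2_least) blast+
  then show ?thesis using generated by auto
qed

lemma powers_independent:
  assumes "(\<Sum>i<degree f. ev (p i) x * y ^ i) = 0" "i < degree f" shows "p i = 0"
proof -
  define g where "g = (\<Sum>i<degree f. monom (p i) i)"
  have "eval2 \<iota> g x y = 0"
    using assms by (simp add: g_def ring_morphism.hom_sum[OF eval2_morphism] eval2_monom)
  then have "f dvd g" by (simp add: relations)
  moreover have "degree g < degree f" unfolding g_def
    by (rule degree_sum_less) (use assms degree_monom_le in \<open>auto intro: le_less_trans\<close>)
  ultimately have "g = 0" by (meson dvd_imp_degree_le not_less)
  moreover have "coeff g i = p i" using assms by (simp add: g_def coeff_sum)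
  ultimately show ?thesis by simp
qed

lemma x_algebraic_over_rat_field:
  assumes t: "transcendental t" shows "algebraic_over (rat_field t) x"
proof (cases "transcendental x")
  case True
  then show ?thesis using exchange[OF True t powers_span] by (simp add: x_transcendental_iff)
next
  case False
  then show ?thesis by (rule algebraic_over_if_not_transcendental[OF _ range_subset_rat_field])
qed

text \<open>
  Both \<open>x\<close> and \<open>y\<close> are algebraic over $K(t)$, by exchange or because they are algebraic over $K$,
  and they generate $L$.
\<close>
lemma one_dim_extension: "one_dim_extension \<iota>"
proof unfold_locales
  fix t assume t: "transcendental t"
  show "\<exists>N::nat. \<forall>z::nat \<Rightarrow> 'f.
       \<exists>c. (\<forall>i\<le>N. c i \<in> rat_field t) \<and> (\<exists>i\<le>N. c i \<noteq> 0) \<and> (\<Sum>i\<le>N. c i * z i) = 0"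
    by (rule finite_rank_if_generated_by_algebraic[OF subfield_rat_field range_subset_rat_field generated])
       (intro x_algebraic_over_rat_field t function_field.x_algebraic_over_rat_field[OF swapped])+
qed

sublocale one_dim_extension \<iota>
  by (rule one_dim_extension)

text \<open>
  This replaces the resultant of \<open>f\<close> and \<open>g\<close> with respect to $Y$: the element $g(x,y)$ is nonzero, its
  inverse is a combination of powers of \<open>y\<close> over $K(x)$, and $r$ is a common denominator.
\<close>
lemma elimination:
  assumes g: "\<not> f dvd g" shows "\<exists>r b. r \<noteq> 0 \<and> f dvd [:r:] - g * b"
proof (cases "degree f = 0")
  case True
  then obtain p where "f = [:p:]" by (rule degree_eq_zeroE)
  then show ?thesis using f_nonzero by (intro exI[of _ p] exI[of _ 0]) auto
next
  case False
  then have deg: "degree f > 0" by simp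
  then have x: "transcendental x" by (simp add: x_transcendental_iff)
  interpret e2: ring_morphism "\<lambda>g. eval2 \<iota> g x y" by (rule eval2_morphism)
  define h where "h = eval2 \<iota> g x y"
  have h: "h \<noteq> 0" using g by (simp add: h_def relations)
  define n where "n = degree f"
  have "inverse h \<in> Span (rat_field x) (\<lambda>k. y ^ k) {..<n}"
    using powers_span[OF deg] by (simp add: n_def)
  then obtain c where c: "inverse h = (\<Sum>k<n. c k * y ^ k)" "\<forall>k<n. c k \<in> rat_field x"
    by (auto simp: Span_def)
  define c' where "c' k = (if k = n then - 1 else c k)" for k
  define z where "z k = (if k = n then 1 else y ^ k * h)" for k
  have split: "(\<Sum>k\<in>{..n}. e k * z k) = e n + (\<Sum>k<n. e k * y ^ k) * h" for e :: "nat \<Rightarrow> 'f"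
  proof -
    have "{..n} = insert n {..<n}" by auto
    then show ?thesis by (simp add: z_def sum_distrib_right mult.assoc)
  qed
  have "(\<Sum>k<n. c' k * y ^ k) = inverse h" by (simp add: c'_def c(1))
  then have "(\<Sum>k\<in>{..n}. c' k * z k) = 0" using h by (simp add: split c'_def)
  moreover have "c' k \<in> rat_field x" if "k \<in> {..n}" for k
  proof -
    have "- 1 \<in> rat_field x"
      by (intro subring_uminus subring_1 subfield_subring[OF subfield_rat_field])
    then show ?thesis using that c(2) by (simp add: c'_def)
  qed
  moreover have "\<exists>k\<in>{..n}. c' k \<noteq> 0" by (auto simp: c'_def)
  ultimately obtain p where p: "\<exists>k\<in>{..n}. coeff (p k) 0 \<noteq> 0" "(\<Sum>k\<in>{..n}. ev (p k) x * z k) = 0"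
    using clear_denominators[OF x, of "{..n}" c' z] by auto
  define b where "b = (\<Sum>k<n. monom (p k) k)"
  have b: "eval2 \<iota> b x y = (\<Sum>k<n. ev (p k) x * y ^ k)"
    by (simp add: b_def e2.hom_sum eval2_monom)
  have eq: "ev (p n) x + eval2 \<iota> b x y * h = 0" using p(2) by (simp add: split b)
  have "p n \<noteq> 0"
  proof
    assume pn: "p n = 0"
    then have "(\<Sum>k<n. ev (p k) x * y ^ k) = 0" using eq h b by simp
    then have "p k = 0" if "k < n" for k using powers_independent that by (simp add: n_def)
    then have "p k = 0" if "k \<le> n" for k using pn that by (cases "k = n") auto
    then show False using p(1) by auto
  qed
  moreover have "eval2 \<iota> ([:- p n:] - g * b) x y = 0"
    using eq
    by (simp add: e2.hom_diff e2.hom_mult eval2_const h_def[symmetric] ring_morphism.hom_uminus[OF ev_morphism])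
       (simp add: add_eq_0_iff2 mult.commute)
  ultimately show ?thesis unfolding relations by (intro exI[of _ "- p n"] exI[of _ b]) auto
qed

text \<open>
  Otherwise the degree of \<open>f\<close> would be 0 in both variables.
\<close>
lemma not_both_algebraic: "transcendental x \<or> transcendental y"
proof (rule ccontr)
  assume "\<not> ?thesis"
  then have "degree f = 0" "degree (swap_vars f) = 0"
    using x_transcendental_iff function_field.x_transcendental_iff[OF swapped] by auto
  then obtain p where p: "f = [:p:]" by (auto elim: degree_eq_zeroE)
  have "coeff p i = 0" if "i > 0" for i
  proof -
    have "coeff (coeff (swap_vars f) i) 0 = 0" using \<open>degree (swap_vars f) = 0\<close> that by (simp add: coeff_eq_0 del: coeff_swap_vars)
    then show ?thesis by (simp add: p)
  qed
  then have "degree p = 0" by (metis coeff_0_degree_minus_1 le_degree leading_coeff_0_iff neq0_conv degree_0)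
  then obtain c where "p = [:c:]" by (rule degree_eq_zeroE)
  then have "f = const2 c" "c \<noteq> 0" using p f_nonzero by (auto simp: const2_def)
  then show False using is_unit_const2 irreducible by (auto simp: irreducible_def)
qed

lemma relation_makes_x_algebraic:
  assumes "\<not> f dvd g" "eval2 \<iota> f x' y' = 0" "eval2 \<iota> g x' y' = 0"
  shows "\<not> transcendental x'"
proof -
  interpret e2: ring_morphism "\<lambda>g. eval2 \<iota> g x' y'" by (rule eval2_morphism)
  obtain r b where r: "r \<noteq> 0" "f dvd [:r:] - g * b" using elimination[OF assms(1)] by blast
  then obtain q where "[:r:] - g * b = f * q" by (auto simp: dvd_def)
  then have "eval2 \<iota> ([:r:] - g * b) x' y' = 0" using assms by (simp add: e2.hom_mult)
  then have "ev r x' = 0" using assms by (simp add: e2.hom_mult e2.hom_diff eval2_const)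
  then show ?thesis using r by (auto simp: transcendental_def)
qed

text \<open>
  A relation \<open>g\<close> outside the ideal $(f)$ would make $x'$ algebraic over $K$, by elimination of $Y$, and
  $y'$ as well, by elimination of $X$.  Then the field generated by them would be finite over $K$.
\<close>
lemma other_generators:
  assumes gen: "adjoin2 \<iota> x' y' = UNIV" and eq: "eval2 \<iota> f x' y' = 0"
  shows "function_field \<iota> f x' y'"
proof unfold_locales
  interpret e2: ring_morphism "\<lambda>g. eval2 \<iota> g x' y'" by (rule eval2_morphism)
  fix g
  show "eval2 \<iota> g x' y' = 0 \<longleftrightarrow> f dvd g"
  proof
    assume "f dvd g"
    then show "eval2 \<iota> g x' y' = 0" using eq by (auto simp: dvd_def e2.hom_mult)
  next
    assume g: "eval2 \<iota> g x' y' = 0"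
    show "f dvd g"
    proof (rule ccontr)
      assume n: "\<not> f dvd g"
      have "\<not> transcendental x'" by (rule relation_makes_x_algebraic[OF n eq g])
      moreover have "\<not> transcendental y'"
        by (rule function_field.relation_makes_x_algebraic[OF swapped, of "swap_vars g" y' x'])
           (use n eq g in \<open>auto simp: swap_vars_dvd_iff eval2_swap_vars\<close>)
      ultimately have alg: "algebraic_over (range \<iota>) x'" "algebraic_over (range \<iota>) y'"
        by (auto intro: algebraic_over_if_not_transcendental)
      obtain N where "\<And>z::nat \<Rightarrow> 'f.
          \<exists>c. (\<forall>i\<le>N. c i \<in> range \<iota>) \<and> (\<exists>i\<le>N. c i \<noteq> 0) \<and> (\<Sum>i\<le>N. c i * z i) = 0"
        using finite_rank_if_generated_by_algebraic[OF subfield_range _ gen alg] by auto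
      then show False using not_transcendental_if_finite_rank[of N] not_both_algebraic by blast
    qed
  qed
qed (use irreducible gen in auto)

text \<open>
  The multiple $s = ay$ by the leading coefficient $a$ satisfies a monic equation over $K[x]$, the
  product of $f(x,y) = 0$ with $a^{n-1}$.  At a pole of $s$ its leading term would have strictly smaller
  value than the others.
\<close>
lemma y_times_leading_coefficient_integral:
  assumes deg: "degree f > 0" and v: "is_place \<iota> v" and x: "v x \<ge> 0"
  shows "val_ge v 0 (ev (lead_coeff f) x * y)"
proof (rule ccontr)
  define n where "n = degree f"
  define a where "a = ev (lead_coeff f) x"
  define s where "s = a * y"
  obtain k where k: "n = Suc k" using deg by (cases n) (auto simp: n_def)
  assume "\<not> ?thesis"
  then have neg: "v s < 0" "s \<noteq> 0" by (auto simp: val_ge_def s_def a_def)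
  have ev0: "val_ge v 0 (ev p x)" for p using x by (intro val_ge_ev[OF v]) (simp add: val_ge_def)
  have "0 = a ^ k * (\<Sum>j\<le>n. ev (coeff f j) x * y ^ j)"
    using curve_equation by (simp add: eval2_altdef[of f n] n_def)
  also have "(\<Sum>j\<le>n. ev (coeff f j) x * y ^ j) = a * y ^ n + (\<Sum>j\<le>k. ev (coeff f j) x * y ^ j)"
    by (simp add: k a_def) (simp add: n_def[symmetric] k)
  also have "a ^ k * \<dots> = s ^ n + (\<Sum>j\<le>k. a ^ (k - j) * ev (coeff f j) x * s ^ j)"
  proof -
    have "a ^ k * (ev (coeff f j) x * y ^ j) = a ^ (k - j) * ev (coeff f j) x * s ^ j" if "j \<le> k" for j
    proof -
      have "a ^ k = a ^ (k - j) * a ^ j" using that by (simp flip: power_add)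
      then show ?thesis by (simp add: s_def power_mult_distrib mult_ac)
    qed
    then have "a ^ k * (\<Sum>j\<le>k. ev (coeff f j) x * y ^ j) = (\<Sum>j\<le>k. a ^ (k - j) * ev (coeff f j) x * s ^ j)"
      unfolding sum_distrib_left by (intro sum.cong) auto
    then show ?thesis by (simp add: distrib_left k s_def power_mult_distrib mult_ac)
  qed
  finally have "s ^ n = - (\<Sum>j\<le>k. a ^ (k - j) * ev (coeff f j) x * s ^ j)" by (simp add: eq_neg_iff_add_eq_0)
  moreover have "val_ge v (int k * v s) (\<Sum>j\<le>k. a ^ (k - j) * ev (coeff f j) x * s ^ j)"
  proof (rule val_ge_sum[OF v])
    fix j assume "j \<in> {..k}"
    then have "int k * v s \<le> int j * v s" using neg by (intro mult_right_mono_neg) auto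
    then have "val_ge v (int k * v s) (s ^ j)" using neg by (simp add: val_ge_def place_power[OF v])
    moreover have "val_ge v 0 (a ^ (k - j) * ev (coeff f j) x)"
      by (rule val_ge_mult[OF v val_ge_power[OF v] ev0]) (auto simp: a_def ev0)
    ultimately show "val_ge v (int k * v s) (a ^ (k - j) * ev (coeff f j) x * s ^ j)"
      using val_ge_mult[OF v, of 0] by simp
  qed
  ultimately have "val_ge v (int k * v s) (s ^ n)" by (simp add: val_ge_uminus[OF v])
  then show False using neg by (simp add: val_ge_def place_mult[OF v] place_power[OF v] k algebra_simps)
qed

text \<open>
  If \<open>x\<close> is algebraic over $K$, both sides are 0.  Otherwise the powers of $ay$, where $a$ is the
  leading coefficient of \<open>f\<close>, are an integral basis of $L$ over $K(x)$.
\<close>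
theorem degree_of_poles_of_x: "divisor_degree \<iota> (pole_divisor \<iota> x) = int (degree f)"
proof (cases "degree f = 0")
  case True
  then have "\<not> transcendental x" by (simp add: x_transcendental_iff)
  then have "{v. is_place \<iota> v \<and> pole_divisor \<iota> x v \<noteq> 0} = {}"
    using no_pole_if_not_transcendental by (fastforce simp: pole_divisor_def)
  then show ?thesis using True by (simp add: divisor_degree_def)
next
  case False
  then have deg: "degree f > 0" by simp
  then have x: "transcendental x" by (simp add: x_transcendental_iff)
  interpret e: ring_morphism "\<lambda>p. ev p x" by (rule ev_morphism)
  define n where "n = degree f"
  define a where "a = ev (lead_coeff f) x"
  have a: "a \<noteq> 0" using x f_nonzero unfolding a_def transcendental_def by auto
  define z where "z k = (a * y) ^ k" for k
  show ?thesis unfolding n_def[symmetric]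
  proof (rule degree_of_pole_divisor[OF x, of z n])
    show "Span (rat_field x) z {..<n} = UNIV"
    proof -
      have "h \<in> Span (rat_field x) z {..<n}" for h
      proof -
        have "h \<in> Span (rat_field x) (\<lambda>k. y ^ k) {..<n}" using powers_span[OF deg] by (simp add: n_def)
        then obtain c where c: "h = (\<Sum>k<n. c k * y ^ k)" "\<forall>k<n. c k \<in> rat_field x" by (auto simp: Span_def)
        have "h = (\<Sum>k<n. (c k / a ^ k) * z k)" using a by (simp add: c(1) z_def power_mult_distrib)
        moreover have "c k / a ^ k \<in> rat_field x" if "k < n" for k
          using c(2) that ev_in_rat_field subring_power[OF subfield_subring[OF subfield_rat_field]]
          by (intro subfield_divide[OF subfield_rat_field]) (auto simp: a_def)
        ultimately show ?thesis using SpanI[of "{..<n}" "\<lambda>k. c k / a ^ k"] by simp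
      qed
      then show ?thesis by auto
    qed
    show "\<forall>i<n. p i = 0" if p: "(\<Sum>i<n. ev (p i) x * z i) = 0" for p
    proof -
      have "(\<Sum>i<n. ev (p i * lead_coeff f ^ i) x * y ^ i) = 0"
        using p by (simp add: z_def e.hom_mult e.hom_power power_mult_distrib a_def mult_ac)
      then have "p i * lead_coeff f ^ i = 0" if "i < n" for i
        using powers_independent[of "\<lambda>i. p i * lead_coeff f ^ i" i] that by (simp add: n_def)
      then show ?thesis using f_nonzero by simp
    qed
    show "val_ge v 0 (z i)" if "is_place \<iota> v" "v x \<ge> 0" for v i
      using that y_times_leading_coefficient_integral[OF deg] by (auto simp: z_def a_def intro: val_ge_power)
  qed
qed

theorem degree_of_poles_of_y: "divisor_degree \<iota> (pole_divisor \<iota> y) = int (degree_X f)"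
  using function_field.degree_of_poles_of_x[OF swapped] by (simp add: degree_swap_vars)

end

section \<open>Common poles of the coordinate functions\<close>

text \<open>
  The corner of the box is the monomial $X^M Y^N$.  Divided by it, the values $g(x,y)$ of the polynomials
  in the box are polynomials in $1/x$ and $1/y$, with the coefficient at the corner as constant term.
\<close>
definition in_box :: "nat \<Rightarrow> nat \<Rightarrow> 'a::zero poly poly \<Rightarrow> bool" where
  "in_box M N g \<longleftrightarrow> (\<forall>i j. coeff (coeff g j) i \<noteq> 0 \<longrightarrow> i \<le> M \<and> j \<le> N)"

lemma in_box_mono: "in_box M N g \<Longrightarrow> M \<le> M' \<Longrightarrow> N \<le> N' \<Longrightarrow> in_box M' N' g"
  unfolding in_box_def by (meson le_trans)

lemma in_box_diff:
  fixes g h :: "'a::comm_ring_1 poly poly"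
  shows "in_box M N g \<Longrightarrow> in_box M N h \<Longrightarrow> in_box M N (g - h)"
  unfolding in_box_def by (metis coeff_diff diff_self)

lemma in_box_mult:
  fixes g h :: "'a::comm_ring_1 poly poly"
  assumes g: "in_box M N g" and h: "in_box M' N' h"
  shows "in_box (M + M') (N + N') (g * h)"
  unfolding in_box_def
proof (intro allI impI)
  fix i j assume nz: "coeff (coeff (g * h) j) i \<noteq> 0"
  have "coeff (coeff (g * h) j) i
      = (\<Sum>k\<le>j. \<Sum>l\<le>i. coeff (coeff g k) l * coeff (coeff h (j - k)) (i - l))"
    by (simp add: coeff_mult coeff_sum)
  then obtain k where "k \<le> j" "(\<Sum>l\<le>i. coeff (coeff g k) l * coeff (coeff h (j - k)) (i - l)) \<noteq> 0"
    using nz by (metis (no_types, lifting) atMost_iff sum.neutral)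
  moreover from this(2) obtain l where "l \<le> i" "coeff (coeff g k) l * coeff (coeff h (j - k)) (i - l) \<noteq> 0"
    by (metis (no_types, lifting) atMost_iff sum.neutral)
  moreover from this(2) have "coeff (coeff g k) l \<noteq> 0" "coeff (coeff h (j - k)) (i - l) \<noteq> 0" by auto
  then have "l \<le> M" "k \<le> N" "i - l \<le> M'" "j - k \<le> N'" using g h unfolding in_box_def by blast+
  ultimately show "i \<le> M + M' \<and> j \<le> N + N'" by linarith
qed

lemma in_box_monom: "in_box M N (monom (monom c M) N)"
  by (simp add: in_box_def)

lemma in_box_const2: "in_box 0 0 (const2 c)"
  by (auto simp: in_box_def const2_def coeff_pCons split: nat.splits)

lemma in_box_degrees: "in_box (degree_X g) (degree g) g"
  unfolding in_box_def
proof (intro allI impI conjI)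
  fix i j assume nz: "coeff (coeff g j) i \<noteq> 0"
  then show "i \<le> degree_X g" by (rule le_degree_X)
  from nz have "coeff g j \<noteq> 0" by auto
  then show "j \<le> degree g" by (rule le_degree)
qed

lemma degree_eq_if_corner:
  assumes "in_box M N g" "coeff (coeff g N) M \<noteq> 0"
  shows "degree g = N" "degree_X g = M"
proof -
  have "g \<noteq> 0" using assms(2) by auto
  then obtain j where "coeff (coeff g j) (degree_X g) \<noteq> 0" by (rule degree_X_attained)
  then show "degree_X g = M" using assms le_degree_X[of g N M] by (auto simp: in_box_def intro: antisym)
  have "coeff g (degree g) \<noteq> 0" using \<open>g \<noteq> 0\<close> by simp
  then obtain i where "coeff (coeff g (degree g)) i \<noteq> 0" by (metis poly_eqI coeff_0)
  then have "degree g \<le> N" using assms(1) by (simp add: in_box_def)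
  moreover have "coeff g N \<noteq> 0" using assms(2) by auto
  then have "N \<le> degree g" by (rule le_degree)
  ultimately show "degree g = N" by simp
qed

lemma coeff_mult_at_bounds:
  fixes p q :: "'a::comm_ring_1 poly"
  assumes "degree p \<le> a" "degree q \<le> b"
  shows "coeff (p * q) (a + b) = coeff p a * coeff q b"
proof -
  have "coeff (p * q) (a + b) = (\<Sum>i\<le>a + b. coeff p i * coeff q (a + b - i))" by (rule coeff_mult)
  also have "\<dots> = (\<Sum>i\<in>{a}. coeff p i * coeff q (a + b - i))"
  proof (rule sum.mono_neutral_right)
    show "\<forall>i\<in>{..a + b} - {a}. coeff p i * coeff q (a + b - i) = 0"
    proof
      fix i assume "i \<in> {..a + b} - {a}"
      then consider "i > a" | "a + b - i > b" by fastforce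
      then show "coeff p i * coeff q (a + b - i) = 0"
        using assms by cases (auto simp: coeff_eq_0)
    qed
  qed auto
  finally show ?thesis by simp
qed

lemma degree_X_mult:
  fixes g h :: "'a::idom poly poly"
  assumes "g \<noteq> 0" "h \<noteq> 0" shows "degree_X (g * h) = degree_X g + degree_X h"
  using assms by (simp add: swap_vars_mult degree_mult_eq flip: degree_swap_vars)

text \<open>
  The coefficient at the corner of the bidegree is multiplicative, as the leading coefficient is.
\<close>
lemma corner_coeff_mult:
  fixes g h :: "'a::comm_ring_1 poly poly"
  shows "coeff (coeff (g * h) (degree g + degree h)) (degree_X g + degree_X h)
    = coeff (coeff g (degree g)) (degree_X g) * coeff (coeff h (degree h)) (degree_X h)"
proof -
  have "degree (coeff p j) \<le> degree_X p" for p :: "'a poly poly" and j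
    using le_degree_X[of p j "degree (coeff p j)"] by (cases "coeff p j = 0") auto
  then show ?thesis by (simp add: coeff_mult_at_bounds coeff_mult_degree_sum)
qed

context function_field
begin

text \<open>
  At a common pole the value of a monomial strictly decreases with each of its exponents, so the
  corner monomial would dominate all other terms of $f(x,y)$.
\<close>
lemma no_common_pole_if_corner:
  assumes corner: "coeff (coeff f (degree f)) (degree_X f) \<noteq> 0" and v: "is_place \<iota> v"
  shows "\<not> (v x < 0 \<and> v y < 0)"
proof
  assume neg: "v x < 0 \<and> v y < 0"
  then have nz: "x \<noteq> 0" "y \<noteq> 0" using place_0[OF v] by auto
  define m where "m = degree_X f"
  define l where "l = degree f"
  define T where "T = (\<lambda>(i, j). \<iota> (coeff (coeff f j) i) * x ^ i * y ^ j)"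
  have ml: "(m, l) \<in> monomials f" using corner by (simp add: monomials_def m_def l_def)
  have val: "v (T (i, j)) = int i * v x + int j * v y" "T (i, j) \<noteq> 0" if "(i, j) \<in> monomials f" for i j
    using that nz by (auto simp: T_def monomials_def place_mult[OF v] place_power[OF v] place_iota[OF v])
  have "val_ge v (v (T (m, l)) + 1) (\<Sum>s\<in>monomials f - {(m, l)}. T s)"
  proof (rule val_ge_sum[OF v])
    fix s assume s: "s \<in> monomials f - {(m, l)}"
    obtain i j where ij: "s = (i, j)" by (cases s)
    have le: "i \<le> m" "j \<le> l"
      using in_box_degrees[of f] s by (auto simp: ij in_box_def monomials_def m_def l_def)
    have 1: "int m * v x \<le> int i * v x" "int l * v y \<le> int j * v y"
      using le neg by (auto intro: mult_right_mono_neg)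
    have "int m * v x < int i * v x \<or> int l * v y < int j * v y"
      using le neg s by (auto simp: ij mult_less_cancel_right_disj)
    then have "v (T (m, l)) + 1 \<le> v (T s)"
      using 1 s ml by (auto simp: ij val)
    then show "val_ge v (v (T (m, l)) + 1) (T s)" by (simp add: val_ge_def)
  qed
  from place_add_dominant(1)[OF v val(2)[OF ml] this]
  have "(\<Sum>s\<in>monomials f. T s) \<noteq> 0" using ml by (simp add: sum.remove finite_monomials)
  moreover have "(\<Sum>s\<in>monomials f. T s) = eval2 \<iota> f x y"
    by (simp add: eval2_as_sum_of_monomials T_def case_prod_beta)
  ultimately show False using curve_equation by simp
qed

lemma x_nonzero: "degree f > 0 \<Longrightarrow> x \<noteq> 0"
  using x_transcendental_iff transcendental_neq_0 by blast

lemma y_nonzero: "degree_X f > 0 \<Longrightarrow> y \<noteq> 0"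
  using function_field.x_nonzero[OF swapped] by (simp add: degree_swap_vars)

text \<open>
  The ring $K[1/x,1/y]$, in a form that yields polynomial relations between \<open>x\<close> and \<open>y\<close> directly.
\<close>
definition polynomials_in_inverses :: "'f set" where
  "polynomials_in_inverses = {z. \<exists>M N g. z * x ^ M * y ^ N = eval2 \<iota> g x y \<and> in_box M N g}"

lemma in_polynomials_in_inversesI:
  "z * x ^ M * y ^ N = eval2 \<iota> g x y \<Longrightarrow> in_box M N g \<Longrightarrow> z \<in> polynomials_in_inverses"
  unfolding polynomials_in_inverses_def by blast

lemma monomial_shift:
  assumes "z * x ^ M * y ^ N = eval2 \<iota> g x y" "in_box M N g"
  shows "z * x ^ (M + M') * y ^ (N + N') = eval2 \<iota> (g * monom (monom 1 M') N') x y"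
    "in_box (M + M') (N + N') (g * monom (monom 1 M') N')"
  using in_box_mult[OF assms(2) in_box_monom]
  by (simp_all add: ring_morphism.hom_mult[OF eval2_morphism] assms(1)[symmetric] eval2_monom ev_monom hom_1 power_add mult_ac)

lemma subring_polynomials_in_inverses: "is_subring polynomials_in_inverses"
  unfolding is_subring_def
proof (intro conjI ballI)
  interpret e2: ring_morphism "\<lambda>g. eval2 \<iota> g x y" by (rule eval2_morphism)
  show "1 \<in> polynomials_in_inverses"
    by (rule in_polynomials_in_inversesI[of _ 0 0 "const2 1"]) (auto simp: const2_def eval2_const ev_const hom_1, auto simp: in_box_const2 simp flip: const2_def)
  fix a b assume "a \<in> polynomials_in_inverses" "b \<in> polynomials_in_inverses"
  then obtain M N g M' N' h where
    g: "a * x ^ M * y ^ N = eval2 \<iota> g x y" "in_box M N g" and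
    h: "b * x ^ M' * y ^ N' = eval2 \<iota> h x y" "in_box M' N' h"
    by (auto simp: polynomials_in_inverses_def)
  note g' = monomial_shift[OF g, of M' N'] and h' = monomial_shift[OF h, of M N]
  have "(a - b) * x ^ (M + M') * y ^ (N + N')
      = eval2 \<iota> (g * monom (monom 1 M') N' - h * monom (monom 1 M) N) x y"
    unfolding e2.hom_diff g'(1)[symmetric] h'(1)[symmetric] by (simp add: left_diff_distrib add.commute)
  moreover have "in_box (M + M') (N + N') (g * monom (monom 1 M') N' - h * monom (monom 1 M) N)"
    using g'(2) h'(2) by (intro in_box_diff) (simp_all add: add.commute)
  ultimately show "a - b \<in> polynomials_in_inverses" by (rule in_polynomials_in_inversesI)
  have "a * b * x ^ (M + M') * y ^ (N + N') = eval2 \<iota> (g * h) x y"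
    unfolding e2.hom_mult g(1)[symmetric] h(1)[symmetric] by (simp add: power_add mult_ac)
  then show "a * b \<in> polynomials_in_inverses"
    using in_box_mult[OF g(2) h(2)] by (rule in_polynomials_in_inversesI)
qed

text \<open>
  If $1 = a/x + b/y$ with $a$, $b$ in $K[1/x,1/y]$, multiplication with a monomial gives a polynomial
  $H$ in the ideal $(f)$ which has the coefficient 1 at the corner of its box.  A multiple of \<open>f\<close> has
  no such corner if \<open>f\<close> has none.  So the ideal generated by $1/x$ and $1/y$ is proper, and there is a
  place at which both elements vanish.
\<close>
lemma common_pole_if_no_corner:
  assumes corner: "coeff (coeff f (degree f)) (degree_X f) = 0"
  obtains v where "is_place \<iota> v" "v x < 0" "v y < 0"
proof -
  interpret e2: ring_morphism "\<lambda>g. eval2 \<iota> g x y" by (rule eval2_morphism)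
  \<comment> \<open>if only one variable occurred in \<open>f\<close>, the corner coefficient would be its leading coefficient; so
    both variables occur, and \<open>x\<close> and \<open>y\<close> are nonzero\<close>
  have degY: "degree f > 0"
  proof (rule ccontr)
    assume "\<not> degree f > 0"
    moreover obtain j where "coeff (coeff f j) (degree_X f) \<noteq> 0" by (rule degree_X_attained[OF f_nonzero])
    then have "coeff f j \<noteq> 0" "coeff (coeff f j) (degree_X f) \<noteq> 0" by auto
    then have "j \<le> degree f" by (blast intro: le_degree)
    ultimately have "j = degree f" by simp
    then show False using corner \<open>coeff (coeff f j) (degree_X f) \<noteq> 0\<close> by simp
  qed
  have degX: "degree_X f > 0"
  proof (rule ccontr)
    assume "\<not> degree_X f > 0"
    moreover have "coeff f (degree f) \<noteq> 0" using f_nonzero by simp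
    then obtain i where "coeff (coeff f (degree f)) i \<noteq> 0" by (metis poly_eqI coeff_0)
    moreover from this have "i \<le> degree_X f" by (rule le_degree_X)
    ultimately show False using corner by simp
  qed
  have nz: "x \<noteq> 0" "y \<noteq> 0" using x_nonzero[OF degY] y_nonzero[OF degX] .
  define u where "u = inverse x"
  define w where "w = inverse y"
  define R where "R = polynomials_in_inverses"
  have KR: "range \<iota> \<subseteq> R"
  proof
    fix a assume "a \<in> range \<iota>"
    then obtain c where "a = \<iota> c" by auto
    then have "a * x ^ 0 * y ^ 0 = eval2 \<iota> (const2 c) x y" by (simp add: const2_def eval2_const ev_const)
    then show "a \<in> R" unfolding R_def using in_box_const2 by (rule in_polynomials_in_inversesI)
  qed
  have one: "eval2 \<iota> (const2 1) x y = 1" by (simp add: const2_def eval2_const ev_const hom_1)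
  have uR: "u \<in> R" unfolding R_def
    by (rule in_polynomials_in_inversesI[of _ 1 0 "const2 1"])
       (use nz in_box_mono[OF in_box_const2] in \<open>auto simp: one u_def\<close>)
  have wR: "w \<in> R" unfolding R_def
    by (rule in_polynomials_in_inversesI[of _ 0 1 "const2 1"])
       (use nz in_box_mono[OF in_box_const2] in \<open>auto simp: one w_def\<close>)
  have "1 \<notin> ideal2 R u w"
  proof
    assume "1 \<in> ideal2 R u w"
    then obtain a b where ab: "1 = u * a + w * b" "a \<in> R" "b \<in> R" by (auto simp: ideal2_def)
    then obtain M N g M' N' h where
      g: "a * x ^ M * y ^ N = eval2 \<iota> g x y" "in_box M N g" and
      h: "b * x ^ M' * y ^ N' = eval2 \<iota> h x y" "in_box M' N' h"
      unfolding R_def polynomials_in_inverses_def by blast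
    define P where "P = M + M'"
    define Q where "Q = N + N'"
    define g' where "g' = g * monom (monom 1 M') (N' + 1)"
    define h' where "h' = h * monom (monom 1 (M + 1)) N"
    have g': "a * x ^ P * y ^ (Q + 1) = eval2 \<iota> g' x y" "in_box P (Q + 1) g'"
      using monomial_shift[OF g, of M' "N' + 1"] by (simp_all add: g'_def P_def Q_def add.assoc)
    have h': "b * x ^ (P + 1) * y ^ Q = eval2 \<iota> h' x y" "in_box (P + 1) Q h'"
      using monomial_shift[OF h, of "M + 1" N] by (simp_all add: h'_def P_def Q_def ac_simps)
    \<comment> \<open>$H(x,y)$ is $x^{P+1} y^{Q+1} (1 - a/x - b/y)$\<close>
    define H where "H = monom (monom 1 (P + 1)) (Q + 1) - g' - h'"
    have "x ^ (P + 1) * y ^ (Q + 1) = (u * a + w * b) * (x ^ (P + 1) * y ^ (Q + 1))" using ab by simp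
    also have "\<dots> = a * x ^ P * y ^ (Q + 1) + b * x ^ (P + 1) * y ^ Q"
      using nz by (simp add: u_def w_def field_simps)
    finally have "eval2 \<iota> H x y = 0"
      unfolding H_def e2.hom_diff g'(1)[symmetric] h'(1)[symmetric]
      by (simp add: eval2_monom ev_monom hom_1)
    then obtain q where q: "H = f * q" using relations by (auto simp: dvd_def)
    have box: "in_box (P + 1) (Q + 1) H" unfolding H_def
      using g'(2) h'(2) by (intro in_box_diff in_box_monom) (auto elim: in_box_mono)
    have "coeff (coeff g' (Q + 1)) (P + 1) = 0" "coeff (coeff h' (Q + 1)) (P + 1) = 0"
      using g'(2) h'(2) unfolding in_box_def by fastforce+
    then have H1: "coeff (coeff H (Q + 1)) (P + 1) = 1" by (simp add: H_def)
    then have "H \<noteq> 0" by auto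
    then have "q \<noteq> 0" using q by auto
    have "degree H = Q + 1" "degree_X H = P + 1" using degree_eq_if_corner[OF box] H1 by auto
    then have "Q + 1 = degree f + degree q" "P + 1 = degree_X f + degree_X q"
      using q f_nonzero \<open>q \<noteq> 0\<close> by (simp_all add: degree_mult_eq degree_X_mult)
    then have "coeff (coeff H (Q + 1)) (P + 1) = 0"
      using corner_coeff_mult[of f q] corner by (simp add: q)
    then show False using H1 by simp
  qed
  then obtain v where v: "is_place \<iota> v" "v u > 0" "w = 0 \<or> v w > 0"
    using place_exists[OF subring_polynomials_in_inverses[folded R_def] KR uR wR] nz by (auto simp: u_def)
  then show ?thesis using that[of v] nz by (auto simp: u_def w_def place_inverse)
qed

lemma no_common_pole_iff:
  "(\<nexists>v. is_place \<iota> v \<and> is_pole_at v x \<and> is_pole_at v y)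
    \<longleftrightarrow> coeff (coeff f (degree f)) (degree_X f) \<noteq> 0"
  unfolding is_pole_at_def using no_common_pole_if_corner common_pole_if_no_corner by metis

end

section \<open>Multiplicities and the normal form of the equation\<close>

lemma le_total_degree: "coeff (coeff f j) i \<noteq> 0 \<Longrightarrow> i + j \<le> total_degree f"
proof -
  assume nz: "coeff (coeff f j) i \<noteq> 0"
  then have "i + j \<in> (\<lambda>(i, j). i + j) ` monomials f" by (force simp: monomials_def)
  moreover have "f \<noteq> 0" using nz by auto
  ultimately show ?thesis by (auto simp: total_degree_def intro!: Max_ge finite_imageI finite_monomials)
qed

lemma total_degree_attained:
  assumes "f \<noteq> 0" obtains i j where "coeff (coeff f j) i \<noteq> 0" "i + j = total_degree f"
proof -
  have "total_degree f \<in> (\<lambda>(i, j). i + j) ` monomials f"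
    unfolding total_degree_def using assms finite_monomials[of f] monomials_empty_iff[of f]
    by (simp only: if_False) (rule Max_in, auto)
  then show ?thesis using that by (auto simp: monomials_def)
qed

lemma monomials_of_sum:
  assumes S: "finite S" and inj: "inj_on \<phi> S" and a: "\<And>s. s \<in> S \<Longrightarrow> a s \<noteq> 0"
  shows "monomials (\<Sum>s\<in>S. monom (monom (a s) (fst (\<phi> s))) (snd (\<phi> s))) = \<phi> ` S"
proof -
  define b where "b i j = a (inv_into S \<phi> (i, j))" for i j
  have "(\<Sum>s\<in>S. monom (monom (a s) (fst (\<phi> s))) (snd (\<phi> s))) = (\<Sum>(i, j)\<in>\<phi> ` S. monom (monom (b i j) i) j)"
    using inj by (simp add: sum.reindex case_prod_beta b_def)
  moreover have "b i j \<noteq> 0" if "(i, j) \<in> \<phi> ` S" for i j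
    using a inv_into_into[OF that] by (simp add: b_def)
  ultimately show ?thesis
    using S by (auto simp: monomials_def coeff_sum_monom_monom)
qed

lemma monomial_eq: "const2 a * [:[:0, 1:]:] ^ p * [:0, 1:] ^ q = monom (monom (a::'a::field) p) q"
proof -
  have "[:[:0, 1::'a:]:] = monom (monom 1 1) 0" "[:0, 1::'a poly:] = monom 1 1" "const2 a = monom (monom a 0) 0"
    by (simp_all add: monom_0 monom_Suc const2_def)
  then show ?thesis by (simp only: monom_power mult_monom) simp
qed

text \<open>
  The map \<open>\<phi>\<close> sends the exponents of a monomial of \<open>f\<close> to those of its image in the chart.  No two
  monomials are merged, so the multiplicity is the least degree of an image.
\<close>
lemma point_multiplicity_eq:
  assumes local: "local_equation f P
      = (\<Sum>s\<in>monomials f. monom (monom (coeff (coeff f (snd s)) (fst s)) (fst (\<phi> s))) (snd (\<phi> s)))"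
    and inj: "inj_on \<phi> (monomials f)"
    and deg: "\<And>s. s \<in> monomials f \<Longrightarrow> fst (\<phi> s) + snd (\<phi> s) = d - k s"
    and K: "\<And>s. s \<in> monomials f \<Longrightarrow> k s \<le> K" "\<exists>s\<in>monomials f. k s = K"
  shows "point_multiplicity f P = d - K"
proof -
  have "monomials (local_equation f P) = \<phi> ` monomials f"
    unfolding local
    by (rule monomials_of_sum[OF finite_monomials inj]) (auto simp: monomials_def)
  then have "(\<lambda>(i, j). i + j) ` monomials (local_equation f P) = (\<lambda>s. d - k s) ` monomials f"
    unfolding image_image case_prod_beta by (simp add: image_image deg cong: image_cong)
  then have "point_multiplicity f P = Min ((\<lambda>s. d - k s) ` monomials f)"
    by (simp add: point_multiplicity_def)
  also have "\<dots> = d - K"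
  proof (rule Min_eqI)
    show "finite ((\<lambda>s. d - k s) ` monomials f)" by (intro finite_imageI finite_monomials)
    show "d - K \<le> e" if "e \<in> (\<lambda>s. d - k s) ` monomials f" for e
      using that K(1) by (auto intro: diff_le_mono2)
    show "d - K \<in> (\<lambda>s. d - k s) ` monomials f" using K(2) by auto
  qed
  finally show ?thesis .
qed

lemma in_monomials_iff: "s \<in> monomials f \<longleftrightarrow> coeff (coeff f (snd s)) (fst s) \<noteq> 0"
  by (cases s) (simp add: monomials_def)

lemma point_multiplicity_100:
  fixes f :: "'a::field poly poly" assumes f: "f \<noteq> 0"
  shows "point_multiplicity f (1, 0, 0) = total_degree f - degree_X f"
proof (rule point_multiplicity_eq[where k = fst and \<phi> = "\<lambda>s. (snd s, total_degree f - fst s - snd s)"])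
  have d: "fst s + snd s \<le> total_degree f" if "s \<in> monomials f" for s
    using that le_total_degree by (simp add: in_monomials_iff)
  have "const2 (0::'a) = 0" by (simp add: const2_def)
  then show "local_equation f (1, 0, 0) = (\<Sum>s\<in>monomials f. monom (monom (coeff (coeff f (snd s)) (fst s))
      (fst (snd s, total_degree f - fst s - snd s))) (snd (snd s, total_degree f - fst s - snd s)))"
    unfolding local_equation_def homogenization_subst_def
    by (simp add: case_prod_beta monomial_eq)
  show "inj_on (\<lambda>s. (snd s, total_degree f - fst s - snd s)) (monomials f)"
  proof (rule inj_onI)
    fix s t assume "s \<in> monomials f" "t \<in> monomials f"
      "(snd s, total_degree f - fst s - snd s) = (snd t, total_degree f - fst t - snd t)"
    then show "s = t" using d[of s] d[of t] by (cases s; cases t) auto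
  qed
  show "fst (snd s, total_degree f - fst s - snd s) + snd (snd s, total_degree f - fst s - snd s)
      = total_degree f - fst s" if "s \<in> monomials f" for s
    using d[OF that] by simp
  show "fst s \<le> degree_X f" if "s \<in> monomials f" for s
    using that le_degree_X by (simp add: in_monomials_iff)
  obtain j where "coeff (coeff f j) (degree_X f) \<noteq> 0" by (rule degree_X_attained[OF f])
  then show "\<exists>s\<in>monomials f. fst s = degree_X f"
    by (intro bexI[of _ "(degree_X f, j)"]) (auto simp: in_monomials_iff)
qed

lemma point_multiplicity_010:
  fixes f :: "'a::field poly poly" assumes f: "f \<noteq> 0"
  shows "point_multiplicity f (0, 1, 0) = total_degree f - degree f"
proof (rule point_multiplicity_eq[where k = snd and \<phi> = "\<lambda>s. (fst s, total_degree f - fst s - snd s)"])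
  have d: "fst s + snd s \<le> total_degree f" if "s \<in> monomials f" for s
    using that le_total_degree by (simp add: in_monomials_iff)
  have "const2 (0::'a) = 0" by (simp add: const2_def)
  then show "local_equation f (0, 1, 0) = (\<Sum>s\<in>monomials f. monom (monom (coeff (coeff f (snd s)) (fst s))
      (fst (fst s, total_degree f - fst s - snd s))) (snd (fst s, total_degree f - fst s - snd s)))"
    unfolding local_equation_def homogenization_subst_def
    by (simp add: case_prod_beta monomial_eq)
  show "inj_on (\<lambda>s. (fst s, total_degree f - fst s - snd s)) (monomials f)"
  proof (rule inj_onI)
    fix s t assume "s \<in> monomials f" "t \<in> monomials f"
      "(fst s, total_degree f - fst s - snd s) = (fst t, total_degree f - fst t - snd t)"
    then show "s = t" using d[of s] d[of t] by (cases s; cases t) auto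
  qed
  show "fst (fst s, total_degree f - fst s - snd s) + snd (fst s, total_degree f - fst s - snd s)
      = total_degree f - snd s" if "s \<in> monomials f" for s
    using d[OF that] by simp
  show "snd s \<le> degree f" if "s \<in> monomials f" for s
    using that in_box_degrees[of f] by (simp add: in_monomials_iff in_box_def)
  have "coeff f (degree f) \<noteq> 0" using f by simp
  then obtain i where "coeff (coeff f (degree f)) i \<noteq> 0" by (metis poly_eqI coeff_0)
  then show "\<exists>s\<in>monomials f. snd s = degree f"
    by (intro bexI[of _ "(i, degree f)"]) (auto simp: in_monomials_iff)
qed

lemma degrees_le_total_degree:
  assumes "f \<noteq> 0" shows "degree_X f \<le> total_degree f" "degree f \<le> total_degree f"
proof -
  obtain j where "coeff (coeff f j) (degree_X f) \<noteq> 0" by (rule degree_X_attained[OF assms])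
  then show "degree_X f \<le> total_degree f" using le_total_degree add_leD1 by blast
  have "coeff f (degree f) \<noteq> 0" using assms by simp
  then obtain i where "coeff (coeff f (degree f)) i \<noteq> 0" by (metis poly_eqI coeff_0)
  then show "degree f \<le> total_degree f" using le_total_degree add_leD2 by blast
qed

text \<open>
  A monomial of degree equal to the sum of the partial degrees can only be the corner monomial.
\<close>
lemma total_degree_eq_iff_corner:
  assumes "f \<noteq> 0"
  shows "degree_X f + degree f = total_degree f \<longleftrightarrow> coeff (coeff f (degree f)) (degree_X f) \<noteq> 0"
proof -
  obtain i j where ij: "coeff (coeff f j) i \<noteq> 0" "i + j = total_degree f"
    by (rule total_degree_attained[OF assms])
  have le: "i \<le> degree_X f" "j \<le> degree f" using ij(1) in_box_degrees[of f] by (auto simp: in_box_def)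
  show ?thesis
  proof
    assume "degree_X f + degree f = total_degree f"
    then have "i = degree_X f" "j = degree f" using le ij(2) by auto
    then show "coeff (coeff f (degree f)) (degree_X f) \<noteq> 0" using ij(1) by simp
  next
    assume "coeff (coeff f (degree f)) (degree_X f) \<noteq> 0"
    then have "degree_X f + degree f \<le> total_degree f" by (rule le_total_degree)
    then show "degree_X f + degree f = total_degree f" using le ij(2) by auto
  qed
qed

lemma multiplicities_iff:
  fixes f :: "'a::field poly poly" assumes "f \<noteq> 0"
  shows "point_multiplicity f (1, 0, 0) = l \<and> point_multiplicity f (0, 1, 0) = m \<and> m + l = total_degree f
    \<longleftrightarrow> degree f = l \<and> degree_X f = m \<and> coeff (coeff f (degree f)) (degree_X f) \<noteq> 0"
  unfolding point_multiplicity_100[OF assms] point_multiplicity_010[OF assms]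
    total_degree_eq_iff_corner[OF assms, symmetric]
  using degrees_le_total_degree[OF assms] by auto

lemma coeff_const2_mult: "coeff (coeff (const2 c * f) j) i = c * coeff (coeff f j) i"
  by (simp add: const2_def)

text \<open>
  In the normal form, the bound on the total degree of \<open>g\<close> excludes the corner monomial from \<open>g\<close>, so
  that it occurs in \<open>f\<close>.  Conversely, division by the corner coefficient leaves a remainder of smaller
  total degree, because the corner is the only monomial of top degree in the box.
\<close>
lemma normal_form_iff:
  fixes f :: "'a::field poly poly" assumes f: "irreducible f"
  shows "(\<exists>c g. c \<noteq> 0 \<and> const2 c * f = monom (monom 1 m) l + g \<and>
        total_degree g < total_degree f \<and> total_degree f = m + l \<and> degree_X g \<le> m \<and> degree g \<le> l)
    \<longleftrightarrow> degree f = l \<and> degree_X f = m \<and> coeff (coeff f (degree f)) (degree_X f) \<noteq> 0"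
    (is "?normal \<longleftrightarrow> ?corner")
proof
  assume ?normal
  then obtain c g where c: "c \<noteq> 0" and eq: "const2 c * f = monom (monom 1 m) l + g"
    and g: "total_degree g < m + l" "degree_X g \<le> m" "degree g \<le> l" by auto
  have coeff_eq: "c * coeff (coeff f j) i = coeff (coeff (monom (monom 1 m) l + g) j) i" for i j
    unfolding eq[symmetric] coeff_const2_mult ..
  have "coeff (coeff g l) m = 0" using le_total_degree[of g l m] g(1) by auto
  then have "c * coeff (coeff f l) m = 1" unfolding coeff_eq by simp
  then have nz: "coeff (coeff f l) m \<noteq> 0" by auto
  have "in_box m l f"
    unfolding in_box_def
  proof (intro allI impI)
    fix i j assume "coeff (coeff f j) i \<noteq> 0"
    then have "coeff (coeff (monom (monom 1 m) l + g) j) i \<noteq> 0" unfolding coeff_eq[symmetric] using c by simp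
    then have "(i = m \<and> j = l) \<or> coeff (coeff g j) i \<noteq> 0" by (auto split: if_splits)
    then show "i \<le> m \<and> j \<le> l" using g in_box_mono[OF in_box_degrees g(2,3)] by (auto simp: in_box_def)
  qed
  then show ?corner using degree_eq_if_corner[OF _ nz] nz by simp
next
  assume ?corner
  then have deg: "degree f = l" "degree_X f = m" and nz: "coeff (coeff f l) m \<noteq> 0" by auto
  have "f \<noteq> 0" using f by (simp add: irreducible_def)
  then have d: "total_degree f = m + l" using total_degree_eq_iff_corner[of f] deg nz by simp
  have box: "in_box m l f" using in_box_degrees[of f] deg by simp
  \<comment> \<open>settles the case $g = 0$, where the total degree is 0 by convention\<close>
  have dpos: "m + l > 0"
  proof (rule ccontr)
    assume "\<not> m + l > 0"
    then have "f = const2 (coeff (coeff f 0) 0)"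
      using box by (intro poly2_eqI) (auto simp: in_box_def const2_def coeff_pCons split: nat.splits)
    then show False using is_unit_const2 nz f \<open>\<not> m + l > 0\<close> by (metis add_is_0 gr0I irreducible_def)
  qed
  define c where "c = inverse (coeff (coeff f l) m)"
  define g where "g = const2 c * f - monom (monom 1 m) l"
  have c: "c \<noteq> 0" using nz by (simp add: c_def)
  have g: "coeff (coeff g j) i = c * coeff (coeff f j) i - (if i = m \<and> j = l then 1 else 0)" for i j
    by (simp add: g_def coeff_const2_mult)
  have mono: "i \<le> m \<and> j \<le> l \<and> i + j < m + l" if "coeff (coeff g j) i \<noteq> 0" for i j
  proof -
    have "(i, j) \<noteq> (m, l)" using that nz by (auto simp: g c_def)
    then have "coeff (coeff f j) i \<noteq> 0" using that by (auto simp: g)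
    then have "i \<le> m" "j \<le> l" using box by (auto simp: in_box_def)
    then show ?thesis using \<open>(i, j) \<noteq> (m, l)\<close> by auto
  qed
  have "total_degree g < m + l \<and> degree_X g \<le> m \<and> degree g \<le> l"
  proof (cases "g = 0")
    case True
    then show ?thesis using dpos by (simp add: total_degree_def degree_X_def)
  next
    case False
    obtain i j where "coeff (coeff g j) i \<noteq> 0" "i + j = total_degree g" by (rule total_degree_attained[OF False])
    moreover obtain j' where "coeff (coeff g j') (degree_X g) \<noteq> 0" by (rule degree_X_attained[OF False])
    moreover have "coeff g (degree g) \<noteq> 0" using False by simp
    then obtain i' where "coeff (coeff g (degree g)) i' \<noteq> 0" by (metis poly_eqI coeff_0)
    ultimately show ?thesis using mono by metis
  qed
  then show ?normal using c d by (intro exI[of _ c] exI[of _ g]) (simp add: g_def)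
qed

text \<open>
  A factorization over $K$ is one over the algebraic closure, and a polynomial that becomes a constant
  there is constant.
\<close>
lemma irreducible_if_geometrically_irreducible:
  fixes f :: "'a::field poly poly"
  assumes "geometrically_irreducible f" shows "irreducible f"
proof (rule irreducibleI)
  define \<beta> :: "'a poly poly \<Rightarrow> 'a alg_closure poly poly" where "\<beta> = map_poly (map_poly to_ac)"
  have \<beta>: "coeff (coeff (\<beta> g) j) i = to_ac (coeff (coeff g j) i)" for g i j
    by (simp add: \<beta>_def coeff_map_poly)
  have mult: "\<beta> (g * h) = \<beta> g * \<beta> h" for g h
    by (rule poly2_eqI) (simp add: \<beta> coeff_mult coeff_sum to_ac_sum)
  have irr: "irreducible (\<beta> f)" using assms by (simp add: geometrically_irreducible_def \<beta>_def)
  have const: "\<beta> (const2 c) = const2 (to_ac c)" for c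
    by (rule poly2_eqI) (auto simp: \<beta> const2_def coeff_pCons split: nat.splits)
  have unit: "is_unit g" if u: "is_unit (\<beta> g)" for g
  proof -
    have "\<exists>c. \<beta> g = const2 c" using u by (auto simp: is_unit_poly_iff const2_def)
    then obtain c where c: "\<beta> g = const2 c" by blast
    define a where "a = coeff (coeff g 0) 0"
    have "to_ac (coeff (coeff g j) i) = (if i = 0 \<and> j = 0 then c else 0)" for i j
      unfolding \<beta>[symmetric] c by (auto simp: const2_def coeff_pCons split: nat.splits)
    then have coeffs: "coeff (coeff g j) i = 0" if "\<not> (i = 0 \<and> j = 0)" for i j
      using that by (metis to_ac_eq_0_iff)
    have g: "g = const2 a"
      by (rule poly2_eqI) (auto simp: const2_def coeff_pCons coeffs a_def split: nat.splits)
    have "a \<noteq> 0"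
    proof
      assume "a = 0"
      then have "g = 0" by (simp add: g const2_def)
      then show False using u by (simp add: \<beta>_def)
    qed
    then show ?thesis unfolding g by (rule is_unit_const2)
  qed
  show "f \<noteq> 0" using irr by (auto simp: \<beta>_def irreducible_def)
  show "\<not> is_unit f"
  proof
    assume "is_unit f"
    then obtain h where "1 = f * h" by (auto simp: dvd_def)
    then have "\<beta> f * \<beta> h = \<beta> (const2 1)" by (simp add: const2_def one_pCons flip: mult)
    then have "\<beta> f * \<beta> h = 1" unfolding const by (simp add: const2_def one_pCons)
    then have "is_unit (\<beta> f)" by (metis dvd_triv_left)
    then show False using irr by (simp add: irreducible_def)
  qed
  fix g h assume "f = g * h"
  then have "is_unit (\<beta> g) \<or> is_unit (\<beta> h)" using irr mult irreducibleD by metis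
  then show "is_unit g \<or> is_unit h" using unit by blast
qed

text \<open>
  By \<open>no_common_pole_iff\<close> and the degrees of the two pole divisors, (a) says that the bidegree of \<open>f\<close>
  is $(m,l)$ and that its corner coefficient is nonzero; so do (b) and (c), by \<open>normal_form_iff\<close> and
  \<open>multiplicities_iff\<close>.
\<close>
theorem theorem5p2:
  fixes f :: "'a::field poly poly"
    and \<iota> :: "'a \<Rightarrow> 'f::field"
    and x y :: 'f
    and d l m :: nat
  assumes "geometrically_irreducible f"
    and "total_degree f = d"
    and "is_function_field f \<iota>"
    and "adjoin2 \<iota> x y = UNIV"
    and "eval2 \<iota> f x y = 0"
  shows "(((\<nexists>v. is_place \<iota> v \<and> is_pole_at v x \<and> is_pole_at v y) \<and>
            divisor_degree \<iota> (pole_divisor \<iota> x) = int l \<and>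
            divisor_degree \<iota> (pole_divisor \<iota> y) = int m)
          \<longleftrightarrow> (point_multiplicity f (1, 0, 0) = l \<and>
               point_multiplicity f (0, 1, 0) = m \<and> m + l = d))
       \<and> ((\<exists>c g. c \<noteq> 0 \<and> const2 c * f = monom (monom 1 m) l + g \<and>
              total_degree g < d \<and> d = m + l \<and> degree_X g \<le> m \<and> degree_Y g \<le> l)
          \<longleftrightarrow> (point_multiplicity f (1, 0, 0) = l \<and>
               point_multiplicity f (0, 1, 0) = m \<and> m + l = d))"
proof -
  have irr: "irreducible f" using assms(1) by (rule irreducible_if_geometrically_irreducible)
  obtain \<xi> \<eta> where emb: "field_embedding \<iota>" and rel: "\<And>g. eval2 \<iota> g \<xi> \<eta> = 0 \<longleftrightarrow> f dvd g"
    and gen: "adjoin2 \<iota> \<xi> \<eta> = UNIV" using assms(3) by (auto simp: is_function_field_def)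
  interpret coords: function_field \<iota> f \<xi> \<eta>
    by unfold_locales (use irr emb rel gen in auto)
  interpret function_field \<iota> f x y by (rule coords.other_generators[OF assms(4,5)])
  show ?thesis
    unfolding assms(2)[symmetric] multiplicities_iff[OF f_nonzero] normal_form_iff[OF irr]
      no_common_pole_iff degree_of_poles_of_x degree_of_poles_of_y
    by auto
qed

end
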